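(* (1) For every $s\geqslant0$ and every formula $\varphi$ of $TI_s$: if $TI_s\vdash\varphi$ then $SLP_s\vdash int(\bar\varphi)$, where $\bar\varphi$ is the universal closure of $\varphi$. (2) For every formula $\varphi$ of $TI$: if $TI\vdash\varphi$ then $SLP\vdash int(\bar\varphi)$.
   Context: Classical theory $TI$: variables $x^n$ of each type $n\geqslant0$; $0,S,+,\cdot$ on type 0; predicates $=_n$, $\in_n$ ($t\in_n\tau$ with $t$ of type $n$, $\tau$ of type $n+1$); type-0 terms built from variables and $0$ with $S,+,\cdot$, higher-type terms are variables. $srt(\varphi)$ = maximal type of free variables. Axioms (classical logic with equality): successor/addition/multiplication axioms of Peano arithmetic, induction on type 0 for all formulas, comprehension $\exists x^{n+1}\forall z^n(z\in x\equiv\varphi(z))$ for $srt(\varphi)\leqslant n+1$, $x$ not free in $\varphi$, extensionality $\forall z^n(z\in x^{n+1}\equiv z\in y^{n+1})\supset x=y$. $TI_s$: fragment with types $\leqslant s$. Intuitionistic theory $SLP=LP+(LL)+(C)+(BI)$ and its fragments $SLP_s$ (types $\leqslant s$; all schemas restricted to the language $LP_s$). Language $L$: number variables $x,y,\dots$; for $n\geqslant1$ variables $F^n$ ($n$-functionals), $A^n$ (lawlike), $\mathcal F^n$ (lawless) of type $n$; constants $0,K^n$; symbols $S,+,\cdot,N^n$, and application $Z(t)$ lowering type by one (a 1-functional applied to a term is a term); atomic formulas $t=_0\tau$, $Z=_nV$. $LP$ adds atomic formulas $\vdash_z\varphi(\bar X)$ for formulas $\varphi$ of $L$. $sort(\varphi)$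 = maximal type of free variables. $LP$: intuitionistic logic with equality; Peano axioms for $S,+,\cdot$; induction for all formulas; $K^{n+1}(x)=K^n$ ($K^0:=0$), $\neg(N^n(F)=K^n)$, $N^{n+1}(F)(x)=N^n(F(x))$, $N^n(F)=N^n(G)\supset F=G$; $\exists A^1\forall x(A(x)=t)$ for terms $t$ with only number and lawlike 1-functional variables; (CS1) $(\vdash_z\varphi)\vee\neg(\vdash_z\varphi)$, (CS2) $(\vdash_z\varphi)\supset(\vdash_{z+y}\varphi)$, (CS3) $\exists z(\vdash_z\varphi)\equiv\varphi$ ($\varphi$ in $L$). (LL): (LL1) $\exists\mathcal F^n(\forall y\leqslant x)(\mathcal F(y)=F^n(y))$; (LL2) $\mathcal F^n=\mathcal G^n\vee\mathcal F^n\neq\mathcal G^n$; (LL3) $\varphi(\mathcal H^n)\supset\exists x\forall\mathcal G^n[(\forall y<x)(\mathcal G(y)=\mathcal H(y))\supset\varphi(\mathcal G)]$ for $\varphi$ in $LP$, $sort(\varphi)\leqslant n$, no free $F^n$ or $\mathcal F^n$-type variables other than $\mathcal H^n$. (C): (C1) $\forall x\exists y\varphi(x,y)\supset\exists F^m\forall x\varphi(x,F(x)(0)^{m-1})$ for $m\geqslant\max(sort\varphi,1)$; (C2) $\forall x\exists!G^n\varphi(x,G)\supset\exists F^m\forall x\varphi(x,F(x)(0)^{m-n-1})$ for $m\geqslant\max(sort\varphi,n+1)$, where $F(0)^k$ is $F(0)\cdots(0)$ ($k$ times). (BI) bar induction: with $y$ ranging over codes of finite sequences of numbers, $*$ concatenation,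 $\bar F(x)=\langle F(0),\dots,F(x-1)\rangle$: $\forall F^1\exists x\varphi(\bar F(x))\wedge\forall x\forall y[\varphi(y)\supset\varphi(y*\langle x\rangle)]\wedge\forall y[\forall x\psi(y*\langle x\rangle)\supset\psi(y)]\wedge\forall y[\varphi(y)\supset\psi(y)]\supset\psi(\langle\rangle)$. Translation $int(\varphi)=((\varphi^* )')^-$. (i) $\approx_n$: $x^0\approx_0y^0$ is $x=y$; $x^{n+1}\approx_{n+1}y^{n+1}$ is $(\forall z^n\in x)(\exists u^n\in y)(z\approx_nu)\wedge(\forall z^n\in y)(\exists u^n\in x)(z\approx_nu)$; $(t=_n\tau)^*$ is $t\approx_n\tau$, $(t\in_n\tau)^*$ is $(\exists z^n\in\tau)(z\approx_nt)$, $*$ commutes with $\bot$, connectives, quantifiers. (ii) $'$: type-0 variable $x_i^0\mapsto x_i$ (numerical terms otherwise unchanged), $x_i^n\mapsto F_i^n$ for $n\geqslant1$; $(t=_n\tau)'$ is $t'=_n\tau'$; $(t\in_0\tau)'$ is $\exists y[\tau'(y)=S(t')]$; $(t\in_n\tau)'$ ($n\geqslant1$) is $\exists y[\tau'(y)=N^n(t')]$; $'$ commutes with $\bot$, connectives and quantifiers. (iii) $^-$ on $SLP$-formulas: atomic $\varphi\mapsto\neg\neg\varphi$; $\bot^-=\bot$; commutes with $\wedge,\supset,\forall$; $(\psi\vee\chi)^-=\neg(\neg\psi^-\wedge\neg\chi^-)$; $(\exists X\psi)^-=\neg\forall X\neg\psi^-$. *)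

theory Defs
  imports Main "HOL-Library.Product_Lexorder"
begin

text \<open>Deep embedding of the classical simple type theory TI (and its fragments TI_s),
of the intuitionistic theory SLP = LP + (LL) + (C) + (BI) (and its fragments SLP_s),
and of the translation int = ((_*)')^-.
A bound s :: nat option encodes the fragment: Some s = types at most s, None = no bound.\<close>

definition typeok :: "nat option \<Rightarrow> nat \<Rightarrow> bool" where
  "typeok s n = (case s of None \<Rightarrow> True | Some k \<Rightarrow> n \<le> k)"

text \<open>TV n i is the variable x_i^n of type n.  Type-0 terms are built from variables and 0
with S, +, *; higher-type terms are variables.\<close>
datatype ttm = TV nat nat | TZ | TS ttm | TAdd ttm ttm | TMul ttm ttm

text \<open>TEq n t u is t =_n u; TIn n t u is t \<in>_n u (t of type n, u of type n+1);
TAll n i / TEx n i bind the variable x_i^n.\<close>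
datatype tfm = TEq nat ttm ttm | TIn nat ttm ttm | TBot
  | TAnd tfm tfm | TOr tfm tfm | TImp tfm tfm | TAll nat nat tfm | TEx nat nat tfm

fun twt :: "ttm \<Rightarrow> nat \<Rightarrow> bool" where
  "twt (TV m i) n = (m = n)"
| "twt TZ n = (n = 0)"
| "twt (TS a) n = (n = 0 \<and> twt a 0)"
| "twt (TAdd a b) n = (n = 0 \<and> twt a 0 \<and> twt b 0)"
| "twt (TMul a b) n = (n = 0 \<and> twt a 0 \<and> twt b 0)"

fun tvs :: "ttm \<Rightarrow> (nat \<times> nat) set" where
  "tvs (TV n i) = {(n, i)}"
| "tvs TZ = {}"
| "tvs (TS a) = tvs a"
| "tvs (TAdd a b) = tvs a \<union> tvs b"
| "tvs (TMul a b) = tvs a \<union> tvs b"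

fun tfv :: "tfm \<Rightarrow> (nat \<times> nat) set" where
  "tfv (TEq n a b) = tvs a \<union> tvs b"
| "tfv (TIn n a b) = tvs a \<union> tvs b"
| "tfv TBot = {}"
| "tfv (TAnd p q) = tfv p \<union> tfv q"
| "tfv (TOr p q) = tfv p \<union> tfv q"
| "tfv (TImp p q) = tfv p \<union> tfv q"
| "tfv (TAll n i p) = tfv p - {(n, i)}"
| "tfv (TEx n i p) = tfv p - {(n, i)}"

fun tsub :: "nat \<times> nat \<Rightarrow> ttm \<Rightarrow> ttm \<Rightarrow> ttm" where
  "tsub v t (TV n i) = (if (n, i) = v then t else TV n i)"
| "tsub v t TZ = TZ"
| "tsub v t (TS a) = TS (tsub v t a)"
| "tsub v t (TAdd a b) = TAdd (tsub v t a) (tsub v t b)"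
| "tsub v t (TMul a b) = TMul (tsub v t a) (tsub v t b)"

text \<open>Substitution of t for the free occurrences of v (no renaming; used only together
with the side condition tfree_for).\<close>
fun tsubst :: "nat \<times> nat \<Rightarrow> ttm \<Rightarrow> tfm \<Rightarrow> tfm" where
  "tsubst v t (TEq n a b) = TEq n (tsub v t a) (tsub v t b)"
| "tsubst v t (TIn n a b) = TIn n (tsub v t a) (tsub v t b)"
| "tsubst v t TBot = TBot"
| "tsubst v t (TAnd p q) = TAnd (tsubst v t p) (tsubst v t q)"
| "tsubst v t (TOr p q) = TOr (tsubst v t p) (tsubst v t q)"
| "tsubst v t (TImp p q) = TImp (tsubst v t p) (tsubst v t q)"
| "tsubst v t (TAll n i p) = (if (n, i) = v then TAll n i p else TAll n i (tsubst v t p))"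
| "tsubst v t (TEx n i p) = (if (n, i) = v then TEx n i p else TEx n i (tsubst v t p))"

fun tfree_for :: "ttm \<Rightarrow> nat \<times> nat \<Rightarrow> tfm \<Rightarrow> bool" where
  "tfree_for t v (TEq n a b) = True"
| "tfree_for t v (TIn n a b) = True"
| "tfree_for t v TBot = True"
| "tfree_for t v (TAnd p q) = (tfree_for t v p \<and> tfree_for t v q)"
| "tfree_for t v (TOr p q) = (tfree_for t v p \<and> tfree_for t v q)"
| "tfree_for t v (TImp p q) = (tfree_for t v p \<and> tfree_for t v q)"
| "tfree_for t v (TAll n i p) = (v \<notin> tfv (TAll n i p) \<or> ((n, i) \<notin> tvs t \<and> tfree_for t v p))"
| "tfree_for t v (TEx n i p) = (v \<notin> tfv (TEx n i p) \<or> ((n, i) \<notin> tvs t \<and> tfree_for t v p))"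

fun twfs :: "nat option \<Rightarrow> tfm \<Rightarrow> bool" where
  "twfs s (TEq n a b) = (typeok s n \<and> twt a n \<and> twt b n)"
| "twfs s (TIn n a b) = (typeok s (Suc n) \<and> twt a n \<and> twt b (Suc n))"
| "twfs s TBot = True"
| "twfs s (TAnd p q) = (twfs s p \<and> twfs s q)"
| "twfs s (TOr p q) = (twfs s p \<and> twfs s q)"
| "twfs s (TImp p q) = (twfs s p \<and> twfs s q)"
| "twfs s (TAll n i p) = (typeok s n \<and> twfs s p)"
| "twfs s (TEx n i p) = (typeok s n \<and> twfs s p)"

definition tneg :: "tfm \<Rightarrow> tfm" where "tneg p = TImp p TBot"
definition tiff :: "tfm \<Rightarrow> tfm \<Rightarrow> tfm" where "tiff p q = TAnd (TImp p q) (TImp q p)"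

inductive tax :: "tfm \<Rightarrow> bool" where
  tK: "tax (TImp p (TImp q p))"
| tS: "tax (TImp (TImp p (TImp q r)) (TImp (TImp p q) (TImp p r)))"
| tC1: "tax (TImp (TAnd p q) p)"
| tC2: "tax (TImp (TAnd p q) q)"
| tC3: "tax (TImp p (TImp q (TAnd p q)))"
| tD1: "tax (TImp p (TOr p q))"
| tD2: "tax (TImp q (TOr p q))"
| tD3: "tax (TImp (TImp p r) (TImp (TImp q r) (TImp (TOr p q) r)))"
| tEFQ: "tax (TImp TBot p)"
| tDNE: "tax (TImp (tneg (tneg p)) p)"
| tAllE: "twt t n \<Longrightarrow> tfree_for t (n, i) p \<Longrightarrow> tax (TImp (TAll n i p) (tsubst (n, i) t p))"
| tExI: "twt t n \<Longrightarrow> tfree_for t (n, i) p \<Longrightarrow> tax (TImp (tsubst (n, i) t p) (TEx n i p))"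
| tRefl: "twt t n \<Longrightarrow> tax (TEq n t t)"
| tLeib: "twt a n \<Longrightarrow> twt b n \<Longrightarrow> tfree_for a (n, i) p \<Longrightarrow> tfree_for b (n, i) p \<Longrightarrow>
     tax (TImp (TEq n a b) (TImp (tsubst (n, i) a p) (tsubst (n, i) b p)))"
| tP1: "tax (tneg (TEq 0 (TS (TV 0 0)) TZ))"
| tP2: "tax (TImp (TEq 0 (TS (TV 0 0)) (TS (TV 0 1))) (TEq 0 (TV 0 0) (TV 0 1)))"
| tP3: "tax (TEq 0 (TAdd (TV 0 0) TZ) (TV 0 0))"
| tP4: "tax (TEq 0 (TAdd (TV 0 0) (TS (TV 0 1))) (TS (TAdd (TV 0 0) (TV 0 1))))"
| tP5: "tax (TEq 0 (TMul (TV 0 0) TZ) TZ)"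
| tP6: "tax (TEq 0 (TMul (TV 0 0) (TS (TV 0 1))) (TAdd (TMul (TV 0 0) (TV 0 1)) (TV 0 0)))"
| tInd: "tax (TImp (TAnd (tsubst (0, i) TZ p) (TAll 0 i (TImp p (tsubst (0, i) (TS (TV 0 i)) p))))
              (TAll 0 i p))"
| tComp: "(\<forall>v\<in>tfv p. fst v \<le> Suc n) \<Longrightarrow> (Suc n, j) \<notin> tfv p \<Longrightarrow>
     tax (TEx (Suc n) j (TAll n k (tiff (TIn n (TV n k) (TV (Suc n) j)) p)))"
| tExt: "tax (TImp (TAll n 0 (tiff (TIn n (TV n 0) (TV (Suc n) 0)) (TIn n (TV n 0) (TV (Suc n) 1))))
              (TEq (Suc n) (TV (Suc n) 0) (TV (Suc n) 1)))"

inductive tprov :: "nat option \<Rightarrow> tfm \<Rightarrow> bool" for s where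
  tprov_ax: "tax p \<Longrightarrow> twfs s p \<Longrightarrow> tprov s p"
| tprov_mp: "tprov s (TImp p q) \<Longrightarrow> tprov s p \<Longrightarrow> tprov s q"
| tprov_gen: "tprov s (TImp q p) \<Longrightarrow> (n, i) \<notin> tfv q \<Longrightarrow> typeok s n \<Longrightarrow> tprov s (TImp q (TAll n i p))"
| tprov_exe: "tprov s (TImp p q) \<Longrightarrow> (n, i) \<notin> tfv q \<Longrightarrow> typeok s n \<Longrightarrow> tprov s (TImp (TEx n i p) q)"

definition tclose :: "tfm \<Rightarrow> tfm" where
  "tclose p = foldr (\<lambda>v q. TAll (fst v) (snd v) q) (sorted_list_of_set (tfv p)) p"

text \<open>Sorts: number variables, n-functionals F^n, lawlike A^n, lawless (script F)^n (n \<ge> 1).\<close>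
datatype lsort = Num | Fn nat | Law nat | Lls nat

fun stype :: "lsort \<Rightarrow> nat" where
  "stype Num = 0" | "stype (Fn n) = n" | "stype (Law n) = n" | "stype (Lls n) = n"

definition sok :: "lsort \<Rightarrow> bool" where "sok X = (X = Num \<or> 1 \<le> stype X)"

text \<open>Terms: LV X i variable; LZ = 0; LKc n = K^n (n \<ge> 1); S, +, *; LN n t = N^n(t) (n \<ge> 1);
LAp Z t = Z(t).\<close>
datatype ltm = LV lsort nat | LZ | LKc nat | LS ltm | LAdd ltm ltm | LMul ltm ltm
  | LN nat ltm | LAp ltm ltm

text \<open>Formulas of LP; LPr z p is the atomic formula \<turnstile>_z p (p a formula of L).\<close>
datatype lfm = LEq nat ltm ltm | LPr ltm lfm | LBot
  | LAnd lfm lfm | LOr lfm lfm | LImp lfm lfm | LAll lsort nat lfm | LEx lsort nat lfm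

fun kk :: "nat \<Rightarrow> ltm" where "kk 0 = LZ" | "kk (Suc n) = LKc (Suc n)"

fun lwt :: "ltm \<Rightarrow> nat \<Rightarrow> bool" where
  "lwt (LV X i) n = (sok X \<and> stype X = n)"
| "lwt LZ n = (n = 0)"
| "lwt (LKc m) n = (1 \<le> m \<and> m = n)"
| "lwt (LS a) n = (n = 0 \<and> lwt a 0)"
| "lwt (LAdd a b) n = (n = 0 \<and> lwt a 0 \<and> lwt b 0)"
| "lwt (LMul a b) n = (n = 0 \<and> lwt a 0 \<and> lwt b 0)"
| "lwt (LN m a) n = (1 \<le> m \<and> m = n \<and> lwt a m)"
| "lwt (LAp f a) n = (lwt f (Suc n) \<and> lwt a 0)"

fun ltys :: "ltm \<Rightarrow> nat set" where
  "ltys (LV X i) = {stype X}"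
| "ltys LZ = {}"
| "ltys (LKc m) = {m}"
| "ltys (LS a) = ltys a"
| "ltys (LAdd a b) = ltys a \<union> ltys b"
| "ltys (LMul a b) = ltys a \<union> ltys b"
| "ltys (LN m a) = insert m (ltys a)"
| "ltys (LAp f a) = ltys f \<union> ltys a"

definition ltm_ok :: "nat option \<Rightarrow> ltm \<Rightarrow> nat \<Rightarrow> bool" where
  "ltm_ok s t n = (lwt t n \<and> (\<forall>k\<in>ltys t. typeok s k))"

fun lvs :: "ltm \<Rightarrow> (lsort \<times> nat) set" where
  "lvs (LV X i) = {(X, i)}"
| "lvs LZ = {}"
| "lvs (LKc m) = {}"
| "lvs (LS a) = lvs a"
| "lvs (LAdd a b) = lvs a \<union> lvs b"
| "lvs (LMul a b) = lvs a \<union> lvs b"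
| "lvs (LN m a) = lvs a"
| "lvs (LAp f a) = lvs f \<union> lvs a"

fun lfv :: "lfm \<Rightarrow> (lsort \<times> nat) set" where
  "lfv (LEq n a b) = lvs a \<union> lvs b"
| "lfv (LPr z p) = lvs z \<union> lfv p"
| "lfv LBot = {}"
| "lfv (LAnd p q) = lfv p \<union> lfv q"
| "lfv (LOr p q) = lfv p \<union> lfv q"
| "lfv (LImp p q) = lfv p \<union> lfv q"
| "lfv (LAll X i p) = lfv p - {(X, i)}"
| "lfv (LEx X i p) = lfv p - {(X, i)}"

fun lidx :: "lfm \<Rightarrow> nat set" where
  "lidx (LEq n a b) = snd ` (lvs a \<union> lvs b)"
| "lidx (LPr z p) = snd ` lvs z \<union> lidx p"
| "lidx LBot = {}"
| "lidx (LAnd p q) = lidx p \<union> lidx q"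
| "lidx (LOr p q) = lidx p \<union> lidx q"
| "lidx (LImp p q) = lidx p \<union> lidx q"
| "lidx (LAll X i p) = insert i (lidx p)"
| "lidx (LEx X i p) = insert i (lidx p)"

fun lsub :: "lsort \<times> nat \<Rightarrow> ltm \<Rightarrow> ltm \<Rightarrow> ltm" where
  "lsub v t (LV X i) = (if (X, i) = v then t else LV X i)"
| "lsub v t LZ = LZ"
| "lsub v t (LKc m) = LKc m"
| "lsub v t (LS a) = LS (lsub v t a)"
| "lsub v t (LAdd a b) = LAdd (lsub v t a) (lsub v t b)"
| "lsub v t (LMul a b) = LMul (lsub v t a) (lsub v t b)"
| "lsub v t (LN m a) = LN m (lsub v t a)"
| "lsub v t (LAp f a) = LAp (lsub v t f) (lsub v t a)"

fun lsubst :: "lsort \<times> nat \<Rightarrow> ltm \<Rightarrow> lfm \<Rightarrow> lfm" where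
  "lsubst v t (LEq n a b) = LEq n (lsub v t a) (lsub v t b)"
| "lsubst v t (LPr z p) = LPr (lsub v t z) (lsubst v t p)"
| "lsubst v t LBot = LBot"
| "lsubst v t (LAnd p q) = LAnd (lsubst v t p) (lsubst v t q)"
| "lsubst v t (LOr p q) = LOr (lsubst v t p) (lsubst v t q)"
| "lsubst v t (LImp p q) = LImp (lsubst v t p) (lsubst v t q)"
| "lsubst v t (LAll X i p) = (if (X, i) = v then LAll X i p else LAll X i (lsubst v t p))"
| "lsubst v t (LEx X i p) = (if (X, i) = v then LEx X i p else LEx X i (lsubst v t p))"

fun lfree_for :: "ltm \<Rightarrow> lsort \<times> nat \<Rightarrow> lfm \<Rightarrow> bool" where
  "lfree_for t v (LEq n a b) = True"
| "lfree_for t v (LPr z p) = lfree_for t v p"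
| "lfree_for t v LBot = True"
| "lfree_for t v (LAnd p q) = (lfree_for t v p \<and> lfree_for t v q)"
| "lfree_for t v (LOr p q) = (lfree_for t v p \<and> lfree_for t v q)"
| "lfree_for t v (LImp p q) = (lfree_for t v p \<and> lfree_for t v q)"
| "lfree_for t v (LAll X i p) = (v \<notin> lfv (LAll X i p) \<or> ((X, i) \<notin> lvs t \<and> lfree_for t v p))"
| "lfree_for t v (LEx X i p) = (v \<notin> lfv (LEx X i p) \<or> ((X, i) \<notin> lvs t \<and> lfree_for t v p))"

fun inL :: "lfm \<Rightarrow> bool" where
  "inL (LEq n a b) = True"
| "inL (LPr z p) = False"
| "inL LBot = True"
| "inL (LAnd p q) = (inL p \<and> inL q)"
| "inL (LOr p q) = (inL p \<and> inL q)"
| "inL (LImp p q) = (inL p \<and> inL q)"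
| "inL (LAll X i p) = inL p"
| "inL (LEx X i p) = inL p"

fun lwfs :: "nat option \<Rightarrow> lfm \<Rightarrow> bool" where
  "lwfs s (LEq n a b) = (typeok s n \<and> ltm_ok s a n \<and> ltm_ok s b n)"
| "lwfs s (LPr z p) = (ltm_ok s z 0 \<and> inL p \<and> lwfs s p)"
| "lwfs s LBot = True"
| "lwfs s (LAnd p q) = (lwfs s p \<and> lwfs s q)"
| "lwfs s (LOr p q) = (lwfs s p \<and> lwfs s q)"
| "lwfs s (LImp p q) = (lwfs s p \<and> lwfs s q)"
| "lwfs s (LAll X i p) = (sok X \<and> typeok s (stype X) \<and> lwfs s p)"
| "lwfs s (LEx X i p) = (sok X \<and> typeok s (stype X) \<and> lwfs s p)"

fun ladm :: "lsort \<Rightarrow> ltm \<Rightarrow> bool" where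
  "ladm Num t = lwt t 0"
| "ladm (Fn n) t = lwt t n"
| "ladm (Law n) t = (\<exists>i. t = LV (Law n) i)"
| "ladm (Lls n) t = (\<exists>i. t = LV (Lls n) i)"

definition lsrt_le :: "lfm \<Rightarrow> nat \<Rightarrow> bool" where
  "lsrt_le p m = (\<forall>v\<in>lfv p. stype (fst v) \<le> m)"

definition lnot :: "lfm \<Rightarrow> lfm" where "lnot p = LImp p LBot"
definition liff :: "lfm \<Rightarrow> lfm \<Rightarrow> lfm" where "liff p q = LAnd (LImp p q) (LImp q p)"

abbreviation nv :: "nat \<Rightarrow> ltm" where "nv i \<equiv> LV Num i"

definition lle :: "nat \<Rightarrow> ltm \<Rightarrow> ltm \<Rightarrow> lfm" where
  "lle w u v = LEx Num w (LEq 0 (LAdd u (nv w)) v)"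
definition llt :: "nat \<Rightarrow> ltm \<Rightarrow> ltm \<Rightarrow> lfm" where
  "llt w u v = LEx Num w (LEq 0 (LAdd u (LS (nv w))) v)"

fun appz :: "ltm \<Rightarrow> nat \<Rightarrow> ltm" where
  "appz t 0 = t" | "appz t (Suc k) = appz (LAp t LZ) k"

text \<open>We use the bijective coding: <> has code 0 and the code of s*<x> is
S(pair(code s, x)) with Cantor pairing pair(u,v) = ((u+v)(u+v+1))/2 + u.  So every number is the
code of exactly one finite sequence.  Bar F x is defined by the Goedel beta function
beta(a,c,i) = a mod (1 + (i+1) c).\<close>

definition lpair :: "ltm \<Rightarrow> ltm \<Rightarrow> ltm \<Rightarrow> lfm" where
  "lpair u v p = LEq 0 (LAdd p p) (LAdd (LMul (LAdd u v) (LS (LAdd u v))) (LAdd u u))"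

definition lbeta :: "nat \<Rightarrow> nat \<Rightarrow> ltm \<Rightarrow> ltm \<Rightarrow> ltm \<Rightarrow> ltm \<Rightarrow> lfm" where
  "lbeta q k a c i r = (let d = LS (LMul (LS i) c) in
     LEx Num q (LEx Num k (LAnd (LEq 0 a (LAdd (LMul (nv q) d) r))
                               (LEq 0 (LAdd r (LS (nv k))) d))))"

text \<open>w = code of <F(0),...,F(x-1)>, with bound variables of indices m .. m+7.\<close>
definition lbar :: "nat \<Rightarrow> ltm \<Rightarrow> ltm \<Rightarrow> ltm \<Rightarrow> lfm" where
  "lbar m F x w = (let a = nv m; c = nv (m+1); i = nv (m+2); u = nv (m+3); v = nv (m+4);
       p = nv (m+5); q = m+6; k = m+7 in
     LEx Num m (LEx Num (m+1) (LAnd (lbeta q k a c LZ LZ)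
       (LAnd (LAll Num (m+2) (LImp (llt k i x)
           (LEx Num (m+3) (LEx Num (m+4) (LEx Num (m+5)
              (LAnd (lbeta q k a c i u) (LAnd (lbeta q k a c (LS i) v)
                 (LAnd (lpair u (LAp F i) p) (LEq 0 v (LS p))))))))))
         (lbeta q k a c x w)))))"

definition lbi :: "lfm \<Rightarrow> lfm \<Rightarrow> nat \<Rightarrow> lfm" where
  "lbi p q y = (let b = Suc (Max (insert y (lidx p \<union> lidx q)));
       F = LV (Fn 1) b; x = nv b; w = nv (b+1); z = nv (b+2);
       P1 = LAll (Fn 1) b (LEx Num b (LEx Num (b+1)
              (LAnd (lbar (b+3) F x w) (lsubst (Num, y) w p))));
       P2 = LAll Num b (LAll Num y (LImp p
              (LEx Num (b+2) (LAnd (lpair (nv y) x z) (lsubst (Num, y) (LS z) p)))));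
       P3 = LAll Num y (LImp (LAll Num b
              (LEx Num (b+2) (LAnd (lpair (nv y) x z) (lsubst (Num, y) (LS z) q)))) q);
       P4 = LAll Num y (LImp p q)
     in LImp (LAnd P1 (LAnd P2 (LAnd P3 P4))) (lsubst (Num, y) LZ q))"

inductive lax :: "lfm \<Rightarrow> bool" where
  lK: "lax (LImp p (LImp q p))"
| lS: "lax (LImp (LImp p (LImp q r)) (LImp (LImp p q) (LImp p r)))"
| lC1: "lax (LImp (LAnd p q) p)"
| lC2: "lax (LImp (LAnd p q) q)"
| lC3: "lax (LImp p (LImp q (LAnd p q)))"
| lD1: "lax (LImp p (LOr p q))"
| lD2: "lax (LImp q (LOr p q))"
| lD3: "lax (LImp (LImp p r) (LImp (LImp q r) (LImp (LOr p q) r)))"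
| lEFQ: "lax (LImp LBot p)"
| lAllE: "ladm X t \<Longrightarrow> lfree_for t (X, i) p \<Longrightarrow> lax (LImp (LAll X i p) (lsubst (X, i) t p))"
| lExI: "ladm X t \<Longrightarrow> lfree_for t (X, i) p \<Longrightarrow> lax (LImp (lsubst (X, i) t p) (LEx X i p))"
| lRefl: "lwt t n \<Longrightarrow> lax (LEq n t t)"
| lLeib: "stype X = n \<Longrightarrow> ladm X a \<Longrightarrow> ladm X b \<Longrightarrow> lfree_for a (X, i) p \<Longrightarrow> lfree_for b (X, i) p \<Longrightarrow>
     lax (LImp (LEq n a b) (LImp (lsubst (X, i) a p) (lsubst (X, i) b p)))"
| lP1: "lax (lnot (LEq 0 (LS (nv 0)) LZ))"
| lP2: "lax (LImp (LEq 0 (LS (nv 0)) (LS (nv 1))) (LEq 0 (nv 0) (nv 1)))"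
| lP3: "lax (LEq 0 (LAdd (nv 0) LZ) (nv 0))"
| lP4: "lax (LEq 0 (LAdd (nv 0) (LS (nv 1))) (LS (LAdd (nv 0) (nv 1))))"
| lP5: "lax (LEq 0 (LMul (nv 0) LZ) LZ)"
| lP6: "lax (LEq 0 (LMul (nv 0) (LS (nv 1))) (LAdd (LMul (nv 0) (nv 1)) (nv 0)))"
| lInd: "lax (LImp (LAnd (lsubst (Num, i) LZ p) (LAll Num i (LImp p (lsubst (Num, i) (LS (nv i)) p))))
              (LAll Num i p))"
| lK1: "lax (LEq n (LAp (LKc (Suc n)) (nv 0)) (kk n))"
| lN1: "1 \<le> n \<Longrightarrow> lax (lnot (LEq n (LN n (LV (Fn n) 0)) (LKc n)))"
| lN2: "1 \<le> n \<Longrightarrow> lax (LEq n (LAp (LN (Suc n) (LV (Fn (Suc n)) 0)) (nv 0))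
                              (LN n (LAp (LV (Fn (Suc n)) 0) (nv 0))))"
| lN3: "1 \<le> n \<Longrightarrow> lax (LImp (LEq n (LN n (LV (Fn n) 0)) (LN n (LV (Fn n) 1)))
                              (LEq n (LV (Fn n) 0) (LV (Fn n) 1)))"
| lLaw: "lwt t 0 \<Longrightarrow> (\<forall>v\<in>lvs t. fst v = Num \<or> fst v = Law 1) \<Longrightarrow> (Law 1, j) \<notin> lvs t \<Longrightarrow>
     lax (LEx (Law 1) j (LAll Num i (LEq 0 (LAp (LV (Law 1) j) (nv i)) t)))"
| lCS1: "inL p \<Longrightarrow> lax (LOr (LPr (nv i) p) (lnot (LPr (nv i) p)))"
| lCS2: "inL p \<Longrightarrow> lax (LImp (LPr (nv i) p) (LPr (LAdd (nv i) (nv j)) p))"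
| lCS3: "inL p \<Longrightarrow> (Num, i) \<notin> lfv p \<Longrightarrow> lax (liff (LEx Num i (LPr (nv i) p)) p)"
| lLL1: "1 \<le> n \<Longrightarrow> lax (LEx (Lls n) 0 (LAll Num 1 (LImp (lle 2 (nv 1) (nv 0))
            (LEq (n - 1) (LAp (LV (Lls n) 0) (nv 1)) (LAp (LV (Fn n) 0) (nv 1))))))"
| lLL2: "1 \<le> n \<Longrightarrow> lax (LOr (LEq n (LV (Lls n) 0) (LV (Lls n) 1)) (lnot (LEq n (LV (Lls n) 0) (LV (Lls n) 1))))"
| lLL3: "1 \<le> n \<Longrightarrow> lsrt_le p n \<Longrightarrow>
     (\<forall>v\<in>lfv p. (fst v = Fn n \<or> fst v = Lls n) \<longrightarrow> v = (Lls n, h)) \<Longrightarrow>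
     g \<noteq> h \<Longrightarrow> (Lls n, g) \<notin> lfv p \<Longrightarrow> lfree_for (LV (Lls n) g) (Lls n, h) p \<Longrightarrow>
     distinct [a, b, c] \<Longrightarrow> (Num, a) \<notin> lfv p \<Longrightarrow>
     lax (LImp p (LEx Num a (LAll (Lls n) g
        (LImp (LAll Num b (LImp (llt c (nv b) (nv a))
                 (LEq (n - 1) (LAp (LV (Lls n) g) (nv b)) (LAp (LV (Lls n) h) (nv b)))))
              (lsubst (Lls n, h) (LV (Lls n) g) p)))))"
| lC1ax: "1 \<le> m \<Longrightarrow> lsrt_le p m \<Longrightarrow> i \<noteq> j \<Longrightarrow> (Fn m, f) \<notin> lfv p \<Longrightarrow>
     lfree_for (appz (LAp (LV (Fn m) f) (nv i)) (m - 1)) (Num, j) p \<Longrightarrow>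
     lax (LImp (LAll Num i (LEx Num j p))
               (LEx (Fn m) f (LAll Num i (lsubst (Num, j) (appz (LAp (LV (Fn m) f) (nv i)) (m - 1)) p))))"
| lC2ax: "1 \<le> n \<Longrightarrow> n + 1 \<le> m \<Longrightarrow> lsrt_le p m \<Longrightarrow> g \<noteq> g' \<Longrightarrow>
     (Fn n, g') \<notin> lfv p \<Longrightarrow> lfree_for (LV (Fn n) g') (Fn n, g) p \<Longrightarrow>
     (Fn m, f) \<notin> lfv p \<Longrightarrow>
     lfree_for (appz (LAp (LV (Fn m) f) (nv i)) (m - n - 1)) (Fn n, g) p \<Longrightarrow>
     lax (LImp (LAll Num i (LEx (Fn n) g (LAnd p
                 (LAll (Fn n) g' (LImp (lsubst (Fn n, g) (LV (Fn n) g') p)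
                                       (LEq n (LV (Fn n) g') (LV (Fn n) g)))))))
               (LEx (Fn m) f (LAll Num i
                  (lsubst (Fn n, g) (appz (LAp (LV (Fn m) f) (nv i)) (m - n - 1)) p))))"
| lBI: "lax (lbi p q y)"

inductive lprov :: "nat option \<Rightarrow> lfm \<Rightarrow> bool" for s where
  lprov_ax: "lax p \<Longrightarrow> lwfs s p \<Longrightarrow> lprov s p"
| lprov_mp: "lprov s (LImp p q) \<Longrightarrow> lprov s p \<Longrightarrow> lprov s q"
| lprov_gen: "lprov s (LImp q p) \<Longrightarrow> (X, i) \<notin> lfv q \<Longrightarrow> sok X \<Longrightarrow> typeok s (stype X) \<Longrightarrow>
     lprov s (LImp q (LAll X i p))"
| lprov_exe: "lprov s (LImp p q) \<Longrightarrow> (X, i) \<notin> lfv q \<Longrightarrow> sok X \<Longrightarrow> typeok s (stype X) \<Longrightarrow>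
     lprov s (LImp (LEx X i p) q)"

text \<open>(i) x \<approx>_n y.  The bound variables introduced at level n+1 have type n and indices 0, 1;
since the arguments have type n+1 no capture can occur.\<close>
fun approx :: "nat \<Rightarrow> ttm \<Rightarrow> ttm \<Rightarrow> tfm" where
  "approx 0 a b = TEq 0 a b"
| "approx (Suc n) a b =
     TAnd (TAll n 0 (TImp (TIn n (TV n 0) a) (TEx n 1 (TAnd (TIn n (TV n 1) b) (approx n (TV n 0) (TV n 1))))))
          (TAll n 0 (TImp (TIn n (TV n 0) b) (TEx n 1 (TAnd (TIn n (TV n 1) a) (approx n (TV n 0) (TV n 1))))))"

definition tfresh :: "nat \<Rightarrow> ttm \<Rightarrow> nat" where
  "tfresh n t = Suc (Max (insert 0 (snd ` {v \<in> tvs t. fst v = n})))"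

fun star :: "tfm \<Rightarrow> tfm" where
  "star (TEq n a b) = approx n a b"
| "star (TIn n a b) = (let z = tfresh n a in TEx n z (TAnd (TIn n (TV n z) b) (approx n (TV n z) a)))"
| "star TBot = TBot"
| "star (TAnd p q) = TAnd (star p) (star q)"
| "star (TOr p q) = TOr (star p) (star q)"
| "star (TImp p q) = TImp (star p) (star q)"
| "star (TAll n i p) = TAll n i (star p)"
| "star (TEx n i p) = TEx n i (star p)"

definition psort :: "nat \<Rightarrow> lsort" where "psort n = (if n = 0 then Num else Fn n)"

fun ptm :: "ttm \<Rightarrow> ltm" where
  "ptm (TV n i) = LV (psort n) i"
| "ptm TZ = LZ"
| "ptm (TS a) = LS (ptm a)"
| "ptm (TAdd a b) = LAdd (ptm a) (ptm b)"
| "ptm (TMul a b) = LMul (ptm a) (ptm b)"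

definition lfresh :: "ltm \<Rightarrow> nat" where
  "lfresh t = Suc (Max (insert 0 (snd ` {v \<in> lvs t. fst v = Num})))"

fun prime :: "tfm \<Rightarrow> lfm" where
  "prime (TEq n a b) = LEq n (ptm a) (ptm b)"
| "prime (TIn n a b) = (let y = lfresh (ptm a) in
     LEx Num y (LEq n (LAp (ptm b) (nv y)) (if n = 0 then LS (ptm a) else LN n (ptm a))))"
| "prime TBot = LBot"
| "prime (TAnd p q) = LAnd (prime p) (prime q)"
| "prime (TOr p q) = LOr (prime p) (prime q)"
| "prime (TImp p q) = LImp (prime p) (prime q)"
| "prime (TAll n i p) = LAll (psort n) i (prime p)"
| "prime (TEx n i p) = LEx (psort n) i (prime p)"

fun negt :: "lfm \<Rightarrow> lfm" where
  "negt (LEq n a b) = lnot (lnot (LEq n a b))"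
| "negt (LPr z p) = lnot (lnot (LPr z p))"
| "negt LBot = LBot"
| "negt (LAnd p q) = LAnd (negt p) (negt q)"
| "negt (LOr p q) = lnot (LAnd (lnot (negt p)) (lnot (negt q)))"
| "negt (LImp p q) = LImp (negt p) (negt q)"
| "negt (LAll X i p) = LAll X i (negt p)"
| "negt (LEx X i p) = lnot (LAll X i (lnot (negt p)))"

definition int :: "tfm \<Rightarrow> lfm" where
  "int p = negt (prime (star p))"

end

theory Submission
  imports Defs "HOL-Library.Countable"
begin

text \<open>
  The formulas whose negative translation is provable form a classical theory, so if the translation
  of a theorem were unprovable, a Henkin construction would give a classical model of that theory,
  built from terms of the intuitionistic language, in which the theorem fails.  In that model
  membership of \<open>a\<close> in \<open>b\<close> means that some value of \<open>b\<close> is the successor of \<open>a\<close>, and equality of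
  sets is the bisimulation \<open>approx\<close>.  All axioms of type theory hold there by inspection, except
  comprehension, which has to be derived intuitionistically.

  For comprehension, let \<open>h\<close> be lawless of type \<open>n + 1\<close>.  By the continuity axiom (LL3), \<open>h\<close> takes every
  object of type \<open>n\<close> as a value, beyond every bound, up to double negation.  Let \<open>F(i)\<close> be the
  successor of \<open>h(i)\<close> if the creating subject has proved \<open>\<phi>(h(i))\<close> by stage \<open>i\<close>, and \<open>K\<close>
  otherwise; this is a decidable case distinction, so choice yields \<open>F\<close>, and \<open>F\<close> enumerates the
  objects satisfying \<open>\<phi>\<close>.  Using stage \<open>i\<close> for the \<open>i\<close>-th value works without pairing, because
  each value recurs and proofs persist.
\<close>

subsection \<open>Terms, substitution and well-formedness\<close>

text \<open>The detour through models replaces formal derivations inside SLP: under the translation,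
  Leibniz's law and extensionality for the bisimulation become routine facts about a two-valued
  structure. What cannot be read off there is the existence of sets. The obstacle is (LL3): it
  admits only formulas of sort at most \<open>n + 1\<close> in which the lawless variable is the
  sole functional or lawless variable of type \<open>n + 1\<close>, whereas a comprehension formula
  may have set parameters of that type. Hence (LL3) is never applied to the comprehension formula,
  only to the statement that \<open>h\<close> attains a given object of type \<open>n\<close>. The
  parameters are met by choice, which asks only for sort at most \<open>n + 1\<close>; this is
  exactly the restriction on comprehension in TI. As no type above that of the set being formed is
  used, one argument covers all fragments and the full theory. Choice needs a decidable condition,
  and being proved by stage \<open>i\<close> is decidable where \<open>\<phi>\<close> itself need
  not be. The spare value \<open>K\<close> lets a total functional enumerate with gaps, so even the
  empty set has an enumeration.\<close>

lemma typeok_0 [simp]: "typeok s 0"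
  by (auto simp: typeok_def split: option.splits)

lemma typeok_Suc: "typeok s (Suc n) \<Longrightarrow> typeok s n"
  by (auto simp: typeok_def split: option.splits)

lemma ltm_ok_simps [simp]:
  "ltm_ok s (LV X i) n \<longleftrightarrow> sok X \<and> stype X = n \<and> typeok s n"
  "ltm_ok s LZ n \<longleftrightarrow> n = 0"
  "ltm_ok s (LKc m) n \<longleftrightarrow> 1 \<le> m \<and> m = n \<and> typeok s n"
  "ltm_ok s (LS a) n \<longleftrightarrow> n = 0 \<and> ltm_ok s a 0"
  "ltm_ok s (LAdd a b) n \<longleftrightarrow> n = 0 \<and> ltm_ok s a 0 \<and> ltm_ok s b 0"
  "ltm_ok s (LMul a b) n \<longleftrightarrow> n = 0 \<and> ltm_ok s a 0 \<and> ltm_ok s b 0"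
  "ltm_ok s (LN m a) n \<longleftrightarrow> 1 \<le> m \<and> m = n \<and> typeok s n \<and> ltm_ok s a m"
  "ltm_ok s (LAp f a) n \<longleftrightarrow> ltm_ok s f (Suc n) \<and> ltm_ok s a 0"
  by (auto simp: ltm_ok_def)

lemma ltm_ok_typeok: "ltm_ok s t n \<Longrightarrow> typeok s n"
  by (induction t arbitrary: n) (auto intro: typeok_Suc)

lemma ltm_ok_lwt: "ltm_ok s t n \<Longrightarrow> lwt t n"
  by (simp add: ltm_ok_def)

lemma sok_simps [simp]: "sok Num" "sok (Fn n) \<longleftrightarrow> 1 \<le> n" "sok (Law n) \<longleftrightarrow> 1 \<le> n"
  "sok (Lls n) \<longleftrightarrow> 1 \<le> n"
  by (auto simp: sok_def)

lemma sok_psort [simp]: "sok (psort n)"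
  by (simp add: psort_def)

lemma stype_psort [simp]: "stype (psort n) = n"
  by (simp add: psort_def)

lemma psort_0 [simp]: "psort 0 = Num"
  by (simp add: psort_def)

lemma psort_Suc [simp]: "psort (Suc n) = Fn (Suc n)"
  by (simp add: psort_def)

lemma psort_neq [simp]: "psort n \<noteq> Fn (Suc n)" "psort n \<noteq> Lls m" "psort n \<noteq> Law m"
  by (auto simp: psort_def)

lemma psort_neq' [simp]: "Fn (Suc n) \<noteq> psort n" "Lls m \<noteq> psort n" "Law m \<noteq> psort n"
  by (auto simp: psort_def)

lemma psort_inject [simp]: "psort m = psort n \<longleftrightarrow> m = n"
  by (auto simp: psort_def)

lemma ladm_psort [simp]: "ladm (psort n) t = lwt t n"
  by (cases n) auto

lemma ladm_LV [simp]: "sok X \<Longrightarrow> ladm X (LV X i)"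
  by (cases X) (auto simp: sok_def)

lemma finite_lvs [simp]: "finite (lvs t)"
  by (induction t) auto

lemma finite_lfv [simp]: "finite (lfv p)"
  by (induction p) auto

lemma finite_lidx [simp]: "finite (lidx p)"
  by (induction p) auto

lemma lfv_lidx: "v \<in> lfv p \<Longrightarrow> snd v \<in> lidx p"
  by (induction p) auto

text \<open>The index avoids the variables of every sort at once, which spares later proofs a case
  distinction on sorts.\<close>

lemma exists_fresh:
  fixes S :: "('a \<times> nat) set"
  assumes "finite S"
  obtains i where "\<And>X. (X, i) \<notin> S"
proof -
  obtain i where "i \<notin> snd ` S"
    using ex_new_if_finite[OF infinite_UNIV_nat, of "snd ` S"] assms by auto
  then show thesis by (intro that) force
qed

lemma lsub_fresh [simp]: "v \<notin> lvs t \<Longrightarrow> lsub v a t = t"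
  by (induction t) auto

lemma lsub_self: "lsub (X, i) (LV X i) t = t"
  by (induction t) auto

lemma lvs_lsub: "lvs (lsub v a t) = (if v \<in> lvs t then lvs t - {v} \<union> lvs a else lvs t)"
  by (induction t) auto

lemma lsubst_fresh [simp]: "v \<notin> lfv p \<Longrightarrow> lsubst v a p = p"
  by (induction p) auto

lemma lsubst_self [simp]: "lsubst (X, i) (LV X i) p = p"
  by (induction p) (auto simp: lsub_self)

lemma lfree_for_self [simp]: "lfree_for (LV X i) (X, i) p"
  by (induction p) auto

lemma lfree_for_fresh: "(\<And>w. w \<in> lvs t \<Longrightarrow> snd w \<notin> lidx p) \<Longrightarrow> lfree_for t v p"
  by (induction p) (auto, blast+)

lemma lfree_for_notin: "v \<notin> lfv p \<Longrightarrow> lfree_for t v p"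
  by (induction p) auto

lemma lsub_lsub: "snd v \<notin> snd ` lvs t \<Longrightarrow> lsub v a (lsub w b t) = lsub w (lsub v a b) t"
  by (induction t) auto

text \<open>Excluding the index of \<open>v\<close> from \<open>lidx p\<close> also excludes binders
  of \<open>v\<close> in \<open>p\<close>. The equation is then purely syntactic and needs no
  \<open>lfree_for\<close> condition.\<close>

lemma lsubst_lsubst:
  "v \<noteq> w \<Longrightarrow> snd v \<notin> lidx p \<Longrightarrow> lsubst v a (lsubst w b p) = lsubst w (lsub v a b) p"
  by (induction p) (auto simp: lsub_lsub image_Un intro!: lsubst_fresh dest: lfv_lidx)

lemma lfv_lsubst: "lfv (lsubst v a p) \<subseteq> lfv p - {v} \<union> lvs a"
  by (induction p) (auto simp: lvs_lsub split: if_splits)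

lemma size_lsubst [simp]: "size (lsubst (X, i) (LV X j) p) = size p"
  by (induction p) auto

lemma ltm_ok_lsub: "ltm_ok s t n \<Longrightarrow> ltm_ok s a (stype (fst v)) \<Longrightarrow> ltm_ok s (lsub v a t) n"
  by (induction t arbitrary: n) auto

lemma inL_lsubst [simp]: "inL (lsubst v a p) = inL p"
  by (induction p) auto

lemma lwfs_lsubst: "lwfs s p \<Longrightarrow> ltm_ok s a (stype (fst v)) \<Longrightarrow> lwfs s (lsubst v a p)"
  by (induction p) (auto intro: ltm_ok_lsub)

lemma lwfs_lnot [simp]: "lwfs s (lnot p) = lwfs s p"
  by (simp add: lnot_def)

lemma lfv_lnot [simp]: "lfv (lnot p) = lfv p"
  by (simp add: lnot_def)

lemma lsubst_lnot [simp]: "lsubst v t (lnot p) = lnot (lsubst v t p)"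
  by (simp add: lnot_def)

lemma lfree_for_lnot [simp]: "lfree_for t v (lnot p) = lfree_for t v p"
  by (simp add: lnot_def)

subsection \<open>Natural deduction for the intuitionistic calculus\<close>

lemma lprov_wf: "lprov s p \<Longrightarrow> lwfs s p"
  by (induction rule: lprov.induct) auto

text \<open>Hypotheses are stored as iterated implications with the head of the list innermost. The
  deduction theorem is then the defining equation, while weakening and modus ponens under hypotheses
  have to be proved.\<close>

fun nd :: "nat option \<Rightarrow> lfm list \<Rightarrow> lfm \<Rightarrow> bool" where
  "nd s [] q = lprov s q"
| "nd s (p # G) q = nd s G (LImp p q)"

abbreviation wfc :: "nat option \<Rightarrow> lfm list \<Rightarrow> bool" where
  "wfc s G \<equiv> \<forall>p\<in>set G. lwfs s p"

lemma nd_wf: "nd s G q \<Longrightarrow> wfc s G \<and> lwfs s q"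
proof (induction G arbitrary: q)
  case (Cons p G)
  then have "wfc s G \<and> lwfs s (LImp p q)" by (metis nd.simps(2))
  then show ?case by simp
qed (simp add: lprov_wf)

lemma lprov_imp_refl: "lwfs s p \<Longrightarrow> lprov s (LImp p p)"
  by (rule lprov_mp[OF lprov_mp[OF lprov_ax[OF lS[of p "LImp p p" p]]]])
    (auto intro!: lprov_ax lax.intros)

lemma nd_thm: "lprov s q \<Longrightarrow> wfc s G \<Longrightarrow> nd s G q"
proof (induction G arbitrary: q)
  case (Cons p G)
  have "lprov s (LImp p q)"
    by (rule lprov_mp[OF lprov_ax[OF lK]]) (use Cons.prems lprov_wf in auto)
  then show ?case using Cons by simp
qed simp

lemma nd_ax: "lax q \<Longrightarrow> lwfs s q \<Longrightarrow> wfc s G \<Longrightarrow> nd s G q"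
  by (simp add: nd_thm lprov_ax)

lemma nd_mp: "nd s G (LImp p q) \<Longrightarrow> nd s G p \<Longrightarrow> nd s G q"
proof (induction G arbitrary: p q)
  case Nil then show ?case by (simp add: lprov_mp[of s p q])
next
  case (Cons r G)
  have "nd s G (LImp (LImp r (LImp p q)) (LImp (LImp r p) (LImp r q)))"
    by (rule nd_ax[OF lS]) (use Cons.prems nd_wf in force)+
  then show ?case using Cons by (metis nd.simps(2))
qed

lemma nd_asm: "p \<in> set G \<Longrightarrow> wfc s G \<Longrightarrow> nd s G p"
proof (induction G)
  case (Cons r G)
  show ?case
  proof (cases "p \<in> set G")
    case True
    then have "nd s G p" using Cons by simp
    moreover have "nd s G (LImp p (LImp r p))"
      by (rule nd_ax[OF lK]) (use Cons.prems True in auto)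
    ultimately show ?thesis using nd_mp by auto
  next
    case False
    then show ?thesis using Cons.prems nd_thm lprov_imp_refl by auto
  qed
qed simp

lemma nd_mono: "nd s G p \<Longrightarrow> set G \<subseteq> set D \<Longrightarrow> wfc s D \<Longrightarrow> nd s D p"
proof (induction G arbitrary: p)
  case Nil then show ?case by (simp add: nd_thm)
next
  case (Cons q G)
  then have "nd s D (LImp q p)" by simp
  moreover have "nd s D q" using Cons.prems by (simp add: nd_asm)
  ultimately show ?case by (rule nd_mp)
qed

lemma nd_impI: "nd s (p # G) q \<Longrightarrow> nd s G (LImp p q)"
  by simp

lemma nd_notI: "nd s (p # G) LBot \<Longrightarrow> nd s G (lnot p)"
  by (simp add: lnot_def)

lemma nd_notE: "nd s G (lnot p) \<Longrightarrow> nd s G p \<Longrightarrow> nd s G LBot"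
  unfolding lnot_def by (rule nd_mp)

lemma nd_cut: "nd s G p \<Longrightarrow> nd s (p # G) q \<Longrightarrow> nd s G q"
  by (metis nd.simps(2) nd_mp)

lemma nd_conjI: "nd s G p \<Longrightarrow> nd s G q \<Longrightarrow> nd s G (LAnd p q)"
  by (rule nd_mp[OF nd_mp[OF nd_ax[OF lC3]]]) (use nd_wf in auto)

lemma nd_conjE1: "nd s G (LAnd p q) \<Longrightarrow> nd s G p"
  using nd_mp[OF nd_ax[OF lC1[of p q], of s G]] nd_wf[of s G "LAnd p q"] by simp

lemma nd_conjE2: "nd s G (LAnd p q) \<Longrightarrow> nd s G q"
  using nd_mp[OF nd_ax[OF lC2[of p q], of s G]] nd_wf[of s G "LAnd p q"] by simp

lemma nd_disjI1: "nd s G p \<Longrightarrow> lwfs s q \<Longrightarrow> nd s G (LOr p q)"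
  by (rule nd_mp[OF nd_ax[OF lD1]]) (use nd_wf in force)+

lemma nd_disjI2: "nd s G q \<Longrightarrow> lwfs s p \<Longrightarrow> nd s G (LOr p q)"
  by (rule nd_mp[OF nd_ax[OF lD2]]) (use nd_wf in force)+

lemma nd_disjE:
  assumes "nd s G (LOr p q)" "nd s (p # G) r" "nd s (q # G) r"
  shows "nd s G r"
proof -
  have "wfc s G" "lwfs s p" "lwfs s q" "lwfs s r" using assms nd_wf by force+
  then have "nd s G (LImp (LImp p r) (LImp (LImp q r) (LImp (LOr p q) r)))"
    by (intro nd_ax lD3) auto
  then show ?thesis using assms by (metis nd.simps(2) nd_mp)
qed

lemma nd_botE: "nd s G LBot \<Longrightarrow> lwfs s p \<Longrightarrow> nd s G p"
  by (rule nd_mp[OF nd_ax[OF lEFQ]]) (use nd_wf in auto)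

text \<open>The calculus generalises only the consequent of an implication, so a provable sentence
  without variables is supplied as antecedent and afterwards detached.\<close>

lemma lprov_all:
  assumes "lprov s p" "sok X" "typeok s (stype X)"
  shows "lprov s (LAll X i p)"
proof -
  let ?T = "LImp LBot LBot"
  have "lprov s (LImp ?T p)" using nd_thm[OF assms(1), of "[?T]"] by simp
  then have "lprov s (LImp ?T (LAll X i p))" using assms by (intro lprov_gen) auto
  then show ?thesis using lprov_imp_refl[of s LBot] lprov_mp by auto
qed

lemma nd_allE:
  "nd s G (LAll X i p) \<Longrightarrow> ladm X t \<Longrightarrow> ltm_ok s t (stype X) \<Longrightarrow> lfree_for t (X, i) p \<Longrightarrow>
    nd s G (lsubst (X, i) t p)"
  by (rule nd_mp[OF nd_ax[OF lAllE]]) (use nd_wf lwfs_lsubst in force)+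

lemma nd_exI:
  "nd s G (lsubst (X, i) t p) \<Longrightarrow> lwfs s (LEx X i p) \<Longrightarrow> ladm X t \<Longrightarrow> lfree_for t (X, i) p \<Longrightarrow>
    nd s G (LEx X i p)"
  by (rule nd_mp[OF nd_ax[OF lExI]]) (use nd_wf in auto)

lemma nd_allE_self: "nd s G (LAll X i p) \<Longrightarrow> nd s G p"
  using nd_allE[of s G X i p "LV X i"] nd_wf[of s G "LAll X i p"] by simp

text \<open>The rule \<open>lprov_gen\<close> has room for a single antecedent. The induction moves
  one hypothesis at a time under the quantifier and packs it together with the universal formula
  into a conjunction in which the bound variable is not free.\<close>

lemma nd_allI:
  assumes "nd s G p" "sok X" "typeok s (stype X)" "\<And>q. q \<in> set G \<Longrightarrow> (X, i) \<notin> lfv q"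
  shows "nd s G (LAll X i p)"
  using assms(1,4)
proof (induction G arbitrary: p)
  case Nil then show ?case using assms lprov_all by simp
next
  case (Cons q G)
  let ?a = "LAll X i (LImp q p)"
  have IH: "nd s G ?a" using Cons by simp
  then have wf: "wfc s G" "lwfs s q" "lwfs s p" using nd_wf by force+
  have "nd s [LAnd ?a q] ?a" "nd s [LAnd ?a q] q"
    using wf assms by (auto intro!: nd_conjE1[of s _ ?a q] nd_conjE2[of s _ ?a q] nd_asm simp del: nd.simps)
  then have "nd s [LAnd ?a q] p" using nd_allE_self nd_mp by blast
  then have "nd s [] (LImp (LAnd ?a q) (LAll X i p))"
    using assms Cons.prems by (auto intro!: lprov_gen)
  then have 1: "nd s (q # G) (LImp (LAnd ?a q) (LAll X i p))"
    by (rule nd_mono) (use wf in auto)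
  have 2: "nd s (q # G) ?a" by (rule nd_mono[OF IH]) (use wf in auto)
  have 3: "nd s (q # G) q" by (rule nd_asm) (use wf in auto)
  show ?case by (rule nd_mp[OF 1 nd_conjI[OF 2 3]])
qed

text \<open>The context is first absorbed into \<open>LAll X i (LImp p q)\<close>, where the
  variable is bound; the existential rule can then be applied without regard to
  \<open>G\<close>.\<close>

lemma nd_exE:
  assumes ex: "nd s G (LEx X i p)" and imp: "nd s (p # G) q"
    and fr: "(X, i) \<notin> lfv q" "\<And>r. r \<in> set G \<Longrightarrow> (X, i) \<notin> lfv r"
  shows "nd s G q"
proof -
  have wf: "wfc s G" "sok X" "typeok s (stype X)" "lwfs s p" "lwfs s q"
    using nd_wf[OF ex] nd_wf[OF imp] by auto
  let ?a = "LAll X i (LImp p q)"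
  have a: "nd s G ?a" using imp wf fr by (intro nd_allI) auto
  have "nd s [?a, p] (LImp p q)" by (rule nd_allE_self) (use wf in \<open>auto intro!: nd_asm simp del: nd.simps\<close>)
  moreover have "nd s [?a, p] p" by (rule nd_asm) (use wf in auto)
  ultimately have "nd s [?a, p] q" by (rule nd_mp)
  then have "nd s [] (LImp (LEx X i p) (LImp ?a q))"
    using wf fr by (auto intro!: lprov_exe)
  then have "nd s G (LImp (LEx X i p) (LImp ?a q))"
    by (rule nd_mono) (use wf in auto)
  then show ?thesis using nd_mp ex a by blast
qed

subsection \<open>Equality\<close>

lemma nd_refl: "ltm_ok s t n \<Longrightarrow> wfc s G \<Longrightarrow> nd s G (LEq n t t)"
  by (rule nd_ax[OF lRefl]) (auto simp: ltm_ok_lwt ltm_ok_typeok)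

lemma nd_eq_ok: "nd s G (LEq n a b) \<Longrightarrow> ltm_ok s a n \<and> ltm_ok s b n \<and> typeok s n \<and> wfc s G"
  using nd_wf by force

text \<open>The placeholder has sort \<open>psort n\<close> because only number and functional
  variables may be replaced by arbitrary terms; lawlike and lawless variables may only be
  renamed.\<close>

lemma nd_leib:
  assumes "nd s G (LEq n a b)" "nd s G (lsubst (psort n, i) a p)" "lwfs s p"
    "lfree_for a (psort n, i) p" "lfree_for b (psort n, i) p"
  shows "nd s G (lsubst (psort n, i) b p)"
proof -
  have ok: "ltm_ok s a n" "ltm_ok s b n" "wfc s G" "typeok s n" using nd_eq_ok[OF assms(1)] by auto
  have "nd s G (LImp (LEq n a b) (LImp (lsubst (psort n, i) a p) (lsubst (psort n, i) b p)))"
    by (rule nd_ax[OF lLeib]) (use ok assms in \<open>auto simp: ltm_ok_lwt intro!: lwfs_lsubst\<close>)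
  then show ?thesis using assms nd_mp by blast
qed

lemma nd_sym:
  assumes "nd s G (LEq n a b)" shows "nd s G (LEq n b a)"
proof -
  obtain i where "\<And>X. (X, i) \<notin> lvs a" using exists_fresh[OF finite_lvs] by blast
  with nd_leib[OF assms, of i "LEq n (LV (psort n) i) a"] show ?thesis
    using nd_eq_ok[OF assms] by (auto simp: nd_refl)
qed

lemma nd_trans:
  assumes ab: "nd s G (LEq n a b)" and bc: "nd s G (LEq n b c)" shows "nd s G (LEq n a c)"
proof -
  obtain i where "\<And>X. (X, i) \<notin> lvs a" using exists_fresh[OF finite_lvs] by blast
  with nd_leib[OF bc, of i "LEq n a (LV (psort n) i)"] show ?thesis
    using nd_eq_ok[OF ab] ab by auto
qed

text \<open>Leibniz is applied to the reflexive equation for \<open>t\<close> with \<open>a\<close>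
  inserted, of which only the right side is varied. The placeholder must be absent from
  \<open>a\<close> so that the fixed left side stays untouched.\<close>

lemma nd_cong:
  assumes ab: "nd s G (LEq k a b)" and t: "ltm_ok s t n" and i: "(psort k, i) \<notin> lvs a"
  shows "nd s G (LEq n (lsub (psort k, i) a t) (lsub (psort k, i) b t))"
proof -
  note ok = nd_eq_ok[OF ab]
  let ?t = "lsub (psort k, i) a t"
  have t': "ltm_ok s ?t n" using t ok by (auto intro: ltm_ok_lsub)
  moreover have "(psort k, i) \<notin> lvs ?t" using i by (auto simp: lvs_lsub)
  ultimately show ?thesis
    using nd_leib[OF ab, of i "LEq n ?t t"] ok t by (auto simp: nd_refl ltm_ok_typeok)
qed

lemma nd_cong_S:
  assumes ab: "nd s G (LEq 0 a b)" shows "nd s G (LEq 0 (LS a) (LS b))"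
proof -
  obtain i where "\<And>X. (X, i) \<notin> lvs a" using exists_fresh[OF finite_lvs] by blast
  with nd_cong[OF ab, of "LS (nv i)" 0 i] show ?thesis by simp
qed

lemma nd_cong_N:
  assumes ab: "nd s G (LEq n a b)" and "1 \<le> n" shows "nd s G (LEq n (LN n a) (LN n b))"
proof -
  obtain i where "\<And>X. (X, i) \<notin> lvs a" using exists_fresh[OF finite_lvs] by blast
  with nd_cong[OF ab, of "LN n (LV (psort n) i)" n i] show ?thesis
    using nd_eq_ok[OF ab] assms by auto
qed

text \<open>The function \<open>f\<close> stands for a binary term constructor with its arguments in
  either order; commuting with substitution is all that is asked of it.\<close>

lemma nd_cong_1:
  assumes ab: "nd s G (LEq k a b)" and c: "ltm_ok s c j"
    and f: "\<And>i. ltm_ok s (f (LV (psort k) i) c) n"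
    and sub: "\<And>v t u w. lsub v t (f u w) = f (lsub v t u) (lsub v t w)"
  shows "nd s G (LEq n (f a c) (f b c))"
proof -
  obtain i where i: "\<And>X. (X, i) \<notin> lvs a \<union> lvs c"
    using exists_fresh[of "lvs a \<union> lvs c"] by auto
  have "nd s G (LEq n (lsub (psort k, i) a (f (LV (psort k) i) c))
    (lsub (psort k, i) b (f (LV (psort k) i) c)))"
    using i by (intro nd_cong[OF ab] f) auto
  then show ?thesis using i by (simp add: sub)
qed

lemma nd_cong_Add:
  assumes "nd s G (LEq 0 a b)" "nd s G (LEq 0 c d)"
  shows "nd s G (LEq 0 (LAdd a c) (LAdd b d))"
proof (rule nd_trans)
  show "nd s G (LEq 0 (LAdd a c) (LAdd b c))"
    by (rule nd_cong_1[OF assms(1), of c 0]) (use nd_eq_ok[OF assms(2)] in auto)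
  show "nd s G (LEq 0 (LAdd b c) (LAdd b d))"
    by (rule nd_cong_1[OF assms(2), of b 0 "\<lambda>x y. LAdd y x"]) (use nd_eq_ok[OF assms(1)] in auto)
qed

lemma nd_cong_Mul:
  assumes "nd s G (LEq 0 a b)" "nd s G (LEq 0 c d)"
  shows "nd s G (LEq 0 (LMul a c) (LMul b d))"
proof (rule nd_trans)
  show "nd s G (LEq 0 (LMul a c) (LMul b c))"
    by (rule nd_cong_1[OF assms(1), of c 0]) (use nd_eq_ok[OF assms(2)] in auto)
  show "nd s G (LEq 0 (LMul b c) (LMul b d))"
    by (rule nd_cong_1[OF assms(2), of b 0 "\<lambda>x y. LMul y x"]) (use nd_eq_ok[OF assms(1)] in auto)
qed

lemma nd_cong_Ap:
  assumes "nd s G (LEq (Suc n) a b)" "nd s G (LEq 0 c d)"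
  shows "nd s G (LEq n (LAp a c) (LAp b d))"
proof (rule nd_trans)
  show "nd s G (LEq n (LAp a c) (LAp b c))"
    by (rule nd_cong_1[OF assms(1), of c 0])
      (use nd_eq_ok[OF assms(1)] nd_eq_ok[OF assms(2)] in auto)
  show "nd s G (LEq n (LAp b c) (LAp b d))"
    by (rule nd_cong_1[OF assms(2), of b "Suc n" "\<lambda>x y. LAp y x"])
      (use nd_eq_ok[OF assms(1)] in auto)
qed

subsection \<open>Arithmetic\<close>

lemma nd_inst:
  "nd s G p \<Longrightarrow> ladm X t \<Longrightarrow> ltm_ok s t (stype X) \<Longrightarrow> lfree_for t (X, i) p \<Longrightarrow> sok X \<Longrightarrow>
    (\<And>q. q \<in> set G \<Longrightarrow> (X, i) \<notin> lfv q) \<Longrightarrow> nd s G (lsubst (X, i) t p)"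
  by (rule nd_allE[OF nd_allI]) (auto dest: ltm_ok_typeok)

lemma nd_inst_num:
  "nd s [] p \<Longrightarrow> ltm_ok s t 0 \<Longrightarrow> lfree_for t (Num, i) p \<Longrightarrow> nd s [] (lsubst (Num, i) t p)"
  by (rule nd_inst) (auto simp: ltm_ok_lwt)

lemma nd_weaken: "nd s [] p \<Longrightarrow> wfc s G \<Longrightarrow> nd s G p"
  by (simp add: nd_thm)

lemma nd_induct:
  assumes base: "nd s G (lsubst (Num, i) LZ p)"
    and step: "nd s (p # G) (lsubst (Num, i) (LS (nv i)) p)"
    and fresh: "\<And>q. q \<in> set G \<Longrightarrow> (Num, i) \<notin> lfv q"
  shows "nd s G p"
proof (rule nd_allE_self, rule nd_mp[OF nd_ax[OF lInd]])
  have "nd s G (LAll Num i (LImp p (lsubst (Num, i) (LS (nv i)) p)))"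
    by (rule nd_allI[OF nd_impI[OF step]]) (use fresh in auto)
  then show "nd s G (LAnd (lsubst (Num, i) LZ p)
      (LAll Num i (LImp p (lsubst (Num, i) (LS (nv i)) p))))"
    using base by (rule nd_conjI[rotated])
qed (use nd_wf[OF base] nd_wf[OF step] in auto)

lemma add_zero: "ltm_ok s a 0 \<Longrightarrow> wfc s G \<Longrightarrow> nd s G (LEq 0 (LAdd a LZ) a)"
  using nd_inst_num[OF nd_ax[OF lP3, of s "[]"], of a 0] by (auto intro: nd_weaken simp del: nd.simps)

lemma add_Suc:
  assumes "ltm_ok s a 0" "ltm_ok s b 0" "wfc s G"
  shows "nd s G (LEq 0 (LAdd a (LS b)) (LS (LAdd a b)))"
proof -
  \<comment> \<open>Substitution treats one variable at a time, and \<open>a\<close> may contain the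
    axiom's second variable. That variable is therefore renamed to a fresh \<open>k\<close> before
    \<open>a\<close> is inserted; the same device serves every axiom in two variables.\<close>
  obtain k where k: "\<And>X. (X, k) \<notin> insert (Num, 0) (lvs a \<union> lvs b)"
    using exists_fresh[of "insert (Num, 0) (lvs a \<union> lvs b)"] by auto
  then have k0: "k \<noteq> 0" by auto
  have "nd s [] (LEq 0 (LAdd (nv 0) (LS (nv 1))) (LS (LAdd (nv 0) (nv 1))))"
    by (rule nd_ax[OF lP4]) auto
  from nd_inst_num[OF this, of "nv k" 1]
  have "nd s [] (LEq 0 (LAdd (nv 0) (LS (nv k))) (LS (LAdd (nv 0) (nv k))))" by simp
  from nd_inst_num[OF this, of a 0] k0 assms
  have "nd s [] (LEq 0 (LAdd a (LS (nv k))) (LS (LAdd a (nv k))))" by simp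
  from nd_inst_num[OF this, of b k] k assms
  show ?thesis by (auto intro: nd_weaken simp del: nd.simps)
qed

lemma Suc_inject:
  assumes ab: "nd s G (LEq 0 (LS a) (LS b))"
  shows "nd s G (LEq 0 a b)"
proof -
  have ok: "ltm_ok s a 0" "ltm_ok s b 0" "wfc s G" using nd_eq_ok[OF ab] by auto
  obtain k where k: "\<And>X. (X, k) \<notin> insert (Num, 0) (lvs a \<union> lvs b)"
    using exists_fresh[of "insert (Num, 0) (lvs a \<union> lvs b)"] by auto
  then have k0: "k \<noteq> 0" by auto
  have "nd s [] (LImp (LEq 0 (LS (nv 0)) (LS (nv 1))) (LEq 0 (nv 0) (nv 1)))"
    by (rule nd_ax[OF lP2]) auto
  from nd_inst_num[OF this, of "nv k" 1]
  have "nd s [] (LImp (LEq 0 (LS (nv 0)) (LS (nv k))) (LEq 0 (nv 0) (nv k)))" by simp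
  from nd_inst_num[OF this, of a 0] k0 ok
  have "nd s [] (LImp (LEq 0 (LS a) (LS (nv k))) (LEq 0 a (nv k)))" by simp
  from nd_inst_num[OF this, of b k] k ok
  have "nd s [] (LImp (LEq 0 (LS a) (LS b)) (LEq 0 a b))" by simp
  then show ?thesis using ab ok nd_mp nd_weaken by blast
qed

lemma Suc_neq_zero:
  assumes "nd s G (LEq 0 (LS a) LZ)"
  shows "nd s G LBot"
proof -
  have ok: "ltm_ok s a 0" "wfc s G" using nd_eq_ok[OF assms] by auto
  have "nd s [] (lnot (LEq 0 (LS (nv 0)) LZ))" by (rule nd_ax[OF lP1]) auto
  from nd_inst_num[OF this, of a 0] ok
  have "nd s [] (lnot (LEq 0 (LS a) LZ))" by simp
  then show ?thesis using assms ok nd_notE nd_weaken by blast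
qed

lemma zero_add:
  assumes "ltm_ok s a 0" "wfc s G"
  shows "nd s G (LEq 0 (LAdd LZ a) a)"
proof -
  let ?p = "LEq 0 (LAdd LZ (nv 0)) (nv 0)"
  have "nd s [?p] (LEq 0 (LAdd LZ (LS (nv 0))) (LS (nv 0)))"
    by (rule nd_trans[OF add_Suc nd_cong_S[OF nd_asm]]) auto
  then have "nd s [] ?p"
    by - (rule nd_induct[of s "[]" 0 ?p], auto intro!: add_zero simp del: nd.simps)
  from nd_inst_num[OF this, of a 0] assms show ?thesis by (auto intro: nd_weaken simp del: nd.simps)
qed

lemma Suc_add:
  assumes "ltm_ok s a 0" "ltm_ok s b 0" "wfc s G"
  shows "nd s G (LEq 0 (LAdd (LS a) b) (LS (LAdd a b)))"
proof -
  obtain i where i: "\<And>X. (X, i) \<notin> lvs a" using exists_fresh[OF finite_lvs] by blast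
  let ?p = "LEq 0 (LAdd (LS a) (nv i)) (LS (LAdd a (nv i)))"
  have "nd s [] (LEq 0 (LAdd (LS a) LZ) (LS (LAdd a LZ)))"
    by (rule nd_trans[OF add_zero nd_cong_S[OF nd_sym[OF add_zero]]]) (use assms in auto)
  moreover have "nd s [?p] (LEq 0 (LAdd (LS a) (LS (nv i))) (LS (LAdd a (LS (nv i)))))"
    by (rule nd_trans[OF add_Suc nd_cong_S[OF nd_trans[OF nd_asm nd_sym[OF add_Suc]]]])
      (use assms in auto)
  ultimately have "nd s [] ?p"
    by - (rule nd_induct[of s "[]" i ?p], use i in \<open>auto simp del: nd.simps\<close>)
  from nd_inst_num[OF this, of b i] i assms show ?thesis
    by (auto intro: nd_weaken simp del: nd.simps)
qed

lemma add_commute: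
  assumes "ltm_ok s a 0" "ltm_ok s b 0" "wfc s G"
  shows "nd s G (LEq 0 (LAdd a b) (LAdd b a))"
proof -
  obtain i where i: "\<And>X. (X, i) \<notin> lvs a" using exists_fresh[OF finite_lvs] by blast
  let ?p = "LEq 0 (LAdd a (nv i)) (LAdd (nv i) a)"
  have "nd s [] (LEq 0 (LAdd a LZ) (LAdd LZ a))"
    by (rule nd_trans[OF add_zero nd_sym[OF zero_add]]) (use assms in auto)
  moreover have "nd s [?p] (LEq 0 (LAdd a (LS (nv i))) (LAdd (LS (nv i)) a))"
    by (rule nd_trans[OF add_Suc nd_trans[OF nd_cong_S[OF nd_asm] nd_sym[OF Suc_add]]])
      (use assms in auto)
  ultimately have "nd s [] ?p"
    by - (rule nd_induct[of s "[]" i ?p], use i in \<open>auto simp del: nd.simps\<close>)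
  from nd_inst_num[OF this, of b i] i assms show ?thesis
    by (auto intro: nd_weaken simp del: nd.simps)
qed

lemma add_assoc:
  assumes "ltm_ok s a 0" "ltm_ok s b 0" "ltm_ok s c 0" "wfc s G"
  shows "nd s G (LEq 0 (LAdd (LAdd a b) c) (LAdd a (LAdd b c)))"
proof -
  obtain i where i: "\<And>X. (X, i) \<notin> lvs a \<union> lvs b" using exists_fresh[of "lvs a \<union> lvs b"] by auto
  let ?p = "LEq 0 (LAdd (LAdd a b) (nv i)) (LAdd a (LAdd b (nv i)))"
  have "nd s [] (LEq 0 (LAdd (LAdd a b) LZ) (LAdd a (LAdd b LZ)))"
    by (rule nd_trans[OF add_zero nd_cong_Add[OF nd_refl nd_sym[OF add_zero]]]) (use assms in auto)
  moreover have "nd s [?p] (LEq 0 (LAdd (LAdd a b) (LS (nv i))) (LAdd a (LAdd b (LS (nv i)))))"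
    by (rule nd_trans[OF add_Suc nd_trans[OF nd_cong_S[OF nd_asm]
          nd_trans[OF nd_sym[OF add_Suc] nd_cong_Add[OF nd_refl nd_sym[OF add_Suc]]]]])
      (use assms in auto)
  ultimately have "nd s [] ?p"
    by - (rule nd_induct[of s "[]" i ?p], use i in \<open>auto simp del: nd.simps\<close>)
  from nd_inst_num[OF this, of c i] i assms show ?thesis
    by (auto intro: nd_weaken simp del: nd.simps)
qed

lemma add_Suc_neq_self:
  assumes eq: "nd s G (LEq 0 (LAdd a (LS b)) a)"
  shows "nd s G LBot"
proof -
  have ok: "ltm_ok s a 0" "ltm_ok s b 0" "wfc s G" using nd_eq_ok[OF eq] by auto
  obtain i where i: "\<And>X. (X, i) \<notin> lvs b" using exists_fresh[OF finite_lvs] by blast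
  let ?p = "lnot (LEq 0 (LAdd (nv i) (LS b)) (nv i))"
  have "nd s [] (lnot (LEq 0 (LAdd LZ (LS b)) LZ))"
    by (rule nd_notI, rule Suc_neq_zero, rule nd_trans[OF nd_sym[OF add_Suc] nd_asm])
      (use ok in auto)
  moreover have "nd s [?p] (lnot (LEq 0 (LAdd (LS (nv i)) (LS b)) (LS (nv i))))"
  proof (rule nd_notI, rule nd_notE)
    show "nd s [LEq 0 (LAdd (LS (nv i)) (LS b)) (LS (nv i)), ?p] (LEq 0 (LAdd (nv i) (LS b)) (nv i))"
      by (rule Suc_inject, rule nd_trans[OF nd_sym[OF Suc_add] nd_asm]) (use ok in auto)
  qed (use ok in \<open>auto intro!: nd_asm simp del: nd.simps\<close>)
  ultimately have "nd s [] ?p"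
    by - (rule nd_induct[of s "[]" i ?p], use i in \<open>auto simp del: nd.simps\<close>)
  from nd_inst_num[OF this, of a i] i ok have "nd s [] (lnot (LEq 0 (LAdd a (LS b)) a))" by simp
  then show ?thesis using eq ok nd_notE nd_weaken by blast
qed

section \<open>The order on numbers and its decidability\<close>

lemma lwfs_llt [simp]: "lwfs s (llt w a b) \<longleftrightarrow> ltm_ok s a 0 \<and> ltm_ok s b 0"
  by (auto simp: llt_def)

lemma lwfs_lle [simp]: "lwfs s (lle w a b) \<longleftrightarrow> ltm_ok s a 0 \<and> ltm_ok s b 0"
  by (auto simp: lle_def)

lemma lfv_llt [simp]: "lfv (llt w a b) = lvs a \<union> lvs b - {(Num, w)}"
  by (auto simp: llt_def)

lemma lfv_lle [simp]: "lfv (lle w a b) = lvs a \<union> lvs b - {(Num, w)}"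
  by (auto simp: lle_def)

lemma lsubst_llt [simp]:
  "v \<noteq> (Num, w) \<Longrightarrow> lsubst v t (llt w a b) = llt w (lsub v t a) (lsub v t b)"
  by (auto simp: llt_def)

lemma lsubst_lle [simp]:
  "v \<noteq> (Num, w) \<Longrightarrow> lsubst v t (lle w a b) = lle w (lsub v t a) (lsub v t b)"
  by (auto simp: lle_def)

lemma lfree_for_llt [simp]: "(Num, w) \<notin> lvs t \<Longrightarrow> lfree_for t v (llt w a b)"
  by (auto simp: llt_def)

lemma lfree_for_lle [simp]: "(Num, w) \<notin> lvs t \<Longrightarrow> lfree_for t v (lle w a b)"
  by (auto simp: lle_def)

lemma lltI:
  assumes "nd s G (LEq 0 (LAdd a (LS t)) b)" "(Num, w) \<notin> lvs a \<union> lvs b"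
  shows "nd s G (llt w a b)"
  unfolding llt_def by (rule nd_exI[where t = t])
    (use assms nd_eq_ok[OF assms(1)] in \<open>auto simp: ltm_ok_lwt simp del: nd.simps\<close>)

lemma lltE:
  assumes "nd s G (llt w a b)" "nd s (LEq 0 (LAdd a (LS (nv w))) b # G) q"
    "(Num, w) \<notin> lfv q" "\<And>r. r \<in> set G \<Longrightarrow> (Num, w) \<notin> lfv r"
  shows "nd s G q"
  using assms unfolding llt_def by (rule nd_exE)

lemma lleI:
  assumes "nd s G (LEq 0 (LAdd a t) b)" "(Num, w) \<notin> lvs a \<union> lvs b"
  shows "nd s G (lle w a b)"
  unfolding lle_def by (rule nd_exI[where t = t])
    (use assms nd_eq_ok[OF assms(1)] in \<open>auto simp: ltm_ok_lwt simp del: nd.simps\<close>)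

lemma zero_or_Suc:
  assumes "j \<noteq> k"
  shows "nd s [] (LOr (LEq 0 (nv j) LZ) (LEx Num k (LEq 0 (nv j) (LS (nv k)))))" (is "nd s [] ?p")
proof (rule nd_induct[where i = j])
  show "nd s [] (lsubst (Num, j) LZ ?p)"
    using assms by (auto intro!: nd_disjI1 nd_refl simp del: nd.simps)
  have "nd s [?p] (LEx Num k (LEq 0 (LS (nv j)) (LS (nv k))))"
    by (rule nd_exI[where t = "nv j"]) (use assms in \<open>auto intro!: nd_refl simp del: nd.simps\<close>)
  then show "nd s [?p] (lsubst (Num, j) (LS (nv j)) ?p)"
    using assms by (auto intro!: nd_disjI2 simp del: nd.simps)
qed auto

text \<open>There is no excluded middle to appeal to, and the lawless argument defines a functional
  by cases on this condition, so an inductive proof is required.\<close>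

lemma llt_decidable:
  assumes d: "distinct [i, j, w]"
  shows "nd s [] (LOr (llt w (nv i) (nv j)) (lnot (llt w (nv i) (nv j))))"
proof -
  obtain k where k: "k \<noteq> i" "k \<noteq> j" "k \<noteq> w"
    \<comment> \<open>The unit type stands in for sorts here, since only numbers have to be
      avoided.\<close>
    using exists_fresh[of "{((), i), ((), j), ((), w)}"] by auto
  let ?D = "\<lambda>a b. LOr (llt w a b) (lnot (llt w a b))"
  let ?c = "LEx Num k (LEq 0 (nv j) (LS (nv k)))"
  have cases: "nd s G (?D a (nv j))"
    if zero: "nd s (LEq 0 (nv j) LZ # G) (?D a (nv j))"
      and Suc: "nd s (LEq 0 (nv j) (LS (nv k)) # G) (?D a (nv j))"
      and fresh: "\<And>q. q \<in> set G \<Longrightarrow> (Num, k) \<notin> lfv q" "(Num, k) \<notin> lvs a" for a G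
  proof (rule nd_disjE[OF nd_weaken[OF zero_or_Suc[of j k]] zero])
    have wf: "wfc s G" "ltm_ok s a 0" using nd_wf[OF zero] by auto
    have "nd s (LEq 0 (nv j) (LS (nv k)) # ?c # G) (?D a (nv j))"
      by (rule nd_mono[OF Suc]) (use wf in auto)
    then show "nd s (?c # G) (?D a (nv j))"
      by (rule nd_exE[OF nd_asm, rotated 2]) (use wf fresh k in auto)
  qed (use k nd_wf[OF zero] in auto)
  have not_lt_0: "nd s (LEq 0 (nv j) LZ # G) (?D a (nv j))"
    if "wfc s G" "ltm_ok s a 0" "\<And>q. q \<in> set G \<Longrightarrow> (Num, w) \<notin> lfv q" for a G
  proof (rule nd_disjI2, rule nd_notI)
    let ?G = "llt w a (nv j) # LEq 0 (nv j) LZ # G"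
    let ?H = "LEq 0 (LAdd a (LS (nv w))) (nv j) # ?G"
    show "nd s ?G LBot"
    proof (rule lltE[OF nd_asm])
      have "nd s ?H (LEq 0 (LAdd a (LS (nv w))) LZ)"
        by (rule nd_trans[OF nd_asm nd_asm]) (use that in auto)
      then show "nd s ?H LBot"
        by (intro Suc_neq_zero[of s _ "LAdd a (nv w)"] nd_trans[OF nd_sym[OF add_Suc]])
          (use that in auto)
    qed (use that d in auto)
  qed (use that in auto)
  \<comment> \<open>The variable \<open>j\<close> is bound inside the induction formula because the
    step compares \<open>LS i\<close> with \<open>LS k\<close> and calls on the hypothesis at
    \<open>k\<close>.\<close>
  have "nd s [] (LAll Num j (?D (nv i) (nv j)))" (is "nd s [] ?p")
  proof (rule nd_induct[where i = i])
    have "nd s [] (LAll Num j (?D LZ (nv j)))"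
    proof (rule nd_allI, rule cases[OF not_lt_0])
      let ?G = "[LEq 0 (nv j) (LS (nv k))]"
      have "nd s ?G (LEq 0 (LAdd LZ (LS (nv k))) (nv j))"
        by (rule nd_trans[OF zero_add nd_sym[OF nd_asm]]) auto
      then show "nd s ?G (?D LZ (nv j))"
        by (intro nd_disjI1 lltI) (use d k in auto)
    qed auto
    then show "nd s [] (lsubst (Num, i) LZ ?p)" using d by simp
    have "nd s [?p] (LAll Num j (?D (LS (nv i)) (nv j)))"
    proof (rule nd_allI, rule cases[OF not_lt_0])
      let ?G = "[LEq 0 (nv j) (LS (nv k)), ?p]"
      have "nd s ?G (lsubst (Num, j) (nv k) (?D (nv i) (nv j)))"
        by (rule nd_allE[OF nd_asm]) (use k in auto)
      then have IH: "nd s ?G (?D (nv i) (nv k))" using d by simp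
      show "nd s ?G (?D (LS (nv i)) (nv j))"
      proof (rule nd_disjE[OF IH])
        let ?a = "llt w (nv i) (nv k)" and ?e = "LEq 0 (LAdd (nv i) (LS (nv w))) (nv k)"
        have "nd s (?e # ?a # ?G) (LEq 0 (LAdd (LS (nv i)) (LS (nv w))) (LS (nv k)))"
          by (rule nd_trans[OF Suc_add nd_cong_S[OF nd_asm]]) auto
        then have "nd s (?e # ?a # ?G) (LEq 0 (LAdd (LS (nv i)) (LS (nv w))) (nv j))"
          by (rule nd_trans[OF _ nd_sym[OF nd_asm]]) auto
        then have "nd s (?e # ?a # ?G) (llt w (LS (nv i)) (nv j))"
          by (rule lltI) (use d in auto)
        then have "nd s (?a # ?G) (llt w (LS (nv i)) (nv j))"
          by (rule lltE[OF nd_asm, rotated 2]) (use d k in auto)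
        then show "nd s (?a # ?G) (?D (LS (nv i)) (nv j))" by (rule nd_disjI1) auto
        let ?b = "llt w (LS (nv i)) (nv j)" and ?f = "LEq 0 (LAdd (LS (nv i)) (LS (nv w))) (nv j)"
        let ?H = "?f # ?b # lnot ?a # ?G"
        have "nd s ?H (LEq 0 (LS (LAdd (nv i) (LS (nv w)))) (LS (nv k)))"
          by (rule nd_trans[OF nd_sym[OF Suc_add] nd_trans[OF nd_asm nd_asm]]) auto
        then have "nd s ?H (LEq 0 (LAdd (nv i) (LS (nv w))) (nv k))" by (rule Suc_inject)
        then have "nd s ?H ?a" by (rule lltI) (use d k in auto)
        moreover have "nd s ?H (lnot ?a)" by (rule nd_asm) auto
        ultimately have "nd s ?H LBot" by (rule nd_notE[rotated])
        then have "nd s (?b # lnot ?a # ?G) LBot"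
          by (rule lltE[OF nd_asm, rotated 2]) (use d k in auto)
        then show "nd s (lnot ?a # ?G) (?D (LS (nv i)) (nv j))"
          by (intro nd_disjI2 nd_notI) auto
      qed
    qed (use d k in auto)
    then show "nd s [?p] (lsubst (Num, i) (LS (nv i)) ?p)" using d by simp
  qed auto
  then show ?thesis by (rule nd_allE_self)
qed

text \<open>With \<open>a\<close> the length of an initial segment, this places position
  \<open>z + a\<close> outside the segment, where a continuation may be chosen freely.\<close>

lemma add_not_llt:
  assumes "ltm_ok s z 0" "ltm_ok s a 0" "wfc s G" "(Num, w) \<notin> lvs z \<union> lvs a"
    "\<And>q. q \<in> set G \<Longrightarrow> (Num, w) \<notin> lfv q"
  shows "nd s G (lnot (llt w (LAdd z a) a))"
proof (rule nd_notI)
  let ?G = "llt w (LAdd z a) a # G"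
  let ?H = "LEq 0 (LAdd (LAdd z a) (LS (nv w))) a # ?G"
  have wf: "wfc s ?H" using assms by auto
  show "nd s ?G LBot"
  proof (rule lltE[OF nd_asm])
    have "nd s ?H (LEq 0 (LAdd (LAdd a z) (LS (nv w))) a)"
      by (rule nd_trans[OF nd_cong_Add[OF add_commute nd_refl] nd_asm]) (use assms in auto)
    then have "nd s ?H (LEq 0 (LAdd a (LAdd z (LS (nv w)))) a)"
      by (rule nd_trans[OF nd_sym[OF add_assoc], rotated 4]) (use assms in auto)
    then have "nd s ?H (LEq 0 (LAdd a (LS (LAdd z (nv w)))) a)"
      by (rule nd_trans[OF nd_cong_Add[OF nd_refl nd_sym[OF add_Suc]], rotated 5]) (use assms in auto)
    then show "nd s ?H LBot" by (rule add_Suc_neq_self)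
  qed (use assms in auto)
qed

text \<open>(LL1) copies a functional up to and including a bound. This shows that the bound
  \<open>z + a\<close> still covers the whole segment of length \<open>a\<close>.\<close>

lemma llt_imp_lle_add:
  assumes lt: "nd s G (llt w b a)" and z: "ltm_ok s z 0"
    and w: "(Num, w) \<notin> lvs z \<union> lvs a \<union> lvs b" "\<And>q. q \<in> set G \<Longrightarrow> (Num, w) \<notin> lfv q"
    and v: "(Num, v) \<notin> lvs z \<union> lvs a \<union> lvs b"
  shows "nd s G (lle v b (LAdd z a))"
proof (rule lltE[OF lt])
  let ?G = "LEq 0 (LAdd b (LS (nv w))) a # G"
  have wf: "wfc s G" "ltm_ok s a 0" "ltm_ok s b 0" using nd_wf[OF lt] by auto
  have "nd s ?G (LEq 0 (LAdd (LAdd b (LS (nv w))) z) (LAdd z a))"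
    by (rule nd_trans[OF nd_cong_Add[OF nd_asm nd_refl] add_commute]) (use wf z in auto)
  then have "nd s ?G (LEq 0 (LAdd b (LAdd (LS (nv w)) z)) (LAdd z a))"
    by (rule nd_trans[OF nd_sym[OF add_assoc], rotated 4]) (use wf z in auto)
  then show "nd s ?G (lle v b (LAdd z a))" by (rule lleI) (use v in auto)
qed (use w in auto)

subsection \<open>Stability of negative translations\<close>

lemma negt_simps [simp]:
  "lfv (negt p) = lfv p" "lidx (negt p) = lidx p" "inL (negt p) = inL p"
  "lwfs s (negt p) = lwfs s p" "negt (lsubst v t p) = lsubst v t (negt p)"
  by (induction p) (auto simp: lnot_def)

lemma lfree_for_negt [simp]: "lfree_for t v (negt p) = lfree_for t v p"
  by (induction p) auto

lemma negt_lnot [simp]: "negt (lnot p) = lnot (negt p)"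
  by (simp add: lnot_def)

lemma negt_liff: "negt (liff p q) = liff (negt p) (negt q)"
  by (simp add: liff_def)

definition stable :: "nat option \<Rightarrow> lfm \<Rightarrow> bool" where
  "stable s p = (\<forall>G. nd s G (lnot (lnot p)) \<longrightarrow> nd s G p)"

lemma nd_not_not_mono:
  assumes pq: "nd s (p # G) q" and p: "nd s G (lnot (lnot p))"
  shows "nd s G (lnot (lnot q))"
proof (rule nd_notI, rule nd_notE)
  have wf: "wfc s G" "lwfs s p" "lwfs s q" using nd_wf[OF pq] by auto
  show "nd s (lnot q # G) (lnot (lnot p))" by (rule nd_mono[OF p]) (use wf in auto)
  show "nd s (lnot q # G) (lnot p)"
    by (rule nd_notI, rule nd_notE[of s _ q], rule nd_asm)
      (use wf in \<open>auto intro!: nd_mono[OF pq] simp del: nd.simps\<close>)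
qed

lemma stable_lnot: "stable s (lnot p)"
  unfolding stable_def
proof (intro allI impI nd_notI)
  fix G assume nn: "nd s G (lnot (lnot (lnot p)))"
  then have wf: "wfc s G" "lwfs s p" using nd_wf by force+
  show "nd s (p # G) LBot"
  proof (rule nd_notE)
    show "nd s (p # G) (lnot (lnot (lnot p)))" by (rule nd_mono[OF nn]) (use wf in auto)
    show "nd s (p # G) (lnot (lnot p))"
      by (rule nd_notI, rule nd_notE[of s _ p]) (use wf in \<open>auto intro!: nd_asm simp del: nd.simps\<close>)
  qed
qed

text \<open>After \<open>negt\<close>, atoms, disjunctions and existential formulas have become
  negations, and a double negation can be pushed inward intuitionistically through conjunction,
  implication (to the consequent) and universal quantification.\<close>

lemma stable_negt: "stable s (negt p)"
proof (induction p)
  case LBot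
  have "nd s G LBot" if "nd s G (lnot (lnot LBot))" for G
    by (rule nd_notE[OF that], rule nd_notI, rule nd_asm) (use nd_wf[OF that] in auto)
  then show ?case by (simp add: stable_def)
next
  case (LAnd p q)
  show ?case unfolding stable_def
  proof (intro allI impI)
    fix G assume nn: "nd s G (lnot (lnot (negt (LAnd p q))))"
    then have wf: "wfc s G" "lwfs s p" "lwfs s q" using nd_wf by force+
    have "nd s (negt (LAnd p q) # G) (negt p)" "nd s (negt (LAnd p q) # G) (negt q)"
      by (rule nd_conjE1[OF nd_asm, of _ "negt q"] nd_conjE2[OF nd_asm, of "negt p"];
          use wf in simp)+
    from nd_not_not_mono[OF this(1) nn] nd_not_not_mono[OF this(2) nn]
    show "nd s G (negt (LAnd p q))" using LAnd by (auto simp: stable_def intro: nd_conjI)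
  qed
next
  case (LImp p q)
  show ?case unfolding stable_def
  proof (intro allI impI)
    fix G assume nn: "nd s G (lnot (lnot (negt (LImp p q))))"
    then have wf: "wfc s G" "lwfs s p" "lwfs s q" using nd_wf by force+
    have 1: "nd s (negt (LImp p q) # negt p # G) (negt q)"
      by (rule nd_mp[of _ _ "negt p"]) (use wf in \<open>auto intro!: nd_asm simp del: nd.simps\<close>)
    have "nd s (negt p # G) (lnot (lnot (negt (LImp p q))))"
      by (rule nd_mono[OF nn]) (use wf in auto)
    from nd_not_not_mono[OF 1 this] have "nd s (negt p # G) (negt q)"
      using LImp by (auto simp: stable_def simp del: nd.simps)
    then show "nd s G (negt (LImp p q))" by simp
  qed
next
  case (LAll X i p)
  show ?case unfolding stable_def
  proof (intro allI impI)
    fix G assume nn: "nd s G (lnot (lnot (negt (LAll X i p))))"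
    let ?a = "lnot (lnot (LAll X i (negt p)))"
    have wf: "wfc s G" "lwfs s p" "sok X" "typeok s (stype X)" using nd_wf[OF nn] by auto
    have "nd s [LAll X i (negt p), ?a] (negt p)"
      by (rule nd_allE_self[OF nd_asm]) (use wf in auto)
    then have "nd s [?a] (lnot (lnot (negt p)))"
      by (rule nd_not_not_mono[OF _ nd_asm]) (use wf in auto)
    then have "nd s [?a] (negt p)" using LAll by (auto simp: stable_def simp del: nd.simps)
    then have "nd s [?a] (LAll X i (negt p))" by (rule nd_allI) (use wf in auto)
    then have "nd s (?a # G) (LAll X i (negt p))" by (rule nd_mono) (use wf in auto)
    then show "nd s G (negt (LAll X i p))" using nn by (auto intro: nd_cut simp del: nd.simps)
  qed
qed (simp_all add: stable_lnot)

subsection \<open>Functionals defined by a decidable case distinction\<close>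

text \<open>This unifies the two membership clauses of \<open>prime\<close>. The operation is
  injective and never takes the value \<open>kk n\<close>, which is thereby free to mean that
  nothing is enumerated at an argument.\<close>

definition lsucc :: "nat \<Rightarrow> ltm \<Rightarrow> ltm" where
  "lsucc n t = (if n = 0 then LS t else LN n t)"

lemma lsucc_simps [simp]:
  "ltm_ok s (lsucc n t) n \<longleftrightarrow> typeok s n \<and> ltm_ok s t n" "lvs (lsucc n t) = lvs t"
  "lsub v a (lsucc n t) = lsucc n (lsub v a t)"
  by (auto simp: lsucc_def)

lemma kk_simps [simp]: "ltm_ok s (kk n) n \<longleftrightarrow> typeok s n" "lvs (kk n) = {}" "lsub v a (kk n) = kk n"
  by (cases n; simp)+

lemma nd_cong_lsucc: "nd s G (LEq n a b) \<Longrightarrow> nd s G (LEq n (lsucc n a) (lsucc n b))"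
  by (auto simp: lsucc_def intro: nd_cong_S nd_cong_N)

lemma lsucc_neq_kk:
  assumes eq: "nd s G (LEq n (lsucc n a) (kk n))"
  shows "nd s G LBot"
proof (cases n)
  case 0 then show ?thesis using eq Suc_neq_zero by (auto simp: lsucc_def)
next
  case (Suc m)
  have ok: "ltm_ok s a n" "typeok s n" "wfc s G" using nd_eq_ok[OF eq] by auto
  have "nd s [] (lnot (LEq n (LN n (LV (Fn n) 0)) (LKc n)))"
    by (rule nd_ax[OF lN1]) (use Suc ok in auto)
  from nd_inst[OF this, of "Fn n" a 0] have "nd s [] (lnot (LEq n (LN n a) (LKc n)))"
    using ok Suc by (simp add: ltm_ok_lwt)
  then have "nd s G (lnot (LEq n (LN n a) (LKc n)))" using ok nd_weaken by blast
  then show ?thesis using eq Suc by (auto simp: lsucc_def intro: nd_notE)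
qed

lemma lsucc_inject:
  assumes eq: "nd s G (LEq n (lsucc n a) (lsucc n b))"
  shows "nd s G (LEq n a b)"
proof (cases n)
  case 0 then show ?thesis using eq Suc_inject by (auto simp: lsucc_def)
next
  case (Suc m)
  let ?X = "Fn n"
  have ok: "ltm_ok s a n" "ltm_ok s b n" "typeok s n" "wfc s G" using nd_eq_ok[OF eq] by auto
  obtain k where k: "\<And>X. (X, k) \<notin> insert (Num, 0) (lvs a \<union> lvs b)"
    using exists_fresh[of "insert (Num, 0) (lvs a \<union> lvs b)"] by auto
  then have k0: "k \<noteq> 0" by auto
  have "nd s [] (LImp (LEq n (LN n (LV ?X 0)) (LN n (LV ?X 1))) (LEq n (LV ?X 0) (LV ?X 1)))"
    by (rule nd_ax[OF lN3]) (use Suc ok in auto)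
  from nd_inst[OF this, of ?X "LV ?X k" 1]
  have "nd s [] (LImp (LEq n (LN n (LV ?X 0)) (LN n (LV ?X k))) (LEq n (LV ?X 0) (LV ?X k)))"
    using ok Suc by (simp add: ltm_ok_lwt)
  from nd_inst[OF this, of ?X a 0]
  have "nd s [] (LImp (LEq n (LN n a) (LN n (LV ?X k))) (LEq n a (LV ?X k)))"
    using ok Suc k0 by (simp add: ltm_ok_lwt)
  from nd_inst[OF this, of ?X b k]
  have "nd s [] (LImp (LEq n (LN n a) (LN n b)) (LEq n a b))"
    using ok Suc k by (simp add: ltm_ok_lwt)
  then have "nd s G (LImp (LEq n (LN n a) (LN n b)) (LEq n a b))" using ok nd_weaken by blast
  then show ?thesis using eq Suc by (auto simp: lsucc_def intro: nd_mp)
qed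

text \<open>Choosing \<open>m = n + 1\<close> in (C1) and (C2) makes the trailing applications to
  zero disappear, so both schemas take one form in which the functional is applied just
  once.\<close>

lemma unique_choice:
  assumes ex: "nd s G (LAll Num i (LEx (psort n) g (LAnd p
      (LAll (psort n) g' (LImp (lsubst (psort n, g) (LV (psort n) g') p)
        (LEq n (LV (psort n) g') (LV (psort n) g)))))))"
    and ok: "typeok s (Suc n)" "lsrt_le p (Suc n)" "g \<noteq> g'" "i \<noteq> g" "(psort n, g') \<notin> lfv p"
      "lfree_for (LV (psort n) g') (psort n, g) p" "(Fn (Suc n), f) \<notin> lfv p"
      "lfree_for (LAp (LV (Fn (Suc n)) f) (nv i)) (psort n, g) p"
  shows "nd s G (LEx (Fn (Suc n)) f (LAll Num i
    (lsubst (psort n, g) (LAp (LV (Fn (Suc n)) f) (nv i)) p)))"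
proof -
  let ?u = "LAll (psort n) g' (LImp (lsubst (psort n, g) (LV (psort n) g') p)
        (LEq n (LV (psort n) g') (LV (psort n) g)))"
  let ?c = "LEx (Fn (Suc n)) f (LAll Num i
    (lsubst (psort n, g) (LAp (LV (Fn (Suc n)) f) (nv i)) p))"
  have wf: "wfc s G" "lwfs s p" "typeok s n" using nd_wf[OF ex] by auto
  have wfc: "lwfs s ?c" using ok wf by (auto intro: lwfs_lsubst)
  show ?thesis
  proof (cases n)
    case 0
    \<comment> \<open>At type 0 the relevant schema is (C1), whose premise carries no uniqueness
      clause; the clause is stripped off here.\<close>
    let ?e = "LEx Num g (LAnd p ?u)"
    have "nd s (LAnd p ?u # ?e # [LAll Num i ?e]) (LEx Num g p)"
      by (rule nd_exI[where t = "nv g"]) (use 0 wf nd_wf[OF ex] in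
          \<open>auto intro!: nd_conjE1[OF nd_asm, of _ ?u] simp del: nd.simps\<close>)
    then have "nd s (?e # [LAll Num i ?e]) (LEx Num g p)"
      by (rule nd_exE[OF nd_asm, rotated 2]) (use 0 wf nd_wf[OF ex] in auto)
    moreover have "nd s [LAll Num i ?e] ?e" by (rule nd_allE_self[OF nd_asm]) (use 0 nd_wf[OF ex] in auto)
    ultimately have "nd s [LAll Num i ?e] (LEx Num g p)" using nd_cut by blast
    then have "nd s [LAll Num i ?e] (LAll Num i (LEx Num g p))" by (rule nd_allI) auto
    then have "nd s [] (LImp (LAll Num i ?e) (LAll Num i (LEx Num g p)))" by simp
    then have "nd s G (LAll Num i (LEx Num g p))" using ex 0 wf nd_weaken nd_mp by (metis psort_0)
    moreover have "nd s G (LImp (LAll Num i (LEx Num g p)) ?c)"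
      using lC1ax[of 1 p i g f] ok 0 wfc wf by (intro nd_ax) auto
    ultimately show ?thesis using nd_mp by blast
  next
    case (Suc k)
    have "nd s G (LImp (LAll Num i (LEx (psort n) g (LAnd p ?u))) ?c)"
      using lC2ax[of n "Suc n" p g g' f i] ok Suc wfc wf nd_wf[OF ex] by (intro nd_ax) auto
    then show ?thesis using ex nd_mp by blast
  qed
qed

text \<open>Decidability supplies a value and the contradictory guards make it unique, which is what
  (C2) demands. The variable \<open>i\<close> may occur in \<open>d\<close>, \<open>t\<close> and
  \<open>u\<close>.\<close>

lemma definition_by_cases:
  assumes dec: "nd s [] (LOr d (lnot d))" and t: "ltm_ok s t n" "ltm_ok s u n"
    and ty: "typeok s (Suc n)" "lsrt_le d (Suc n)" "\<And>v. v \<in> lvs t \<union> lvs u \<Longrightarrow> stype (fst v) \<le> Suc n"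
    and f: "(Fn (Suc n), f) \<notin> lfv d \<union> lvs t \<union> lvs u"
  shows "nd s [] (LEx (Fn (Suc n)) f (LAll Num i
    (LOr (LAnd d (LEq n (LAp (LV (Fn (Suc n)) f) (nv i)) t))
      (LAnd (lnot d) (LEq n (LAp (LV (Fn (Suc n)) f) (nv i)) u)))))"
proof -
  let ?S = "insert (Num, i) (lfv d \<union> lvs t \<union> lvs u)"
  have "finite ?S" by simp
  then obtain g where g: "\<And>X. (X, g) \<notin> ?S" using exists_fresh[of ?S] by blast
  have "finite (insert (Num, g) ?S)" by simp
  then obtain g' where g': "\<And>X. (X, g') \<notin> insert (Num, g) ?S"
    using exists_fresh[of "insert (Num, g) ?S"] by blast
  let ?p = "\<lambda>a. LOr (LAnd d (LEq n a t)) (LAnd (lnot d) (LEq n a u))"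
  let ?G = "LV (psort n) g" and ?G' = "LV (psort n) g'"
  let ?u = "\<lambda>a. LAll (psort n) g' (LImp (?p ?G') (LEq n ?G' a))"
  have neq: "g \<noteq> g'" "i \<noteq> g" "i \<noteq> g'" using g g' by auto
  have gd: "lfree_for a (X, g) d" for a X using g by (intro lfree_for_notin) auto
  have wf: "lwfs s d" "typeok s n" using nd_wf[OF dec] ltm_ok_typeok[OF t(1)] by auto
  have intro_t: "nd s G (LEx (psort n) g (LAnd (?p ?G) (?u ?G)))"
    if a: "nd s G (?p a)" and un: "nd s (?p ?G' # G) (LEq n ?G' a)"
      and fr: "\<And>q. q \<in> set G \<Longrightarrow> (psort n, g') \<notin> lfv q" "(psort n, g') \<notin> lvs a" for G a
  proof (rule nd_exI[where t = a])
    have "nd s G (?u a)" by (rule nd_allI[OF nd_impI[OF un]]) (use wf fr in auto)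
    then have "nd s G (LAnd (?p a) (?u a))" by (rule nd_conjI[OF a])
    then show "nd s G (lsubst (psort n, g) a (LAnd (?p ?G) (?u ?G)))" using g neq by auto
  qed (use wf t fr nd_wf[OF a] in \<open>auto simp: ltm_ok_lwt gd\<close>)
  have "nd s [] (LEx (psort n) g (LAnd (?p ?G) (?u ?G)))"
  proof (rule nd_disjE[OF dec]; rule intro_t)
    show "nd s [d] (?p t)"
      by (intro nd_disjI1 nd_conjI nd_asm nd_refl) (use wf t in auto)
    show "nd s [lnot d] (?p u)"
      by (intro nd_disjI2 nd_conjI nd_asm nd_refl) (use wf t in auto)
    show "nd s [?p ?G', d] (LEq n ?G' t)"
    proof (rule nd_disjE[OF nd_asm[of "?p ?G'"]])
      show "nd s [LAnd d (LEq n ?G' t), ?p ?G', d] (LEq n ?G' t)"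
        by (rule nd_conjE2[OF nd_asm, of d]) (use wf t in auto)
      show "nd s [LAnd (lnot d) (LEq n ?G' u), ?p ?G', d] (LEq n ?G' t)"
        by (rule nd_botE, rule nd_notE[of _ _ d], rule nd_conjE1[OF nd_asm, of _ "LEq n ?G' u"])
          (use wf t in \<open>auto intro!: nd_asm simp del: nd.simps\<close>)
    qed (use wf t in auto)
    show "nd s [?p ?G', lnot d] (LEq n ?G' u)"
    proof (rule nd_disjE[OF nd_asm[of "?p ?G'"]])
      show "nd s [LAnd (lnot d) (LEq n ?G' u), ?p ?G', lnot d] (LEq n ?G' u)"
        by (rule nd_conjE2[OF nd_asm, of "lnot d"]) (use wf t in auto)
      have "nd s [LAnd d (LEq n ?G' t), ?p ?G', lnot d] d"
        by (rule nd_conjE1[OF nd_asm, of _ "LEq n ?G' t"]) (use wf t in auto)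
      moreover have "nd s [LAnd d (LEq n ?G' t), ?p ?G', lnot d] (lnot d)"
        by (rule nd_asm) (use wf t in auto)
      ultimately have "nd s [LAnd d (LEq n ?G' t), ?p ?G', lnot d] LBot" by (rule nd_notE[rotated])
      then show "nd s [LAnd d (LEq n ?G' t), ?p ?G', lnot d] (LEq n ?G' u)"
        by (rule nd_botE) (use wf t in auto)
    qed (use wf t in auto)
  qed (use g' in auto)
  moreover have "lsubst (psort n, g) ?G' (?p ?G) = ?p ?G'" using g by auto
  ultimately have "nd s [] (LAll Num i (LEx (psort n) g (LAnd (?p ?G)
      (LAll (psort n) g' (LImp (lsubst (psort n, g) ?G' (?p ?G)) (LEq n ?G' ?G))))))"
    by - (rule nd_allI, auto)
  then have "nd s [] (LEx (Fn (Suc n)) f (LAll Num i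
    (lsubst (psort n, g) (LAp (LV (Fn (Suc n)) f) (nv i)) (?p ?G))))"
    by (rule unique_choice) (use ty f g g' neq in \<open>auto simp: lsrt_le_def gd\<close>)
  then show ?thesis using g by auto
qed

subsection \<open>Comprehension\<close>

text \<open>A lawless functional meets every object of the type below it, and does so beyond every bound:
if not, some initial segment of it would force this, but that segment has a lawless
continuation taking the value in question.  The indices below 10 are reserved for the
variables that (LL1) fixes and for the bound variables of the proof.\<close>

lemma lawless_generic:
  assumes ty: "typeok s (Suc n)" and zx: "10 \<le> z" "10 \<le> x" "z \<noteq> x" "10 \<le> h"
  shows "nd s [] (lnot (lnot (LEx Num x
    (LEq n (LAp (LV (Lls (Suc n)) h) (LAdd (nv z) (nv x))) (LV (psort n) 4)))))"
proof (rule nd_notI)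
  let ?h = "LV (Lls (Suc n)) h" and ?g = "LV (Lls (Suc n)) 0" and ?f = "LV (Fn (Suc n)) 0"
  let ?Z = "LV (psort n) 4"
  let ?psi = "\<lambda>h. lnot (LEx Num x (LEq n (LAp h (LAdd (nv z) (nv x))) ?Z))"
  let ?agree = "LAll Num 7 (LImp (llt 8 (nv 7) (nv 6)) (LEq n (LAp ?g (nv 7)) (LAp ?h (nv 7))))"
  let ?body = "LAll (Lls (Suc n)) 0 (LImp ?agree (?psi ?g))"
  let ?cho = "\<lambda>i. LOr (LAnd (llt 8 i (nv 6)) (LEq n (LAp ?f i) (LAp ?h i)))
    (LAnd (lnot (llt 8 i (nv 6))) (LEq n (LAp ?f i) ?Z))"
  let ?ll = "LAll Num 1 (LImp (lle 2 (nv 1) (LAdd (nv z) (nv 6)))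
    (LEq n (LAp ?g (nv 1)) (LAp ?f (nv 1))))"
  have tyn: "typeok s n" using ty by (rule typeok_Suc)
  have wf: "lwfs s (?psi ?h)" "lwfs s ?body" "lwfs s (LAll Num 9 (?cho (nv 9)))" "lwfs s ?ll"
    using ty tyn by auto
  \<comment> \<open>Suppose \<open>h\<close> misses the value \<open>Z\<close> from \<open>z\<close>
    on. The only variable of type \<open>n + 1\<close> in this assumption is \<open>h\<close>, so
    (LL3) applies; variable 6 is the length of the segment that forces it.\<close>
  have cont: "nd s [?psi ?h] (LEx Num 6 ?body)"
  proof (rule nd_mp[OF nd_ax nd_asm])
    have "lax (LImp (?psi ?h) (LEx Num 6 (LAll (Lls (Suc n)) 0
        (LImp (LAll Num 7 (LImp (llt 8 (nv 7) (nv 6))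
                 (LEq (Suc n - 1) (LAp ?g (nv 7)) (LAp ?h (nv 7)))))
              (lsubst (Lls (Suc n), h) ?g (?psi ?h))))))"
      by (rule lLL3) (use zx in \<open>auto simp: lsrt_le_def\<close>)
    then show "lax (LImp (?psi ?h) (LEx Num 6 ?body))" by simp
  qed (use wf in auto)
  have dec: "nd s [] (LOr (llt 8 (nv 9) (nv 6)) (lnot (llt 8 (nv 9) (nv 6))))"
    by (rule llt_decidable) auto
  \<comment> \<open>The counterexample is planned as an ordinary functional: it copies
    \<open>h\<close> below the forced length and is constantly \<open>Z\<close> from there
    on.\<close>
  have cho: "nd s [] (LEx (Fn (Suc n)) 0 (LAll Num 9 (?cho (nv 9))))"
    by (rule definition_by_cases[OF dec]) (use ty tyn in \<open>auto simp: lsrt_le_def\<close>)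
  have "nd s [] (LEx (Lls (Suc n)) 0 (LAll Num 1 (LImp (lle 2 (nv 1) (nv 0))
      (LEq n (LAp ?g (nv 1)) (LAp ?f (nv 1))))))"
    by (rule nd_ax) (use lLL1[of "Suc n"] ty tyn in auto)
  \<comment> \<open>The bound is the position at which \<open>Z\<close> has to appear. A lawless
    \<open>g\<close> following the plan up to and including it agrees with \<open>h\<close> on the
    segment and yet takes the value \<open>Z\<close> beyond \<open>z\<close>.\<close>
  from nd_inst_num[OF this, of "LAdd (nv z) (nv 6)" 0]
  have ll: "nd s [] (LEx (Lls (Suc n)) 0 ?ll)" using zx by simp
  let ?G = "[?ll, LAll Num 9 (?cho (nv 9)), ?body, ?psi ?h]"
  have wfG: "wfc s ?G" using wf by simp
  have cho': "nd s ?G (?cho t)" if "ltm_ok s t 0" "(Num, 8) \<notin> lvs t" for t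
  proof -
    have "nd s ?G (lsubst (Num, 9) t (?cho (nv 9)))"
      by (rule nd_allE[OF nd_asm]) (use that wfG in \<open>auto simp: ltm_ok_lwt\<close>)
    then show ?thesis by simp
  qed
  have ll': "nd s D (LImp (lle 2 t (LAdd (nv z) (nv 6))) (LEq n (LAp ?g t) (LAp ?f t)))"
    if "ltm_ok s t 0" "(Num, 2) \<notin> lvs t" "set ?G \<subseteq> set D" "wfc s D" for t D
  proof -
    have "nd s D (lsubst (Num, 1) t (LImp (lle 2 (nv 1) (LAdd (nv z) (nv 6)))
      (LEq n (LAp ?g (nv 1)) (LAp ?f (nv 1)))))"
      by (rule nd_allE[OF nd_asm]) (use that in \<open>auto simp: ltm_ok_lwt\<close>)
    then show ?thesis using zx by simp
  qed
  have "nd s ?G LBot"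
  proof (rule nd_notE)
    have "nd s ?G ?agree"
    proof (rule nd_allI, rule nd_impI)
      let ?lt = "llt 8 (nv 7) (nv 6)"
      let ?D = "?lt # ?G"
      have wfD: "wfc s ?D" using wfG by simp
      have "nd s ?D (lle 2 (nv 7) (LAdd (nv z) (nv 6)))"
        by (rule llt_imp_lle_add[OF nd_asm, where w = 8]) (use wfD zx in auto)
      then have gf: "nd s ?D (LEq n (LAp ?g (nv 7)) (LAp ?f (nv 7)))"
        by (rule nd_mp[OF ll', rotated 4]) (use wfD in auto)
      have "nd s ?D (LEq n (LAp ?f (nv 7)) (LAp ?h (nv 7)))"
      proof (rule nd_disjE)
        show "nd s ?D (?cho (nv 7))" by (rule nd_mono[OF cho']) (use wfD in auto)
        show "nd s (LAnd ?lt (LEq n (LAp ?f (nv 7)) (LAp ?h (nv 7))) # ?D)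
            (LEq n (LAp ?f (nv 7)) (LAp ?h (nv 7)))"
          by (rule nd_conjE2[OF nd_asm, of ?lt]) (use wfD ty tyn in auto)
        let ?E = "LAnd (lnot ?lt) (LEq n (LAp ?f (nv 7)) ?Z) # ?D"
        have "nd s ?E (lnot ?lt)"
          by (rule nd_conjE1[OF nd_asm, of _ "LEq n (LAp ?f (nv 7)) ?Z"]) (use wfD ty tyn in auto)
        moreover have "nd s ?E ?lt" by (rule nd_asm) (use wfD ty tyn in auto)
        ultimately have "nd s ?E LBot" by (rule nd_notE)
        then show "nd s ?E (LEq n (LAp ?f (nv 7)) (LAp ?h (nv 7)))"
          by (rule nd_botE) (use ty tyn in auto)
      qed
      then show "nd s ?D (LEq n (LAp ?g (nv 7)) (LAp ?h (nv 7)))" by (rule nd_trans[OF gf])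
    qed (use zx in auto)
    moreover have "nd s ?G (LImp ?agree (?psi ?g))"
      by (rule nd_allE_self[OF nd_asm]) (use wfG in auto)
    ultimately show "nd s ?G (?psi ?g)" by (rule nd_mp[rotated])
    \<comment> \<open>The offset from \<open>z\<close> is the segment length itself, so this one
      position is both beyond \<open>z\<close> and outside the segment.\<close>
    let ?t = "LAdd (nv z) (nv 6)"
    have "nd s ?G (lle 2 ?t ?t)" by (rule lleI[OF add_zero]) (use wfG zx in auto)
    then have gf: "nd s ?G (LEq n (LAp ?g ?t) (LAp ?f ?t))"
      by (rule nd_mp[OF ll', rotated 4]) (use wfG zx in auto)
    have "nd s ?G (LEq n (LAp ?f ?t) ?Z)"
    proof (rule nd_disjE)
      show "nd s ?G (?cho ?t)" by (rule cho') (use zx in auto)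
      let ?E = "LAnd (lnot (llt 8 ?t (nv 6))) (LEq n (LAp ?f ?t) ?Z) # ?G"
      show "nd s ?E (LEq n (LAp ?f ?t) ?Z)"
        by (rule nd_conjE2[OF nd_asm, of "lnot (llt 8 ?t (nv 6))"]) (use wfG ty tyn in auto)
      let ?D = "LAnd (llt 8 ?t (nv 6)) (LEq n (LAp ?f ?t) (LAp ?h ?t)) # ?G"
      have "nd s ?D (llt 8 ?t (nv 6))"
        by (rule nd_conjE1[OF nd_asm, of _ "LEq n (LAp ?f ?t) (LAp ?h ?t)"])
          (use wfG ty tyn in auto)
      moreover have "nd s [] (lnot (llt 8 ?t (nv 6)))"
        by (rule add_not_llt) (use zx in auto)
      then have "nd s ?D (lnot (llt 8 ?t (nv 6)))"
        by (rule nd_weaken) (use wfG ty tyn in auto)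
      ultimately have "nd s ?D LBot" by (rule nd_notE[rotated])
      then show "nd s ?D (LEq n (LAp ?f ?t) ?Z)" by (rule nd_botE) (use ty tyn in auto)
    qed
    then have "nd s ?G (LEq n (LAp ?g ?t) ?Z)" by (rule nd_trans[OF gf])
    then show "nd s ?G (LEx Num x (LEq n (LAp ?g (LAdd (nv z) (nv x))) ?Z))"
      by (intro nd_exI[where t = "nv 6"]) (use zx ty tyn in auto)
  qed
  \<comment> \<open>The auxiliary objects are discharged from the inside out: the lawless
    continuation, the planned functional, and last the segment length on which both depend.\<close>
  then have "nd s (tl ?G) LBot"
    by - (rule nd_exE[OF nd_weaken[OF ll]], use wf zx in auto)
  then have "nd s (tl (tl ?G)) LBot"
    by - (rule nd_exE[OF nd_weaken[OF cho]], use wf zx in auto)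
  then show "nd s [?psi ?h] LBot"
    by - (rule nd_exE[OF cont], use wf zx in auto)
qed

text \<open>The index \<open>k\<close> comes from the given comprehension axiom and may clash with
  the reserved ones. The genericity proof therefore uses the name 4, which is exchanged only
  afterwards.\<close>

lemma lawless_generic_fresh:
  assumes "typeok s (Suc n)" "10 \<le> b" "k < b"
  shows "nd s [] (lnot (lnot (LEx Num (b+4)
    (LEq n (LAp (LV (Lls (Suc n)) b) (LAdd (nv (b+3)) (nv (b+4)))) (LV (psort n) k)))))"
proof -
  have "nd s [] (lnot (lnot (LEx Num (b+4)
    (LEq n (LAp (LV (Lls (Suc n)) b) (LAdd (nv (b+3)) (nv (b+4)))) (LV (psort n) 4)))))"
    by (rule lawless_generic) (use assms in auto)
  from nd_inst[OF this, of "psort n" "LV (psort n) k" 4] assms show ?thesis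
    by (auto dest: typeok_Suc)
qed

lemma lidx_lsubst: "lidx (lsubst v t p) \<subseteq> lidx p \<union> snd ` lvs t"
  by (induction p) (auto simp: lvs_lsub split: if_splits)

text \<open>A functional is constructed outright, and only the last steps weaken its existence to
  the form that \<open>negt\<close> gives to an existential formula.\<close>

lemma lprov_comprehension:
  assumes q: "inL q" "lwfs s q" "lsrt_le q (Suc n)" and ty: "typeok s (Suc n)"
    and b: "10 \<le> b" "k < b" "\<And>j. j \<in> lidx q \<Longrightarrow> j < b"
  shows "lprov s (negt (LEx (Fn (Suc n)) b (LAll (psort n) k
    (liff (LEx Num (b+1) (LEq n (LAp (LV (Fn (Suc n)) b) (nv (b+1))) (lsucc n (LV (psort n) k)))) q))))"
proof -
  \<comment> \<open>The creating subject is consulted about the negative translation itself. It lies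
    in \<open>L\<close>, as \<open>LPr\<close> requires, and it is stable.\<close>
  define p where "p = negt q"
  define P where "P t = lsubst (psort n, k) t p" for t
  \<comment> \<open>Fresh indices are allotted from \<open>b\<close> upward: \<open>b\<close> for
    the functional and the lawless object, then argument, choice variable, stage and offset. The
    position \<open>?w\<close> is stage plus offset.\<close>
  let ?h = "LV (Lls (Suc n)) b" and ?f = "LV (Fn (Suc n)) b" and ?Z = "LV (psort n) k"
  let ?i = "nv (b+2)"
  let ?y = "nv (b+1)" and ?z = "nv (b+3)" and ?x = "nv (b+4)"
  let ?w = "LAdd ?z ?x"
  have tyn: "typeok s n" using ty by (rule typeok_Suc)
  have p: "inL p" "lwfs s p" "lsrt_le p (Suc n)" and idx: "\<And>j. j \<in> lidx p \<Longrightarrow> j < b"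
    using q b unfolding p_def lsrt_le_def by auto
  have fvp: "j < b" if "(X, j) \<in> lfv p" for X j using that idx lfv_lidx by fastforce
  have PZ: "P ?Z = p" by (simp add: P_def)
  have P_free: "lfree_for t (psort n, k) p" if "\<And>v. v \<in> lvs t \<Longrightarrow> b \<le> snd v" for t
    by (rule lfree_for_fresh) (use that idx leD in blast)
  have free: "lfree_for (LAp ?h ?y) (psort n, k) p" "lfree_for (LAp ?h ?w) (psort n, k) p"
    by (rule P_free; auto)+
  have P_wf: "lwfs s (P t)" "inL (P t)" if "ltm_ok s t n" for t
    using that p by (auto simp: P_def intro: lwfs_lsubst)
  have P_fv: "lfv (P t) \<subseteq> lfv p - {(psort n, k)} \<union> lvs t" for t
    unfolding P_def by (rule lfv_lsubst)
  have P_fresh: "(X, j) \<notin> lfv (P t)" if "b \<le> j" "(X, j) \<notin> lvs t" for X j t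
    using P_fv[of t] that fvp leD by blast
  have P_sub: "lsubst (Num, j) a (P t) = P (lsub (Num, j) a t)" if "b \<le> j" for j a t
    unfolding P_def using that b idx by (intro lsubst_lsubst) fastforce+
  let ?d = "\<lambda>t. LPr t (P (LAp ?h t))"
  let ?C = "\<lambda>t. LOr (LAnd (?d t) (LEq n (LAp ?f t) (lsucc n (LAp ?h t))))
     (LAnd (lnot (?d t)) (LEq n (LAp ?f t) (kk n)))"
  let ?cho = "LAll Num (b+2) (?C ?i)"
  have dwf: "lwfs s (?d t)" if "ltm_ok s t 0" for t using that P_wf ty by auto
  have Cwf: "lwfs s (?C t)" if "ltm_ok s t 0" for t using that dwf ty tyn by auto
  have dec: "nd s [] (LOr (?d ?i) (lnot (?d ?i)))"
    by (rule nd_ax[OF lCS1]) (use dwf[of ?i] in auto)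
  have cho: "nd s [] (LEx (Fn (Suc n)) b ?cho)"
  proof (rule definition_by_cases[OF dec])
    show "lsrt_le (?d ?i) (Suc n)"
      using P_fv[of "LAp ?h ?i"] p(3) unfolding lsrt_le_def by fastforce
    show "(Fn (Suc n), b) \<notin> lfv (?d ?i) \<union> lvs (lsucc n (LAp ?h ?i)) \<union> lvs (kk n)"
      using P_fresh[of b "Fn (Suc n)" "LAp ?h ?i"] by auto
  qed (use ty tyn in auto)
  have inst: "nd s G (?C t)"
    if "nd s G ?cho" "ltm_ok s t 0" "\<And>v. v \<in> lvs t \<Longrightarrow> b + 2 < snd v \<or> snd v = b + 1" for G t
  proof -
    have "lfree_for t (Num, b+2) (P (LAp ?h ?i))"
    proof (rule lfree_for_fresh)
      fix v assume "v \<in> lvs t"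
      with that(3) have "b < snd v" "snd v \<noteq> b + 2" by fastforce+
      then show "snd v \<notin> lidx (P (LAp ?h ?i))"
        using lidx_lsubst[of "(psort n, k)" "LAp ?h ?i" p] idx[of "snd v"] unfolding P_def by auto
    qed
    then have "nd s G (lsubst (Num, b+2) t (?C ?i))"
      using that by (intro nd_allE) (auto simp: ltm_ok_lwt)
    then show ?thesis by (simp add: P_sub)
  qed
  let ?e = "\<lambda>t. LEq n (LAp ?f t) (lsucc n ?Z)"
  \<comment> \<open>Two of the three negations come from translating the equation and one from
    translating the quantifier, so \<open>lnot ?U\<close> is the translated statement that
    \<open>?f\<close> enumerates \<open>?Z\<close>.\<close>
  let ?U = "LAll Num (b+1) (lnot (lnot (lnot (?e ?y))))"
  have wf: "lwfs s p" "lwfs s ?cho" "lwfs s ?U" using p Cwf[of ?i] ty tyn by auto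
  have cho_fresh: "(X, j) \<notin> lfv ?cho" if "b < j \<or> (X, j) = (psort n, k)" for X j
    using that P_fv[of "LAp ?h ?i"] fvp[of X j] b by auto
  have stab: "nd s G p" if "nd s G (lnot (lnot p))" for G
    using that stable_negt[of s q] by (auto simp: p_def stable_def)
  have CS3: "nd s [] (liff (LEx Num (b+3) (LPr ?z (P t))) (P t))"
    if "ltm_ok s t n" "(Num, b+3) \<notin> lvs t" for t
    by (rule nd_ax[OF lCS3]) (use that P_wf P_fresh in \<open>auto simp: liff_def\<close>)
  \<comment> \<open>Stability permits a proof by refuting \<open>lnot p\<close>; with falsity as the
    goal, each double negation on an equation can be removed.\<close>
  have "nd s [lnot ?U, ?cho] p"
  proof (rule stab, rule nd_notI, rule nd_notE[of _ _ ?U])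
    let ?G = "[lnot p, lnot ?U, ?cho]"
    show "nd s ?G (lnot ?U)" by (rule nd_asm) (use wf in auto)
    let ?D = "[?e ?y, lnot (lnot (?e ?y)), lnot p, lnot ?U, ?cho]"
    have wfD: "wfc s ?D" using wf ty tyn by simp
    have ey: "nd s (c # ?D) (LEq n (lsucc n ?Z) (LAp ?f ?y))" if "lwfs s c" for c
      by (rule nd_sym[OF nd_asm]) (use wfD that in auto)
    have "nd s ?D LBot"
    proof (rule nd_disjE)
      show "nd s ?D (?C ?y)" by (rule inst[OF nd_asm]) (use wfD in auto)
      let ?a = "LEq n (LAp ?f ?y) (lsucc n (LAp ?h ?y))"
      let ?H = "LAnd (?d ?y) ?a # ?D"
      have wfH: "wfc s ?H" using wfD Cwf[of ?y] by auto
      have "nd s ?H ?a" by (rule nd_conjE2[OF nd_asm, of "?d ?y"]) (use wfH in auto)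
      with ey have "nd s ?H (LEq n (lsucc n ?Z) (lsucc n (LAp ?h ?y)))"
        by (rule nd_trans) (use wfH in auto)
      then have Zh: "nd s ?H (LEq n (LAp ?h ?y) ?Z)" by (rule nd_sym[OF lsucc_inject])
      have fr: "(Num, b+3) \<notin> lfv (P (LAp ?h ?y))" by (rule P_fresh) auto
      have "nd s ?H (?d ?y)" by (rule nd_conjE1[OF nd_asm, of _ ?a]) (use wfH in auto)
      then have "nd s ?H (lsubst (Num, b+3) ?y (LPr ?z (P (LAp ?h ?y))))" using fr by simp
      then have "nd s ?H (LEx Num (b+3) (LPr ?z (P (LAp ?h ?y))))"
        by (rule nd_exI) (use ty P_wf lfree_for_notin[OF fr] in auto)
      moreover have "nd s ?H (liff (LEx Num (b+3) (LPr ?z (P (LAp ?h ?y)))) (P (LAp ?h ?y)))"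
        by (rule nd_weaken[OF CS3]) (use wfH ty in auto)
      ultimately have "nd s ?H (P (LAp ?h ?y))" unfolding liff_def
        by (rule nd_mp[OF nd_conjE1, rotated])
      then have "nd s ?H p"
        using nd_leib[OF Zh, of k p] p free
        by (simp add: P_def[symmetric] del: nd.simps)
      moreover have "nd s ?H (lnot p)" by (rule nd_asm) (use wfH in auto)
      ultimately show "nd s ?H LBot" by (rule nd_notE[rotated])
      let ?c = "LEq n (LAp ?f ?y) (kk n)"
      let ?H = "LAnd (lnot (?d ?y)) ?c # ?D"
      have wfH: "wfc s ?H" using wfD Cwf[of ?y] by auto
      have "nd s ?H ?c" by (rule nd_conjE2[OF nd_asm, of "lnot (?d ?y)"]) (use wfH in auto)
      with ey have "nd s ?H (LEq n (lsucc n ?Z) (kk n))"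
        by (rule nd_trans) (use wfH in auto)
      then show "nd s ?H LBot" by (rule lsucc_neq_kk)
    qed
    then have "nd s (lnot (lnot (?e ?y)) # ?G) (lnot (?e ?y))" by (rule nd_notI)
    moreover have "nd s (lnot (lnot (?e ?y)) # ?G) (lnot (lnot (?e ?y)))"
      by (rule nd_asm) (use wfD in auto)
    ultimately have "nd s (lnot (lnot (?e ?y)) # ?G) LBot" by (rule nd_notE[rotated])
    then have "nd s ?G (lnot (lnot (lnot (?e ?y))))" by (rule nd_notI)
    then show "nd s ?G ?U"
      by (rule nd_allI) (use cho_fresh[of "b+1" Num] fvp[of Num "b+1"] in auto)
  qed
  then have 1: "nd s [?cho] (LImp (lnot ?U) p)" by simp
  have "nd s [p, ?cho] (lnot ?U)"
  proof (rule nd_notI)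
    let ?G = "[?U, p, ?cho]"
    have "nd s ?G (liff (LEx Num (b+3) (LPr ?z p)) p)"
      using nd_weaken[OF CS3[of ?Z], of ?G] wf tyn b by (auto simp: PZ simp del: nd.simps)
    moreover have "nd s ?G p" by (rule nd_asm) (use wf in auto)
    ultimately have ex: "nd s ?G (LEx Num (b+3) (LPr ?z p))" unfolding liff_def
      by (rule nd_mp[OF nd_conjE2])
    let ?D = "LPr ?z p # ?G"
    let ?g = "LEq n (LAp ?h ?w) ?Z"
    let ?E = "?g # LEx Num (b+4) ?g # ?D"
    have wfE: "wfc s ?E" using wf p ty tyn by simp
    have "nd s ?E LBot"
    proof (rule nd_disjE)
      show "nd s ?E (?C ?w)" by (rule inst[OF nd_asm]) (use wfE in auto)
      let ?a = "LEq n (LAp ?f ?w) (lsucc n (LAp ?h ?w))"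
      let ?H = "LAnd (?d ?w) ?a # ?E"
      have wfH: "wfc s ?H" using wfE Cwf[of ?w] by auto
      have a: "nd s ?H ?a" by (rule nd_conjE2[OF nd_asm, of "?d ?w"]) (use wfH in auto)
      have e: "nd s ?H (?e ?w)"
        by (rule nd_trans[OF a nd_cong_lsucc[OF nd_asm]]) (use wfH in auto)
      have "nd s ?H (lsubst (Num, b+1) ?w (lnot (lnot (lnot (?e ?y)))))"
        by (rule nd_allE[OF nd_asm]) (use wfH in auto)
      then have "nd s ?H (lnot (lnot (lnot (?e ?w))))" using b by auto
      then have "nd s ?H (lnot (?e ?w))" using stable_lnot by (simp add: stable_def del: nd.simps)
      then show "nd s ?H LBot" using e by (rule nd_notE)
      let ?c = "LEq n (LAp ?f ?w) (kk n)"
      let ?H = "LAnd (lnot (?d ?w)) ?c # ?E"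
      have wfH: "wfc s ?H" using wfE Cwf[of ?w] by auto
      have Zh: "nd s ?H (LEq n ?Z (LAp ?h ?w))" by (rule nd_sym[OF nd_asm]) (use wfH in auto)
      \<comment> \<open>(CS2) passes from stage \<open>z\<close> to stage \<open>z + x\<close>.
        Genericity was phrased with a sum, so its position has precisely this form.\<close>
      have "nd s [] (LImp (LPr ?z p) (LPr ?w p))" by (rule nd_ax[OF lCS2]) (use p in auto)
      then have "nd s ?H (LPr ?w p)"
        by - (rule nd_mp[OF nd_weaken nd_asm], use wfH in auto)
      then have "nd s ?H (?d ?w)"
        using nd_leib[OF Zh, of k "LPr ?w p"] p free b
        by (auto simp: P_def[symmetric] PZ simp del: nd.simps)
      moreover have "nd s ?H (lnot (?d ?w))" by (rule nd_conjE1[OF nd_asm, of _ ?c]) (use wfH in auto)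
      ultimately show "nd s ?H LBot" by (rule nd_notE[rotated])
    qed
    then have "nd s (LEx Num (b+4) ?g # ?D) LBot"
      by (rule nd_exE[OF nd_asm, rotated 2])
        (use wfE cho_fresh[of "b+4" Num] fvp[of Num "b+4"] b in auto)
    then have "nd s ?D (lnot (LEx Num (b+4) ?g))" by (rule nd_notI)
    moreover have "nd s ?D (lnot (lnot (LEx Num (b+4) ?g)))"
      by (rule nd_weaken[OF lawless_generic_fresh]) (use ty b wfE in auto)
    ultimately have "nd s ?D LBot" by (rule nd_notE[rotated])
    then show "nd s ?G LBot"
      by (rule nd_exE[OF ex]) (use cho_fresh[of "b+3" Num] fvp[of Num "b+3"] b in auto)
  qed
  then have "nd s [?cho] (liff (lnot ?U) p)" unfolding liff_def
    by (intro nd_conjI[OF 1] nd_impI)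
  then have A: "nd s [?cho] (LAll (psort n) k (liff (lnot ?U) p))" (is "nd s _ ?A")
    by (rule nd_allI) (use tyn cho_fresh[of k "psort n"] in auto)
  have wfA: "lwfs s ?A" using nd_wf[OF A] by simp
  have "nd s [LAll (Fn (Suc n)) b (lnot ?A), ?cho] LBot"
  proof (rule nd_notE)
    show "nd s [LAll (Fn (Suc n)) b (lnot ?A), ?cho] (lnot ?A)"
      by (rule nd_allE_self[OF nd_asm]) (use wf wfA ty in auto)
    show "nd s [LAll (Fn (Suc n)) b (lnot ?A), ?cho] ?A"
      by (rule nd_mono[OF A]) (use wf wfA ty in auto)
  qed
  then have "nd s [?cho] (lnot (LAll (Fn (Suc n)) b (lnot ?A)))" by (rule nd_notI)
  then have "nd s [] (lnot (LAll (Fn (Suc n)) b (lnot ?A)))"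
    by (rule nd_exE[OF cho]) auto
  then show ?thesis unfolding p_def by (simp add: negt_liff)
qed

subsection \<open>Maximal consistent sets with witnesses\<close>

instance lsort :: countable by countable_datatype
instance ltm :: countable by countable_datatype
instance lfm :: countable by countable_datatype

definition ncons :: "nat option \<Rightarrow> lfm list \<Rightarrow> bool" where
  "ncons s G = (wfc s G \<and> \<not> nd s G LBot)"

definition wit :: "nat \<Rightarrow> lfm \<Rightarrow> lfm list \<Rightarrow> nat" where
  "wit k p G = Suc (k + Max (insert 0 (\<Union>q\<in>set (p # G). lidx q)))"

text \<open>The contexts are finite, so fresh variables can serve as Henkin witnesses.  The index of a
witness exceeds the stage, and every formula is treated infinitely often; hence every element
gets infinitely many names.\<close>

definition hstep :: "nat option \<Rightarrow> nat \<Rightarrow> lfm \<Rightarrow> lfm list \<Rightarrow> lfm list" where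
  "hstep s k p G = (if ncons s (p # G) then p # G else
    case p of LAll X i q \<Rightarrow>
      let r = lnot (lsubst (X, i) (LV X (wit k p G)) q) in if ncons s (r # G) then r # G else G
    | _ \<Rightarrow> G)"

fun hchain :: "nat option \<Rightarrow> lfm \<Rightarrow> nat \<Rightarrow> lfm list" where
  "hchain s p 0 = [p]"
| "hchain s p (Suc k) = hstep s k (from_nat (fst (prod_decode k))) (hchain s p k)"

text \<open>\<open>M\<close> decides every well-formed formula although derivability is
  intuitionistic, but counterexamples to universal formulas are promised only for stable bodies:
  inconsistency of all negated instances gives no more than their double negations. The lower bound
  \<open>N\<close> provides names that escape capture.\<close>

locale henkin =
  fixes s :: "nat option" and M :: "lfm set"
  assumes closed: "set D \<subseteq> M \<Longrightarrow> nd s D p \<Longrightarrow> p \<in> M"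
    and consistent: "LBot \<notin> M"
    and complete: "lwfs s p \<Longrightarrow> p \<in> M \<or> lnot p \<in> M"
    and witness: "stable s p \<Longrightarrow> lwfs s (LAll X i p) \<Longrightarrow> LAll X i p \<notin> M \<Longrightarrow>
      \<exists>y\<ge>N. lnot (lsubst (X, i) (LV X y) p) \<in> M"
    and wf: "p \<in> M \<Longrightarrow> lwfs s p"

lemma wit_fresh: "q \<in> set (p # G) \<Longrightarrow> j \<in> lidx q \<Longrightarrow> j < wit k p G"
proof -
  assume "q \<in> set (p # G)" "j \<in> lidx q"
  then have "j \<in> insert 0 (\<Union>q\<in>set (p # G). lidx q)" by auto
  then have "j \<le> Max (insert 0 (\<Union>q\<in>set (p # G). lidx q))" by (intro Max_ge) auto
  then show ?thesis by (simp add: wit_def)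
qed

lemma hstep_mono: "set G \<subseteq> set (hstep s k p G)"
  by (auto simp: hstep_def Let_def split: lfm.splits)

lemma ncons_hstep: "ncons s G \<Longrightarrow> ncons s (hstep s k p G)"
  by (auto simp: hstep_def Let_def split: lfm.splits simp del: nd.simps)

lemma hchain_mono: "k \<le> l \<Longrightarrow> set (hchain s p k) \<subseteq> set (hchain s p l)"
  by (induction l rule: dec_induct) (auto dest: subsetD[OF hstep_mono])

lemma ncons_hchain: "ncons s [p] \<Longrightarrow> ncons s (hchain s p k)"
  by (induction k) (simp_all add: ncons_hstep del: nd.simps)

lemma lsubst_back:
  "y \<notin> lidx p \<Longrightarrow> lsubst (X, y) (LV X i) (lsubst (X, i) (LV X y) p) = p"
  by (cases "y = i") (simp_all add: lsubst_lsubst)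

lemma lfree_for_back:
  "y \<notin> lidx p \<Longrightarrow> lfree_for (LV X i) (X, y) (lsubst (X, i) (LV X y) p)"
  by (induction p) (auto dest: lfv_lidx)

text \<open>If the negated instance were inconsistent, its double negation would hold for a fresh
  variable; stability and generalisation would then make the universal formula derivable, although
  it is inconsistent with \<open>G\<close>.\<close>

lemma ncons_witness:
  assumes st: "stable s q" and G: "wfc s G" and wf: "lwfs s (LAll X i q)"
    and inc: "\<not> ncons s (LAll X i q # G)" and cons: "ncons s G"
  shows "ncons s (lnot (lsubst (X, i) (LV X (wit k (LAll X i q) G)) q) # G)"
proof (rule ccontr)
  let ?y = "wit k (LAll X i q) G"
  let ?q = "lsubst (X, i) (LV X ?y) q"
  have y: "?y \<notin> lidx q" "\<And>p. p \<in> set G \<Longrightarrow> ?y \<notin> lidx p"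
    using wit_fresh[of "LAll X i q" "LAll X i q" G ?y k] wit_fresh[of _ "LAll X i q" G ?y k] by auto
  assume "\<not> ncons s (lnot ?q # G)"
  moreover have wfq: "lwfs s ?q" using wf by (auto intro: lwfs_lsubst)
  ultimately have "nd s (lnot ?q # G) LBot" using G by (auto simp: ncons_def)
  then have nn: "nd s G (lnot (lnot ?q))" by (rule nd_notI)
  have fr: "\<And>p. p \<in> set G \<Longrightarrow> (X, ?y) \<notin> lfv p" using y lfv_lidx by fastforce
  have inv: "lsubst (X, ?y) (LV X i) ?q = q" by (rule lsubst_back[OF y(1)])
  \<comment> \<open>The change of bound variable is made in a context of its own, because the
    original variable may be free in \<open>G\<close>.\<close>
  have "nd s [LAll X ?y (lnot (lnot ?q))] (lnot (lnot q))"
    using nd_allE[OF nd_asm, of X ?y "lnot (lnot ?q)" "[LAll X ?y (lnot (lnot ?q))]" s "LV X i"]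
      wf wfq lfree_for_back[OF y(1)] inv by (auto simp del: nd.simps)
  then have "nd s [LAll X ?y (lnot (lnot ?q))] q" using st by (simp add: stable_def del: nd.simps)
  then have "nd s [LAll X ?y (lnot (lnot ?q))] (LAll X i q)"
  proof (rule nd_allI)
    have "(X, i) \<notin> lfv ?q \<or> ?y = i" using lfv_lsubst[of "(X, i)" "LV X ?y" q] by auto
    then show "\<And>r. r \<in> set [LAll X ?y (lnot (lnot ?q))] \<Longrightarrow> (X, i) \<notin> lfv r" by auto
  qed (use wf in auto)
  then have "nd s [] (LImp (LAll X ?y (lnot (lnot ?q))) (LAll X i q))" by simp
  moreover have "nd s G (LAll X ?y (lnot (lnot ?q)))"
    by (rule nd_allI[OF nn]) (use wf fr in auto)
  ultimately have "nd s G (LAll X i q)" using nd_weaken[OF _ G] nd_mp by blast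
  moreover have "nd s (LAll X i q # G) LBot" using inc G wf by (auto simp: ncons_def)
  ultimately show False using cons nd_cut by (auto simp: ncons_def simp del: nd.simps)
qed

lemma henkin_extension:
  assumes "ncons s [p0]"
  obtains M where "henkin s M" "p0 \<in> M"
proof
  define C where "C = hchain s p0"
  define M where "M = (\<Union>k. set (C k))"
  have cons: "ncons s (C k)" for k unfolding C_def using assms by (rule ncons_hchain)
  have mono: "set (C k) \<subseteq> set (C l)" if "k \<le> l" for k l unfolding C_def using that by (rule hchain_mono)
  have step: "C (Suc (prod_encode (to_nat p, N))) = hstep s (prod_encode (to_nat p, N)) p
      (C (prod_encode (to_nat p, N)))" for p N
    by (simp add: C_def)
  have dich: "p \<in> M \<or> (\<exists>k. nd s (p # C k) LBot)" if "lwfs s p" for p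
  proof (cases "ncons s (p # C (prod_encode (to_nat p, 0)))")
    case True
    then have "p \<in> set (C (Suc (prod_encode (to_nat p, 0))))" by (simp only: step) (simp add: hstep_def)
    then show ?thesis unfolding M_def by blast
  next
    case False
    then have "nd s (p # C (prod_encode (to_nat p, 0))) LBot"
      using that cons by (auto simp: ncons_def)
    then show ?thesis by blast
  qed
  have fin: "\<exists>k. set D \<subseteq> set (C k)" if "set D \<subseteq> M" for D
    using that
  proof (induction D)
    case (Cons a D)
    then obtain k l where "set D \<subseteq> set (C k)" "a \<in> set (C l)" unfolding M_def by auto
    then have "set (a # D) \<subseteq> set (C (max k l))" using mono[of k "max k l"] mono[of l "max k l"] by auto
    then show ?case by blast
  qed simp
  have wfC: "wfc s (C k)" for k using cons by (simp add: ncons_def)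
  have closed: "p \<in> M" if D: "set D \<subseteq> M" "nd s D p" for D p
  proof (rule ccontr)
    assume "p \<notin> M"
    have wfp: "lwfs s p" using nd_wf that by blast
    then obtain k where k: "nd s (p # C k) LBot" using dich \<open>p \<notin> M\<close> by blast
    obtain l where l: "set D \<subseteq> set (C l)" using fin D by blast
    let ?C = "C (max k l)"
    have "nd s ?C p" by (rule nd_mono[OF D(2)]) (use l mono[of l "max k l"] wfC in auto)
    moreover have "nd s (p # ?C) LBot"
      by (rule nd_mono[OF k]) (use mono[of k "max k l"] wfC wfp in auto)
    ultimately show False using cons nd_cut unfolding ncons_def by blast
  qed
  show "henkin s M"
  proof
    show "p \<in> M" if "set D \<subseteq> M" "nd s D p" for D p using closed that .
    show "LBot \<notin> M"
    proof
      assume "LBot \<in> M"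
      then obtain k where "LBot \<in> set (C k)" unfolding M_def by blast
      then show False using cons[of k] nd_asm wfC unfolding ncons_def by blast
    qed
    show "p \<in> M \<or> lnot p \<in> M" if wf: "lwfs s p" for p
    proof -
      have "lnot p \<in> M" if "nd s (p # C k) LBot" for k
        by (rule closed[of "C k"]) (use that nd_notI in \<open>auto simp: M_def\<close>)
      then show ?thesis using dich[OF wf] by blast
    qed
    show "lwfs s p" if "p \<in> M" for p using that wfC unfolding M_def by blast
    show "\<exists>y\<ge>N. lnot (lsubst (X, i) (LV X y) p) \<in> M"
      if st: "stable s p" and wf: "lwfs s (LAll X i p)" and nM: "LAll X i p \<notin> M" for p X i N
    proof -
      \<comment> \<open>This stage treats the formula and is at least \<open>N\<close>; the witness
        index is larger than the stage, hence also larger than \<open>N\<close>.\<close>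
      define k where "k = prod_encode (to_nat (LAll X i p), N)"
      let ?y = "wit k (LAll X i p) (C k)"
      let ?r = "lnot (lsubst (X, i) (LV X ?y) p)"
      have st': "C (Suc k) = hstep s k (LAll X i p) (C k)" unfolding k_def by (rule step)
      have "\<not> ncons s (LAll X i p # C k)"
      proof
        assume "ncons s (LAll X i p # C k)"
        then have "LAll X i p \<in> set (C (Suc k))" by (simp add: st' hstep_def)
        then show False using nM unfolding M_def by blast
      qed
      moreover from this have "ncons s (?r # C k)"
        using ncons_witness[OF st wfC wf _ cons] by blast
      ultimately have "?r \<in> set (C (Suc k))" by (simp add: st' hstep_def)
      then have "?r \<in> M" unfolding M_def by blast
      moreover have "N \<le> ?y" using le_prod_encode_2[of N "to_nat (LAll X i p)"]
        by (simp add: wit_def k_def)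
      ultimately show ?thesis by blast
    qed
  qed
  have "p0 \<in> set (C 0)" by (simp add: C_def)
  then show "p0 \<in> M" unfolding M_def by blast
qed

subsection \<open>The term model\<close>

fun esub :: "(lsort \<times> nat \<Rightarrow> ltm) \<Rightarrow> ltm \<Rightarrow> ltm" where
  "esub r (LV X i) = r (X, i)"
| "esub r LZ = LZ"
| "esub r (LKc m) = LKc m"
| "esub r (LS a) = LS (esub r a)"
| "esub r (LAdd a b) = LAdd (esub r a) (esub r b)"
| "esub r (LMul a b) = LMul (esub r a) (esub r b)"
| "esub r (LN m a) = LN m (esub r a)"
| "esub r (LAp f a) = LAp (esub r f) (esub r a)"

definition ldom :: "nat option \<Rightarrow> lsort \<Rightarrow> ltm set" where
  "ldom s X = {t. ladm X t \<and> ltm_ok s t (stype X)}"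

text \<open>Only atoms refer to \<open>M\<close>; connectives and quantifiers are evaluated
  classically. Falsity of \<open>LPr\<close> is a default value, as the truth lemma concerns
  formulas of \<open>L\<close>.\<close>

fun sat :: "nat option \<Rightarrow> lfm set \<Rightarrow> (lsort \<times> nat \<Rightarrow> ltm) \<Rightarrow> lfm \<Rightarrow> bool" where
  "sat s M r (LEq n a b) = (LEq n (esub r a) (esub r b) \<in> M)"
| "sat s M r (LPr z p) = False"
| "sat s M r LBot = False"
| "sat s M r (LAnd p q) = (sat s M r p \<and> sat s M r q)"
| "sat s M r (LOr p q) = (sat s M r p \<or> sat s M r q)"
| "sat s M r (LImp p q) = (sat s M r p \<longrightarrow> sat s M r q)"
| "sat s M r (LAll X i p) = (\<forall>t\<in>ldom s X. sat s M (r((X, i) := t)) p)"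
| "sat s M r (LEx X i p) = (\<exists>t\<in>ldom s X. sat s M (r((X, i) := t)) p)"

abbreviation lid :: "lsort \<times> nat \<Rightarrow> ltm" where "lid \<equiv> \<lambda>(X, i). LV X i"

lemma esub_lid [simp]: "esub lid t = t"
  by (induction t) auto

lemma esub_cong: "(\<And>v. v \<in> lvs t \<Longrightarrow> r v = r' v) \<Longrightarrow> esub r t = esub r' t"
  by (induction t) auto

lemma esub_lsub: "esub r (lsub v a t) = esub (r(v := esub r a)) t"
  by (induction t) auto

lemma sat_lnot [simp]: "sat s M r (lnot p) \<longleftrightarrow> \<not> sat s M r p"
  by (simp add: lnot_def)

lemma sat_liff [simp]: "sat s M r (liff p q) \<longleftrightarrow> (sat s M r p \<longleftrightarrow> sat s M r q)"
  by (auto simp: liff_def)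

lemma sat_cong: "(\<And>v. v \<in> lfv p \<Longrightarrow> r v = r' v) \<Longrightarrow> sat s M r p = sat s M r' p"
proof (induction p arbitrary: r r')
  case (LEq n a b)
  then show ?case using esub_cong[of a r r'] esub_cong[of b r r'] by simp
next
  case (LAll X i p)
  have "sat s M (r((X, i) := t)) p = sat s M (r'((X, i) := t)) p" for t
    by (rule LAll.IH) (use LAll.prems in auto)
  then show ?case by simp
next
  case (LEx X i p)
  have "sat s M (r((X, i) := t)) p = sat s M (r'((X, i) := t)) p" for t
    by (rule LEx.IH) (use LEx.prems in auto)
  then show ?case by simp
qed (simp, simp, metis UnCI lfv.simps(4) sat.simps(4), metis UnCI lfv.simps(5) sat.simps(5),
  metis UnCI lfv.simps(6) sat.simps(6))

lemma sat_lsubst: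
  "lfree_for t v p \<Longrightarrow> sat s M r (lsubst v t p) = sat s M (r(v := esub r t)) p"
proof (induction p arbitrary: r)
  case (LAll X i p)
  show ?case
  proof (cases "v \<in> lfv (LAll X i p)")
    case False
    then show ?thesis by (subst lsubst_fresh) (auto intro!: sat_cong simp del: sat.simps)
  next
    case True
    then have neq: "v \<noteq> (X, i)" and "lfree_for t v p" using LAll.prems by auto
    have "esub (r((X, i) := u)) t = esub r t" for u
      using True LAll.prems by (intro esub_cong) auto
    then have "sat s M (r((X, i) := u)) (lsubst v t p) = sat s M (r(v := esub r t, (X, i) := u)) p" for u
      using LAll.IH[OF \<open>lfree_for t v p\<close>, of "r((X, i) := u)"] fun_upd_twist[OF neq] by metis
    then show ?thesis using neq by (auto simp del: fun_upd_apply)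
  qed
next
  case (LEx X i p)
  show ?case
  proof (cases "v \<in> lfv (LEx X i p)")
    case False
    then show ?thesis by (subst lsubst_fresh) (auto intro!: sat_cong simp del: sat.simps)
  next
    case True
    then have neq: "v \<noteq> (X, i)" and "lfree_for t v p" using LEx.prems by auto
    have "esub (r((X, i) := u)) t = esub r t" for u
      using True LEx.prems by (intro esub_cong) auto
    then have "sat s M (r((X, i) := u)) (lsubst v t p) = sat s M (r(v := esub r t, (X, i) := u)) p" for u
      using LEx.IH[OF \<open>lfree_for t v p\<close>, of "r((X, i) := u)"] fun_upd_twist[OF neq] by metis
    then show ?thesis using neq by (auto simp del: fun_upd_apply)
  qed
qed (simp_all add: esub_lsub)

context henkin
begin

abbreviation E :: "nat \<Rightarrow> ltm \<Rightarrow> ltm \<Rightarrow> bool" where "E n a b \<equiv> LEq n a b \<in> M"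

lemma closed0: "nd s [] p \<Longrightarrow> p \<in> M"
  using closed[of "[]"] by simp

lemma closed1: "nd s [p] q \<Longrightarrow> p \<in> M \<Longrightarrow> q \<in> M"
  using closed[of "[p]"] by simp

lemma closed2: "nd s [p, q] r \<Longrightarrow> p \<in> M \<Longrightarrow> q \<in> M \<Longrightarrow> r \<in> M"
  using closed[of "[p, q]"] by simp

lemma E_ok: "E n a b \<Longrightarrow> ltm_ok s a n \<and> ltm_ok s b n \<and> typeok s n"
  using wf[of "LEq n a b"] by simp

lemma E_refl: "ltm_ok s a n \<Longrightarrow> E n a a"
  by (rule closed0[OF nd_refl]) auto

lemma E_sym: "E n a b \<Longrightarrow> E n b a"
  by (rule closed1[OF nd_sym[OF nd_asm]]) (auto dest: E_ok)

lemma E_trans: "E n a b \<Longrightarrow> E n b c \<Longrightarrow> E n a c"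
  by (rule closed2[of "LEq n a b" "LEq n b c", OF nd_trans[OF nd_asm[of "LEq n a b"] nd_asm[of "LEq n b c"]]]) (auto dest: E_ok)

lemma E_S: "E 0 a b \<Longrightarrow> E 0 (LS a) (LS b)"
  by (rule closed1[OF nd_cong_S[OF nd_asm]]) (auto dest: E_ok)

lemma E_N: "E n a b \<Longrightarrow> 1 \<le> n \<Longrightarrow> E n (LN n a) (LN n b)"
  by (rule closed1[OF nd_cong_N[OF nd_asm]]) (auto dest: E_ok)

lemma E_Add: "E 0 a b \<Longrightarrow> E 0 c d \<Longrightarrow> E 0 (LAdd a c) (LAdd b d)"
  by (rule closed2[of "LEq 0 a b" "LEq 0 c d", OF nd_cong_Add[OF nd_asm[of "LEq 0 a b"] nd_asm[of "LEq 0 c d"]]]) (auto dest: E_ok)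

lemma E_Mul: "E 0 a b \<Longrightarrow> E 0 c d \<Longrightarrow> E 0 (LMul a c) (LMul b d)"
  by (rule closed2[of "LEq 0 a b" "LEq 0 c d", OF nd_cong_Mul[OF nd_asm[of "LEq 0 a b"] nd_asm[of "LEq 0 c d"]]]) (auto dest: E_ok)

lemma E_Ap: "E (Suc n) a b \<Longrightarrow> E 0 c d \<Longrightarrow> E n (LAp a c) (LAp b d)"
  by (rule closed2[of "LEq (Suc n) a b" "LEq 0 c d", OF nd_cong_Ap[OF nd_asm[of "LEq (Suc n) a b"] nd_asm[of "LEq 0 c d"]]]) (auto dest: E_ok)

lemma M_not: "lwfs s p \<Longrightarrow> lnot p \<in> M \<longleftrightarrow> p \<notin> M"
  using complete[of p] consistent
    closed2[of "lnot p" p, OF nd_notE[OF nd_asm[of "lnot p"] nd_asm[of p]]] by auto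

lemma M_and: "LAnd p q \<in> M \<longleftrightarrow> p \<in> M \<and> q \<in> M"
proof
  assume a: "LAnd p q \<in> M"
  then have "nd s [LAnd p q] (LAnd p q)" using wf[of "LAnd p q"] by (intro nd_asm) auto
  then show "p \<in> M \<and> q \<in> M" using a closed1 nd_conjE1 nd_conjE2 by blast
next
  assume "p \<in> M \<and> q \<in> M"
  then show "LAnd p q \<in> M" using wf closed2[of p q, OF nd_conjI[OF nd_asm[of p] nd_asm[of q]]] by auto
qed

lemma M_imp:
  assumes "lwfs s p" "lwfs s q"
  shows "LImp p q \<in> M \<longleftrightarrow> (p \<in> M \<longrightarrow> q \<in> M)"
proof
  assume "LImp p q \<in> M"
  then show "p \<in> M \<longrightarrow> q \<in> M" using assms closed2[of "LImp p q" p, OF nd_mp[OF nd_asm[of "LImp p q"] nd_asm[of p]]] by auto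
next
  assume a: "p \<in> M \<longrightarrow> q \<in> M"
  show "LImp p q \<in> M"
  proof (cases "p \<in> M")
    case True
    have "nd s [q] (LImp p q)" by (rule nd_impI, rule nd_asm) (use assms in auto)
    then show ?thesis using closed1 True a by blast
  next
    case False
    have "nd s [lnot p] (LImp p q)"
      by (rule nd_impI, rule nd_botE, rule nd_notE[OF nd_asm[of "lnot p"] nd_asm[of p]]) (use assms in auto)
    then show ?thesis using closed1 False M_not assms by blast
  qed
qed

text \<open>Variables whose index occurs in the body are left out because of capture. Nothing is
  lost, since a counterexample can be found beyond any given index.\<close>

lemma M_all:
  assumes st: "stable s p" and w: "lwfs s (LAll X i p)"
  shows "LAll X i p \<in> M \<longleftrightarrow> (\<forall>y. y \<notin> lidx p \<longrightarrow> lsubst (X, i) (LV X y) p \<in> M)"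
proof (intro iffI allI impI)
  fix y assume "LAll X i p \<in> M" "y \<notin> lidx p"
  moreover from this have "nd s [LAll X i p] (lsubst (X, i) (LV X y) p)"
    using w by (intro nd_allE[OF nd_asm] lfree_for_fresh) auto
  ultimately show "lsubst (X, i) (LV X y) p \<in> M" using closed1 by blast
next
  assume a: "\<forall>y. y \<notin> lidx p \<longrightarrow> lsubst (X, i) (LV X y) p \<in> M"
  show "LAll X i p \<in> M"
  proof (rule ccontr)
    assume "LAll X i p \<notin> M"
    then obtain y where y: "y \<ge> Suc (Max (insert 0 (lidx p)))" "lnot (lsubst (X, i) (LV X y) p) \<in> M"
      using witness[OF st w] by blast
    then have "y \<notin> lidx p" using Max_ge[of "insert 0 (lidx p)" y] by fastforce
    then show False using a y(2) M_not wf by blast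
  qed
qed

text \<open>The formula saying that \<open>t\<close> differs from every \<open>x\<close> fails at
  \<open>t\<close> itself, so it has a counterexample with large index; completeness of
  \<open>M\<close> turns this into an equation with a variable.\<close>

lemma named:
  assumes t: "t \<in> ldom s X" and X: "sok X"
  obtains y where "N \<le> y" "E (stype X) t (LV X y)"
proof -
  let ?n = "stype X"
  have ok: "ltm_ok s t ?n" "ladm X t" "typeok s ?n" using t by (auto simp: ldom_def dest: ltm_ok_typeok)
  obtain i where i: "\<And>X. (X, i) \<notin> lvs t" using exists_fresh[OF finite_lvs] by blast
  let ?p = "lnot (LEq ?n t (LV X i))"
  have "nd s [LAll X i ?p] (lsubst (X, i) t ?p)"
    by (rule nd_allE[OF nd_asm]) (use ok X in auto)
  then have "nd s [LAll X i ?p] (lnot (LEq ?n t t))" using i by simp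
  then have "LAll X i ?p \<notin> M"
    using closed1[of "LAll X i ?p"] M_not[of "LEq ?n t t"] E_refl[OF ok(1)] ok by auto
  then obtain y where "N \<le> y" "lnot (lsubst (X, i) (LV X y) ?p) \<in> M"
    using witness[OF stable_lnot, of X i] ok X by force
  moreover from this have "E ?n t (LV X y)" using M_not i ok X by (auto simp: M_not)
  ultimately show thesis using that by blast
qed

section \<open>Environments and the truth lemma\<close>

definition wtenv :: "(lsort \<times> nat \<Rightarrow> ltm) \<Rightarrow> bool" where
  "wtenv r = (\<forall>X i. sok X \<and> typeok s (stype X) \<longrightarrow> r (X, i) \<in> ldom s X)"

definition eqenv :: "(lsort \<times> nat \<Rightarrow> ltm) \<Rightarrow> (lsort \<times> nat \<Rightarrow> ltm) \<Rightarrow> bool" where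
  "eqenv r r' = (\<forall>X i. sok X \<and> typeok s (stype X) \<longrightarrow> E (stype X) (r (X, i)) (r' (X, i)))"

lemma eqenv_upd: "eqenv r r' \<Longrightarrow> E (stype X) t u \<Longrightarrow> eqenv (r((X, i) := t)) (r'((X, i) := u))"
  by (auto simp: eqenv_def)

lemma eqenv_refl: "wtenv r \<Longrightarrow> eqenv r r"
  by (auto simp: eqenv_def wtenv_def ldom_def intro: E_refl)

lemma wtenv_lid: "wtenv lid"
  by (auto simp: wtenv_def ldom_def)

lemma E_esub: "ltm_ok s t n \<Longrightarrow> eqenv r r' \<Longrightarrow> E n (esub r t) (esub r' t)"
  by (induction t arbitrary: n)
    (auto simp: eqenv_def intro: E_refl E_S E_Add E_Mul E_N E_Ap)

lemma sat_eqenv: "lwfs s p \<Longrightarrow> eqenv r r' \<Longrightarrow> sat s M r p = sat s M r' p"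
proof (induction p arbitrary: r r')
  case (LEq n a b)
  have "E n (esub r a) (esub r' a)" "E n (esub r b) (esub r' b)"
    using LEq by (auto intro: E_esub)
  then show ?case by (auto intro: E_trans E_sym)
next
  case (LAll X i p)
  have "sat s M (r((X, i) := t)) p = sat s M (r'((X, i) := t)) p" if "t \<in> ldom s X" for t
    using that LAll by (intro LAll.IH eqenv_upd E_refl) (auto simp: ldom_def)
  then show ?case by simp
next
  case (LEx X i p)
  have "sat s M (r((X, i) := t)) p = sat s M (r'((X, i) := t)) p" if "t \<in> ldom s X" for t
    using that LEx by (intro LEx.IH eqenv_upd E_refl) (auto simp: ldom_def)
  then show ?case by simp
next
  case (LAnd p q) then show ?case by (metis lwfs.simps(4) sat.simps(4))
next
  case (LOr p q) then show ?case by (metis lwfs.simps(5) sat.simps(5))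
next
  case (LImp p q) then show ?case by (metis lwfs.simps(6) sat.simps(6))
qed auto

lemma sat_name:
  assumes "lwfs s p" "sok X" "typeok s (stype X)"
  shows "y \<notin> lidx p \<Longrightarrow>
      LV X y \<in> ldom s X \<and> sat s M (lid((X, i) := LV X y)) p = sat s M lid (lsubst (X, i) (LV X y) p)"
    and "t \<in> ldom s X \<Longrightarrow>
      \<exists>y. y \<notin> lidx p \<and> sat s M (lid((X, i) := t)) p = sat s M lid (lsubst (X, i) (LV X y) p)"
proof -
  show 1: "LV X y \<in> ldom s X \<and> sat s M (lid((X, i) := LV X y)) p = sat s M lid (lsubst (X, i) (LV X y) p)"
    if "y \<notin> lidx p" for y
    using that assms sat_lsubst[OF lfree_for_fresh, of "LV X y" p s M lid "(X, i)"]
    by (simp add: ldom_def del: fun_upd_apply)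
  show "\<exists>y. y \<notin> lidx p \<and> sat s M (lid((X, i) := t)) p = sat s M lid (lsubst (X, i) (LV X y) p)"
    if "t \<in> ldom s X"
  proof -
    obtain y where y: "Suc (Max (insert 0 (lidx p))) \<le> y" "E (stype X) t (LV X y)"
      using named[OF \<open>t \<in> ldom s X\<close> assms(2)] .
    then have "y \<notin> lidx p" using Max_ge[of "insert 0 (lidx p)" y] by fastforce
    moreover have "sat s M (lid((X, i) := t)) p = sat s M (lid((X, i) := LV X y)) p"
      using assms y by (intro sat_eqenv eqenv_upd eqenv_refl wtenv_lid)
    ultimately show ?thesis using 1 by blast
  qed
qed

text \<open>The induction is on size because the quantifier cases pass to instances under renaming
  rather than to subformulas. The environment stays the identity throughout.\<close>

lemma truth: "inL p \<Longrightarrow> lwfs s p \<Longrightarrow> sat s M lid p \<longleftrightarrow> negt p \<in> M"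
proof (induction "size p" arbitrary: p rule: less_induct)
  case less
  have sub: "lwfs s (lsubst (X, i) (LV X y) q)" if "lwfs s q" "sok X" "typeok s (stype X)" for X i y q
    using that by (auto intro: lwfs_lsubst)
  show ?case
  proof (cases p)
    case (LEq n a b)
    then show ?thesis using less.prems by (simp add: M_not)
  next
    case (LAnd q r)
    then show ?thesis using less by (simp add: M_and)
  next
    case (LOr q r)
    then show ?thesis using less by (simp add: M_and M_not)
  next
    case (LImp q r)
    then show ?thesis using less by (simp add: M_imp)
  next
    case (LAll X i q)
    then have q: "inL q" "lwfs s q" "sok X" "typeok s (stype X)" using less.prems by auto
    have IH: "sat s M lid (lsubst (X, i) (LV X y) q) \<longleftrightarrow> lsubst (X, i) (LV X y) (negt q) \<in> M" for y
      using less.hyps[of "lsubst (X, i) (LV X y) q"] LAll q sub by simp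
    have "negt p \<in> M \<longleftrightarrow> (\<forall>y. y \<notin> lidx q \<longrightarrow> lsubst (X, i) (LV X y) (negt q) \<in> M)"
      using M_all[OF stable_negt, of X i q] LAll q by simp
    also have "\<dots> \<longleftrightarrow> sat s M lid p"
      unfolding IH[symmetric] using sat_name[OF q(2-4), of _ i] LAll by (simp, blast)
    finally show ?thesis by blast
  next
    case (LEx X i q)
    then have q: "inL q" "lwfs s q" "sok X" "typeok s (stype X)" using less.prems by auto
    have IH: "sat s M lid (lsubst (X, i) (LV X y) q) \<longleftrightarrow> lsubst (X, i) (LV X y) (negt q) \<in> M" for y
      using less.hyps[of "lsubst (X, i) (LV X y) q"] LEx q sub by simp
    have nw: "lwfs s (lsubst (X, i) (LV X y) (negt q))" for y using q sub[of "negt q"] by simp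
    have "negt p \<in> M \<longleftrightarrow> \<not> (\<forall>y. y \<notin> lidx q \<longrightarrow> \<not> lsubst (X, i) (LV X y) (negt q) \<in> M)"
      using M_all[OF stable_lnot, of X i "negt q"] LEx q nw
      by (simp add: M_not lnot_def[of "negt q"]) (simp add: lnot_def[symmetric] M_not)
    also have "\<dots> \<longleftrightarrow> sat s M lid p"
      unfolding IH[symmetric] using sat_name[OF q(2-4), of _ i] LEx by (simp, blast)
    finally show ?thesis by blast
  qed (use less.prems consistent in auto)
qed

lemma lfv_ok: "lwfs s p \<Longrightarrow> v \<in> lfv p \<Longrightarrow> sok (fst v) \<and> typeok s (stype (fst v))"
proof -
  have tm: "v \<in> lvs t \<Longrightarrow> ltm_ok s t n \<Longrightarrow> sok (fst v) \<and> typeok s (stype (fst v))" for t n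
    by (induction t arbitrary: n) auto
  show "lwfs s p \<Longrightarrow> v \<in> lfv p \<Longrightarrow> ?thesis" by (induction p) (auto dest: tm)
qed

text \<open>The truth lemma speaks of the identity environment only. Other environments are reached
  by induction on the variables they move: a provable translation remains provable under a
  quantifier, which is then instantiated in the model.\<close>

lemma sat_lprov:
  assumes pr: "lprov s (negt p)" and L: "inL p" and r: "wtenv r"
  shows "sat s M r p"
proof -
  have "sat s M r p" if "finite V" "lprov s (negt p)" "inL p" "\<And>v. v \<notin> V \<Longrightarrow> r v = lid v"
    "\<And>v. v \<in> V \<Longrightarrow> sok (fst v) \<and> typeok s (stype (fst v)) \<and> r v \<in> ldom s (fst v)" for V p r
    using that
  proof (induction V arbitrary: p r rule: finite_induct)
    case empty
    then have "r = lid" by auto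
    moreover have "lwfs s p" using lprov_wf[OF empty.prems(1)] by simp
    ultimately show ?case using truth closed0 empty.prems by simp
  next
    case (insert v V)
    obtain X i where v: "v = (X, i)" by (cases v)
    have "sat s M (r((X, i) := LV X i)) (LAll X i p)"
    proof (rule insert.IH)
      show "lprov s (negt (LAll X i p))"
        using insert.prems(1) insert.prems(4)[of v] v by (auto intro: lprov_all)
    qed (use insert v in auto)
    then have "\<forall>t\<in>ldom s X. sat s M (r((X, i) := t)) p" by simp
    then have "sat s M (r((X, i) := r (X, i))) p" using insert.prems(4)[of v] v by auto
    then show ?case by simp
  qed
  from this[of "lfv p" p "\<lambda>v. if v \<in> lfv p then r v else lid v"]
  have "sat s M (\<lambda>v. if v \<in> lfv p then r v else lid v) p"
    using pr L r lfv_ok[of p] lprov_wf[OF pr] by (force simp: wtenv_def)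
  then show ?thesis by (subst sat_cong[of p r]) auto
qed

end

subsection \<open>Syntax of the translation\<close>

lemma twt_unique: "twt a n \<Longrightarrow> twt a m \<longleftrightarrow> m = n"
  by (cases a) auto

lemma twt_tsub: "twt a (fst v) \<Longrightarrow> twt (tsub v a t) n = twt t n"
  by (induction t arbitrary: n) (auto simp: twt_unique)

lemma twfs_tsubst: "twt a (fst v) \<Longrightarrow> twfs s (tsubst v a p) = twfs s p"
  by (induction p) (auto simp: twt_tsub)

lemma tsub_fresh: "v \<notin> tvs u \<Longrightarrow> tsub v t u = u"
  by (induction u) auto

lemma tsubst_fresh: "v \<notin> tfv p \<Longrightarrow> tsubst v t p = p"
  by (induction p) (auto simp: tsub_fresh)

lemma tvs_typeok: "twt t n \<Longrightarrow> typeok s n \<Longrightarrow> v \<in> tvs t \<Longrightarrow> typeok s (fst v)"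
  by (induction t arbitrary: n) auto

lemma tfv_typeok: "twfs s p \<Longrightarrow> v \<in> tfv p \<Longrightarrow> typeok s (fst v)"
  by (induction p) (auto dest: tvs_typeok typeok_Suc)

lemma finite_tvs [simp]: "finite (tvs t)"
  by (induction t) auto

lemma finite_tfv [simp]: "finite (tfv p)"
  by (induction p) auto

lemma twfs_approx: "typeok s n \<Longrightarrow> twt a n \<Longrightarrow> twt b n \<Longrightarrow> twfs s (approx n a b)"
  by (induction n arbitrary: a b) (auto dest: typeok_Suc)

lemma twfs_star: "twfs s p \<Longrightarrow> twfs s (star p)"
  by (induction p) (auto simp: twfs_approx Let_def dest: typeok_Suc)

lemma tfv_approx: "tfv (approx n a b) \<subseteq> tvs a \<union> tvs b"
proof (induction n arbitrary: a b)
  case (Suc n)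
  then show ?case using Suc[of "TV n 0" "TV n 1"] by auto
qed simp

lemma tfv_star: "tfv (star p) \<subseteq> tfv p"
  by (induction p) (use tfv_approx in \<open>fastforce simp: Let_def\<close>)+

lemma lvs_ptm: "lvs (ptm t) = map_prod psort id ` tvs t"
  by (induction t) auto

lemma lfv_prime: "lfv (prime p) \<subseteq> map_prod psort id ` tfv p"
  by (induction p) (auto simp: lvs_ptm Let_def image_iff split: if_splits)

lemma inL_prime [simp]: "inL (prime p)"
  by (induction p) (auto simp: Let_def)

lemma ltm_ok_ptm: "twt t n \<Longrightarrow> typeok s n \<Longrightarrow> ltm_ok s (ptm t) n"
  by (induction t arbitrary: n) auto

lemma lwfs_prime: "twfs s p \<Longrightarrow> lwfs s (prime p)"
  by (induction p) (auto simp: Let_def ltm_ok_ptm dest: typeok_Suc)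

lemma tfresh_notin: "(n, tfresh n t) \<notin> tvs t"
proof
  assume "(n, tfresh n t) \<in> tvs t"
  then have "tfresh n t \<in> insert 0 (snd ` {v \<in> tvs t. fst v = n})" by force
  then have "tfresh n t \<le> Max (insert 0 (snd ` {v \<in> tvs t. fst v = n}))" by (intro Max_ge) auto
  then show False by (simp add: tfresh_def)
qed

lemma lfresh_notin: "(Num, lfresh t) \<notin> lvs t"
proof
  assume "(Num, lfresh t) \<in> lvs t"
  then have "lfresh t \<in> insert 0 (snd ` {v \<in> lvs t. fst v = Num})" by force
  then have "lfresh t \<le> Max (insert 0 (snd ` {v \<in> lvs t. fst v = Num}))" by (intro Max_ge) auto
  then show False by (simp add: lfresh_def)
qed

subsection \<open>The interpretation of type theory in the term model\<close>

text \<open>The test \<open>X = psort (stype X)\<close> selects number variables and functional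
  variables of positive type, the images of variables of type theory; all other variables denote
  themselves.\<close>

definition lenv :: "(nat \<times> nat \<Rightarrow> ltm) \<Rightarrow> lsort \<times> nat \<Rightarrow> ltm" where
  "lenv e = (\<lambda>(X, i). if X = psort (stype X) then e (stype X, i) else LV X i)"

definition teval :: "(nat \<times> nat \<Rightarrow> ltm) \<Rightarrow> ttm \<Rightarrow> ltm" where
  "teval e t = esub (lenv e) (ptm t)"

lemma lenv_psort [simp]: "lenv e (psort n, i) = e (n, i)"
  by (simp add: lenv_def)

lemma lenv_upd [simp]: "lenv (e((n, i) := t)) = (lenv e)((psort n, i) := t)"
  by (auto simp: lenv_def fun_eq_iff)

lemma teval_simps [simp]:
  "teval e (TV n i) = e (n, i)" "teval e TZ = LZ" "teval e (TS a) = LS (teval e a)"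
  "teval e (TAdd a b) = LAdd (teval e a) (teval e b)"
  "teval e (TMul a b) = LMul (teval e a) (teval e b)"
  by (simp_all add: teval_def)

lemma teval_cong: "(\<And>v. v \<in> tvs t \<Longrightarrow> e v = e' v) \<Longrightarrow> teval e t = teval e' t"
  by (induction t) auto

lemma teval_tsub: "teval e (tsub v a t) = teval (e(v := teval e a)) t"
  by (induction t) auto

lemma ldom_psort: "ldom s (psort n) = {t. ltm_ok s t n}"
  by (auto simp: ldom_def ltm_ok_lwt)

context henkin
begin

abbreviation D :: "nat \<Rightarrow> ltm set" where "D n \<equiv> {t. ltm_ok s t n}"

definition mem :: "nat \<Rightarrow> ltm \<Rightarrow> ltm \<Rightarrow> bool" where
  "mem n a b = (\<exists>y\<in>D 0. E n (LAp b y) (lsucc n a))"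

fun apx :: "nat \<Rightarrow> ltm \<Rightarrow> ltm \<Rightarrow> bool" where
  "apx 0 a b = E 0 a b"
| "apx (Suc n) a b = ((\<forall>z\<in>D n. mem n z a \<longrightarrow> (\<exists>u\<in>D n. mem n u b \<and> apx n z u)) \<and>
     (\<forall>z\<in>D n. mem n z b \<longrightarrow> (\<exists>u\<in>D n. mem n u a \<and> apx n z u)))"

lemma apx_refl: "a \<in> D n \<Longrightarrow> apx n a a"
proof (induction n arbitrary: a)
  case (Suc n)
  then show ?case by auto
qed (simp add: E_refl)

lemma apx_sym: "apx n a b \<Longrightarrow> apx n b a"
proof (induction n arbitrary: a b)
  case (Suc n)
  then show ?case by auto
qed (simp add: E_sym)

lemma apx_trans: "apx n a b \<Longrightarrow> apx n b c \<Longrightarrow> apx n a c"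
proof (induction n arbitrary: a b c)
  case (Suc n)
  have half: "\<forall>z\<in>D n. mem n z a \<longrightarrow> (\<exists>u\<in>D n. mem n u c \<and> apx n z u)"
    if "\<forall>z\<in>D n. mem n z a \<longrightarrow> (\<exists>u\<in>D n. mem n u b \<and> apx n z u)"
      "\<forall>z\<in>D n. mem n z b \<longrightarrow> (\<exists>u\<in>D n. mem n u c \<and> apx n z u)" for a b c
    using that Suc.IH by meson
  show ?case using Suc.prems half[of a b c] half[of c b a] by simp
qed (auto intro: E_trans)

abbreviation psem :: "(nat \<times> nat \<Rightarrow> ltm) \<Rightarrow> tfm \<Rightarrow> bool" where
  "psem e p \<equiv> sat s M (lenv e) (prime p)"

definition sem :: "(nat \<times> nat \<Rightarrow> ltm) \<Rightarrow> tfm \<Rightarrow> bool" where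
  "sem e p = psem e (star p)"

lemma psem_In:
  assumes "twt a n" "twt b (Suc n)"
  shows "psem e (TIn n a b) = mem n (teval e a) (teval e b)"
proof -
  let ?y = "lfresh (ptm a)"
  obtain j where b: "b = TV (Suc n) j" using assms(2) by (cases b) auto
  have "esub ((lenv e)((Num, ?y) := t)) (ptm a) = teval e a" for t
    unfolding teval_def using lfresh_notin by (intro esub_cong) auto
  then show ?thesis
    by (auto simp: mem_def Let_def b lsucc_def ldom_psort[of s 0, simplified] lenv_def)
qed

lemma psem_approx:
  "twt a n \<Longrightarrow> twt b n \<Longrightarrow> psem e (approx n a b) = apx n (teval e a) (teval e b)"
proof (induction n arbitrary: a b e)
  case 0
  then show ?case by (simp add: teval_def)
next
  case (Suc n)
  obtain i j where ab: "a = TV (Suc n) i" "b = TV (Suc n) j"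
    using Suc.prems by (cases a; cases b) auto
  have In: "psem e' (TIn n (TV n k) c) = mem n (e' (n, k)) (teval e' c)" if "twt c (Suc n)" for e' k c
    using psem_In[of "TV n k" n c] that by simp
  have IH: "psem e' (approx n (TV n 0) (TV n 1)) = apx n (e' (n, 0)) (e' (n, 1))" for e'
    using Suc.IH[of "TV n 0" "TV n 1"] by simp
  show ?case
    by (simp add: ldom_psort lenv_upd[symmetric] IH In ab
        del: prime.simps(2) lenv_upd One_nat_def)
qed

lemma sem_simps [simp]:
  "sem e TBot \<longleftrightarrow> False" "sem e (TAnd p q) \<longleftrightarrow> sem e p \<and> sem e q"
  "sem e (TOr p q) \<longleftrightarrow> sem e p \<or> sem e q" "sem e (TImp p q) \<longleftrightarrow> (sem e p \<longrightarrow> sem e q)"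
  "sem e (TAll n i p) \<longleftrightarrow> (\<forall>t\<in>D n. sem (e((n, i) := t)) p)"
  "sem e (TEx n i p) \<longleftrightarrow> (\<exists>t\<in>D n. sem (e((n, i) := t)) p)"
  "sem e (tneg p) \<longleftrightarrow> \<not> sem e p" "sem e (tiff p q) \<longleftrightarrow> (sem e p \<longleftrightarrow> sem e q)"
  by (auto simp: sem_def ldom_psort tneg_def tiff_def)

lemma sem_Eq [simp]:
  "twt a n \<Longrightarrow> twt b n \<Longrightarrow> sem e (TEq n a b) = apx n (teval e a) (teval e b)"
  by (simp add: sem_def psem_approx)

lemma sem_In [simp]:
  assumes "twt a n" "twt b (Suc n)"
  shows "sem e (TIn n a b) = (\<exists>z\<in>D n. mem n z (teval e b) \<and> apx n z (teval e a))"
proof -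
  let ?z = "tfresh n a"
  have "teval (e((n, ?z) := t)) a = teval e a" for t
    using tfresh_notin by (intro teval_cong) auto
  moreover have "teval (e((n, ?z) := t)) b = teval e b" for t
    using assms(2) by (cases b) auto
  moreover have "psem e (TEx n ?z (TAnd (TIn n (TV n ?z) b) (approx n (TV n ?z) a))) \<longleftrightarrow>
    (\<exists>t\<in>D n. psem (e((n, ?z) := t)) (TIn n (TV n ?z) b) \<and>
      psem (e((n, ?z) := t)) (approx n (TV n ?z) a))"
    by (simp add: ldom_psort del: prime.simps(2))
  ultimately show ?thesis
    using assms by (simp add: sem_def Let_def psem_In psem_approx del: prime.simps lenv_upd)
qed

lemma sem_cong:
  assumes "\<And>v. v \<in> tfv p \<Longrightarrow> e v = e' v"
  shows "sem e p = sem e' p"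
  unfolding sem_def
proof (rule sat_cong)
  fix v assume "v \<in> lfv (prime (star p))"
  then have "v \<in> map_prod psort id ` tfv p" using lfv_prime[of "star p"] tfv_star[of p] by blast
  then show "lenv e v = lenv e' v" using assms by (auto simp: lenv_def)
qed

lemma sem_tsubst:
  "twfs s p \<Longrightarrow> twt t (fst v) \<Longrightarrow> tfree_for t v p \<Longrightarrow>
    sem e (tsubst v t p) = sem (e(v := teval e t)) p"
proof (induction p arbitrary: e)
  case (TEq n a b)
  then show ?case by (simp add: twt_tsub teval_tsub del: fun_upd_apply)
next
  case (TIn n a b)
  then show ?case by (simp add: twt_tsub teval_tsub del: fun_upd_apply)
next
  case (TAll n i p)
  show ?case
  proof (cases "v \<in> tfv (TAll n i p)")
    case False
    then have "sem e (TAll n i p) = sem (e(v := teval e t)) (TAll n i p)"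
      by (intro sem_cong) auto
    then show ?thesis using tsubst_fresh[OF False] by (simp only:)
  next
    case True
    then have neq: "v \<noteq> (n, i)" and ff: "tfree_for t v p" using TAll.prems by auto
    have "teval (e((n, i) := u)) t = teval e t" for u
      using True TAll.prems by (intro teval_cong) auto
    then have "sem (e((n, i) := u)) (tsubst v t p) = sem (e(v := teval e t, (n, i) := u)) p" for u
      using TAll.IH[of "e((n, i) := u)"] TAll.prems ff fun_upd_twist[OF neq] by (metis twfs.simps(7))
    then show ?thesis using neq by (auto simp del: fun_upd_apply)
  qed
next
  case (TEx n i p)
  show ?case
  proof (cases "v \<in> tfv (TEx n i p)")
    case False
    then have "sem e (TEx n i p) = sem (e(v := teval e t)) (TEx n i p)"
      by (intro sem_cong) auto
    then show ?thesis using tsubst_fresh[OF False] by (simp only:)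
  next
    case True
    then have neq: "v \<noteq> (n, i)" and ff: "tfree_for t v p" using TEx.prems by auto
    have "teval (e((n, i) := u)) t = teval e t" for u
      using True TEx.prems by (intro teval_cong) auto
    then have "sem (e((n, i) := u)) (tsubst v t p) = sem (e(v := teval e t, (n, i) := u)) p" for u
      using TEx.IH[of "e((n, i) := u)"] TEx.prems ff fun_upd_twist[OF neq] by (metis twfs.simps(8))
    then show ?thesis using neq by (auto simp del: fun_upd_apply)
  qed
qed auto

definition wte :: "(nat \<times> nat \<Rightarrow> ltm) \<Rightarrow> bool" where
  "wte e = (\<forall>n i. typeok s n \<longrightarrow> e (n, i) \<in> D n)"

definition apxe :: "(nat \<times> nat \<Rightarrow> ltm) \<Rightarrow> (nat \<times> nat \<Rightarrow> ltm) \<Rightarrow> bool" where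
  "apxe e e' = (\<forall>n i. typeok s n \<longrightarrow> apx n (e (n, i)) (e' (n, i)))"

lemma wte_upd: "wte e \<Longrightarrow> t \<in> D n \<Longrightarrow> wte (e((n, i) := t))"
  by (auto simp: wte_def)

lemma wtenv_lenv: "wte e \<Longrightarrow> wtenv (lenv e)"
  unfolding wtenv_def
proof (intro allI impI)
  fix X i assume e: "wte e" and X: "sok X \<and> typeok s (stype X)"
  show "lenv e (X, i) \<in> ldom s X"
  proof (cases "X = psort (stype X)")
    case True
    then show ?thesis using e X ldom_psort[of s "stype X"] by (auto simp: lenv_def wte_def)
  qed (use X in \<open>auto simp: lenv_def ldom_def\<close>)
qed

lemma teval_D: "wte e \<Longrightarrow> twt t n \<Longrightarrow> typeok s n \<Longrightarrow> teval e t \<in> D n"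
  by (induction t arbitrary: n) (auto simp: wte_def)

lemma apxe_refl: "wte e \<Longrightarrow> apxe e e"
  by (auto simp: apxe_def wte_def intro: apx_refl)

lemma apxe_upd: "apxe e e' \<Longrightarrow> apx n t u \<Longrightarrow> apxe (e((n, i) := t)) (e'((n, i) := u))"
  by (auto simp: apxe_def)

lemma apx_teval:
  assumes e: "apxe e e'" and t: "twt t n" "typeok s n"
  shows "apx n (teval e t) (teval e' t)"
proof (cases n)
  case 0
  have "E 0 (teval e t) (teval e' t)" if "twt t 0" for t
    using that e by (induction t) (auto simp: apxe_def intro: E_refl E_S E_Add E_Mul dest: spec[of _ 0])
  then show ?thesis using 0 t by simp
next
  case (Suc m)
  then obtain j where "t = TV n j" using t by (cases t) auto
  then show ?thesis using e t by (simp add: apxe_def)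
qed

lemma apx_mem:
  assumes "apx (Suc n) b b'" "z \<in> D n" "mem n z b"
  shows "\<exists>u\<in>D n. mem n u b' \<and> apx n z u"
  using assms by simp

text \<open>Membership is closed under bisimilarity on the left by \<open>star\<close> and on the
  right by the clauses of \<open>apx\<close>. This gives Leibniz's law and makes the extent of a
  formula a legitimate set.\<close>

lemma sem_apx: "twfs s p \<Longrightarrow> apxe e e' \<Longrightarrow> sem e p = sem e' p"
proof (induction p arbitrary: e e')
  case (TEq n a b)
  then have "apx n (teval e a) (teval e' a)" "apx n (teval e b) (teval e' b)"
    by (auto intro: apx_teval)
  then show ?case using TEq.prems by (auto intro: apx_trans apx_sym)
next
  case (TIn n a b)
  then have ok: "twt a n" "twt b (Suc n)" "typeok s (Suc n)" by auto
  have a: "apx n (teval e a) (teval e' a)" using ok TIn.prems by (auto intro: apx_teval typeok_Suc)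
  have b: "apx (Suc n) (teval e b) (teval e' b)" using ok TIn.prems by (intro apx_teval) auto
  have imp: "\<exists>z\<in>D n. mem n z y' \<and> apx n z x'"
    if x: "apx n x x'" and y: "apx (Suc n) y y'" and ex: "\<exists>z\<in>D n. mem n z y \<and> apx n z x" for x x' y y'
  proof -
    obtain z where z: "z \<in> D n" "mem n z y" "apx n z x" using ex by blast
    obtain u where "u \<in> D n" "mem n u y'" "apx n z u" using apx_mem[OF y z(1,2)] by blast
    then show ?thesis using z x apx_trans apx_sym by blast
  qed
  show ?case
    unfolding sem_In[OF ok(1,2)] using imp[OF a b] imp[OF apx_sym[OF a] apx_sym[OF b]] by blast
next
  case (TAll n i p)
  have "sem (e((n, i) := t)) p = sem (e'((n, i) := t)) p" if "t \<in> D n" for t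
    using that TAll by (intro TAll.IH apxe_upd apx_refl) auto
  then show ?case by simp
next
  case (TEx n i p)
  have "sem (e((n, i) := t)) p = sem (e'((n, i) := t)) p" if "t \<in> D n" for t
    using that TEx by (intro TEx.IH apxe_upd apx_refl) auto
  then show ?case by simp
next
  case (TAnd p q) then show ?case by (metis sem_simps(2) twfs.simps(4))
next
  case (TOr p q) then show ?case by (metis sem_simps(3) twfs.simps(5))
next
  case (TImp p q) then show ?case by (metis sem_simps(4) twfs.simps(6))
qed auto

lemma sem_eq_axiom:
  assumes "lax (LEq 0 (ptm a) (ptm b))" "twt a 0" "twt b 0" "wte e"
  shows "sem e (TEq 0 a b)"
proof -
  let ?q = "LEq 0 (ptm a) (ptm b)"
  have wf: "lwfs s ?q" using assms by (auto intro: ltm_ok_ptm)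
  have "nd s [lnot ?q] LBot"
    by (rule nd_notE[OF nd_asm nd_ax[OF assms(1)]]) (use wf in auto)
  then have "lprov s (negt ?q)" by (simp add: lnot_def)
  from sat_lprov[OF this _ wtenv_lenv[OF assms(4)]] assms show ?thesis
    by (simp add: teval_def)
qed

lemma lfree_for_Suc: "lfree_for (LS (nv i)) (Num, i) p"
  by (induction p) auto

text \<open>Numbers of the model are terms and may be nonstandard, so induction must come from the
  calculus. As \<open>negt\<close> commutes with substitution, it carries an induction instance to
  an induction instance.\<close>

lemma sem_induct:
  assumes p: "twfs s p" and e: "wte e"
    and base: "sem (e((0, i) := LZ)) p"
    and step: "\<And>t. t \<in> D 0 \<Longrightarrow> sem (e((0, i) := t)) p \<Longrightarrow> sem (e((0, i) := LS t)) p"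
    and t: "t \<in> D 0"
  shows "sem (e((0, i) := t)) p"
proof -
  let ?q = "prime (star p)"
  have wf: "lwfs s ?q" using p by (intro lwfs_prime twfs_star)
  let ?ind = "\<lambda>q. LImp (LAnd (lsubst (Num, i) LZ q) (LAll Num i (LImp q (lsubst (Num, i) (LS (nv i)) q))))
    (LAll Num i q)"
  have wf': "lwfs s (?ind ?q)" using wf by (auto intro!: lwfs_lsubst)
  have "lprov s (negt (?ind ?q))"
    using lInd[of i "negt ?q"] wf' negt_simps(4)[of s "?ind ?q"]
    by (intro lprov_ax) (simp_all only: negt_simps(5) negt.simps)
  then have ind: "sat s M (lenv e) (?ind ?q)"
    by (rule sat_lprov) (use wtenv_lenv[OF e] in auto)
  have dom: "ldom s Num = D 0" using ldom_psort[of s 0] by simp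
  have conv: "sem (e((0, i) := u)) p = sat s M ((lenv e)((Num, i) := u)) ?q" for u
    using lenv_upd[of e 0 i u] by (simp add: sem_def)
  have "lfree_for LZ (Num, i) ?q" by (rule lfree_for_fresh) simp
  then have "sat s M (lenv e) (lsubst (Num, i) LZ ?q)"
    using base conv sat_lsubst[of LZ "(Num, i)" ?q] by simp
  moreover have "sat s M ((lenv e)((Num, i) := u)) (lsubst (Num, i) (LS (nv i)) ?q) =
      sat s M ((lenv e)((Num, i) := LS u)) ?q" for u
    using sat_lsubst[OF lfree_for_Suc, of s M "(lenv e)((Num, i) := u)" i ?q] by simp
  then have "sat s M (lenv e) (LAll Num i (LImp ?q (lsubst (Num, i) (LS (nv i)) ?q)))"
    using step conv dom by simp
  ultimately have "sat s M (lenv e) (LAll Num i ?q)" using ind by simp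
  then show ?thesis using t dom conv by simp
qed

text \<open>The raw membership \<open>mem\<close> is described exactly, before any closure under
  bisimilarity.\<close>

lemma sem_comprehension:
  assumes p: "twfs s p" and e: "wte e" and ty: "typeok s (Suc n)"
    and srt: "\<forall>v\<in>tfv p. fst v \<le> Suc n"
  shows "\<exists>F\<in>D (Suc n). \<forall>z\<in>D n. mem n z F \<longleftrightarrow> sem (e((n, k) := z)) p"
proof -
  let ?q = "prime (star p)"
  have wf: "lwfs s ?q" using p by (intro lwfs_prime twfs_star)
  have sub: "lfv ?q \<subseteq> map_prod psort id ` tfv p" using lfv_prime[of "star p"] tfv_star[of p] by blast
  have lsrt: "lsrt_le ?q (Suc n)" using sub srt unfolding lsrt_le_def by fastforce
  \<comment> \<open>The bound 10 clears the indices reserved by the lawless argument; the other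
    bounds keep the new variables apart from the formula and from \<open>k\<close>.\<close>
  obtain b where b: "10 \<le> b" "k < b" "\<And>j. j \<in> lidx ?q \<Longrightarrow> j < b"
  proof
    let ?B = "Suc (Max ({10, k} \<union> lidx ?q))"
    have "j < ?B" if "j \<in> {10, k} \<union> lidx ?q" for j
      using that by (intro le_imp_less_Suc Max_ge) auto
    then show "10 \<le> ?B" "k < ?B" "\<And>j. j \<in> lidx ?q \<Longrightarrow> j < ?B" by (fastforce intro: less_imp_le)+
  qed
  let ?f = "LEx (Fn (Suc n)) b (LAll (psort n) k (liff (LEx Num (b+1)
    (LEq n (LAp (LV (Fn (Suc n)) b) (nv (b+1))) (lsucc n (LV (psort n) k)))) ?q))"
  have pr: "lprov s (negt ?f)"
    by (rule lprov_comprehension) (use wf lsrt ty b in auto)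
  have "sat s M (lenv e) ?f"
    by (rule sat_lprov[OF pr _ wtenv_lenv[OF e]]) (simp add: liff_def)
  then obtain F where F: "F \<in> ldom s (Fn (Suc n))"
    "\<forall>z\<in>ldom s (psort n). sat s M ((lenv e)((Fn (Suc n), b) := F, (psort n, k) := z))
      (liff (LEx Num (b+1)
    (LEq n (LAp (LV (Fn (Suc n)) b) (nv (b+1))) (lsucc n (LV (psort n) k)))) ?q)"
    by auto
  have dom: "ldom s (Fn (Suc n)) = D (Suc n)" "ldom s Num = D 0"
    using ldom_psort[of s "Suc n"] ldom_psort[of s 0] by simp_all
  have nb: "(Fn (Suc n), b) \<notin> lfv ?q" using b(3) lfv_lidx by fastforce
  have esucc: "esub r (lsucc n t) = lsucc n (esub r t)" for r t by (simp add: lsucc_def)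
  have "mem n z F \<longleftrightarrow> sem (e((n, k) := z)) p" if z: "z \<in> D n" for z
  proof -
    have "sat s M ((lenv e)((Fn (Suc n), b) := F, (psort n, k) := z)) ?q =
        sat s M (lenv (e((n, k) := z))) ?q"
      using nb by (intro sat_cong) auto
    then show ?thesis using F(2) z b(2)
      by (auto simp: ldom_psort dom mem_def sem_def esucc)
  qed
  then show ?thesis using F(1) dom by blast
qed

theorem tax_sound:
  assumes "tax p" "twfs s p" "wte e"
  shows "sem e p"
  using assms
proof (induction rule: tax.induct)
  case (tAllE t n i p)
  then show ?case using teval_D[of e t n] by (simp add: sem_tsubst)
next
  case (tExI t n i p)
  then show ?case using teval_D[of e t n] by (auto simp: sem_tsubst)
next
  case (tRefl t n)
  then show ?case using teval_D[of e t n] by (simp add: apx_refl)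
next
  case (tLeib a n b i p)
  then have p: "twfs s p" using twfs_tsubst[of a "(n, i)" s p] by simp
  have "apx n (teval e a) (teval e b) \<Longrightarrow>
    sem (e((n, i) := teval e a)) p = sem (e((n, i) := teval e b)) p"
    using tLeib p by (intro sem_apx apxe_upd apxe_refl)
  then show ?case using tLeib p by (simp add: sem_tsubst)
next
  case tP1
  have "\<not> E 0 (LS (e (0, 0))) LZ"
  proof
    assume a: "E 0 (LS (e (0, 0))) LZ"
    then show False
      using closed1[of "LEq 0 (LS (e (0, 0))) LZ", OF Suc_neq_zero[OF nd_asm]] wf[OF a] a consistent
      by auto
  qed
  then show ?case by (simp)
next
  case tP2
  have "E 0 (e (0, 0)) (e (0, 1))" if a: "E 0 (LS (e (0, 0))) (LS (e (0, 1)))"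
    using closed1[of "LEq 0 (LS (e (0, 0))) (LS (e (0, 1)))", OF Suc_inject[OF nd_asm]] wf[OF a] a
    by auto
  then show ?case by simp
next
  case tP3
  show ?case by (rule sem_eq_axiom) (use lP3 tP3 in auto)
next
  case tP4
  show ?case by (rule sem_eq_axiom) (use lP4 tP4 in auto)
next
  case tP5
  show ?case by (rule sem_eq_axiom) (use lP5 tP5 in auto)
next
  case tP6
  show ?case by (rule sem_eq_axiom) (use lP6 tP6 in auto)
next
  case (tInd i p)
  have free: "tfree_for TZ (0, i) p" "tfree_for (TS (TV 0 i)) (0, i) p" by (induction p) auto
  have "sem (e((0, i) := t)) p"
    if base: "sem (e((0, i) := LZ)) p"
      and step: "\<forall>t\<in>D 0. sem (e((0, i) := t)) p \<longrightarrow> sem (e((0, i) := LS t)) p"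
      and "t \<in> D 0" for t
  proof (rule sem_induct)
    show "twfs s p" "wte e" using tInd by auto
    show "\<And>t. t \<in> D 0 \<Longrightarrow> sem (e((0, i) := t)) p \<Longrightarrow> sem (e((0, i) := LS t)) p"
      using step by blast
  qed fact+
  moreover have "sem e (tsubst (0, i) TZ p) = sem (e((0, i) := LZ)) p"
    using sem_tsubst[OF _ _ free(1), of e] tInd by simp
  moreover have "sem (e((0, i) := t)) (tsubst (0, i) (TS (TV 0 i)) p) = sem (e((0, i) := LS t)) p" for t
    using sem_tsubst[OF _ _ free(2), of "e((0, i) := t)"] tInd by simp
  ultimately show ?case by (simp only: sem_simps) blast
next
  case (tComp p n j k)
  then have ty: "typeok s (Suc n)" and p: "twfs s p" by (auto simp: tiff_def)
  obtain F where F: "F \<in> D (Suc n)" "\<forall>z\<in>D n. mem n z F \<longleftrightarrow> sem (e((n, k) := z)) p"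
    using sem_comprehension[OF p \<open>wte e\<close> ty tComp(1)] by blast
  \<comment> \<open>Closing the members of \<open>F\<close> under bisimilarity adds nothing, because
    the defining formula is itself invariant.\<close>
  have "(\<exists>w\<in>D n. mem n w F \<and> apx n w z) \<longleftrightarrow> sem (e((Suc n, j) := F, (n, k) := z)) p"
    if z: "z \<in> D n" for z
  proof -
    have "sem (e((Suc n, j) := F, (n, k) := z)) p = sem (e((n, k) := z)) p"
      using tComp(2) by (intro sem_cong) auto
    moreover have "sem (e((n, k) := w)) p = sem (e((n, k) := z)) p" if "apx n w z" for w
      using that p \<open>wte e\<close> by (intro sem_apx apxe_upd apxe_refl)
    ultimately show ?thesis using F(2) z apx_refl[OF z] by blast
  qed
  then show ?case using F(1) by auto
next
  case (tExt n)
  then have ty: "typeok s (Suc n)" by (simp add: tiff_def)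
  \<comment> \<open>A raw member of \<open>x\<close> lies in the closure of \<open>x\<close> by
    reflexivity, hence in that of \<open>y\<close>, and so is bisimilar to a raw member of
    \<open>y\<close>; the converse is symmetric.\<close>
  have "apx (Suc n) x y"
    if "\<forall>z\<in>D n. (\<exists>w\<in>D n. mem n w x \<and> apx n w z) \<longleftrightarrow> (\<exists>w\<in>D n. mem n w y \<and> apx n w z)" for x y
    using that apx_refl apx_sym by (auto, meson+)
  then show ?case by (simp del: apx.simps)
qed auto

lemma tprov_sound: "tprov s p \<Longrightarrow> twfs s p \<and> (\<forall>e. wte e \<longrightarrow> sem e p)"
proof (induction rule: tprov.induct)
  case (tprov_ax p)
  then show ?case using tax_sound by blast
next
  case (tprov_gen q p n i)
  have "sem (e((n, i) := t)) q = sem e q" for e t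
    using tprov_gen by (intro sem_cong) auto
  then show ?case using tprov_gen wte_upd by fastforce
next
  case (tprov_exe p q n i)
  have "sem (e((n, i) := t)) q = sem e q" for e t
    using tprov_exe by (intro sem_cong) auto
  then show ?case using tprov_exe wte_upd by fastforce
qed auto

end

section \<open>From the model back to provability, and universal closure\<close>

theorem tprov_int:
  assumes "tprov s p" "twfs s p"
  shows "lprov s (Defs.int p)"
proof (rule ccontr)
  assume np: "\<not> lprov s (Defs.int p)"
  let ?q = "prime (star p)"
  have wfq: "lwfs s ?q" using assms by (intro lwfs_prime twfs_star)
  have "ncons s [lnot (negt ?q)]"
  proof -
    \<comment> \<open>Stability equates unprovability of the translation with consistency of its
      negation; this is what permits an argument by contraposition through classical models.\<close>
    have "nd s [] (lnot (lnot (negt ?q))) \<Longrightarrow> lprov s (negt ?q)"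
      using stable_negt[of s ?q] unfolding stable_def by (metis nd.simps(1))
    then show ?thesis using np wfq nd_notI[of s "lnot (negt ?q)" "[]"]
      by (auto simp: ncons_def int_def simp del: nd.simps)
  qed
  then obtain M where M: "henkin s M" "lnot (negt ?q) \<in> M" using henkin_extension by blast
  interpret henkin s M by fact
  \<comment> \<open>Every variable denotes itself, so satisfaction under \<open>e\<close> is
    satisfaction in the identity environment, to which the truth lemma applies.\<close>
  define e :: "nat \<times> nat \<Rightarrow> ltm" where "e = (\<lambda>(n, i). LV (psort n) i)"
  have "lenv e = lid" by (auto simp: lenv_def e_def fun_eq_iff)
  moreover have "wte e" by (simp add: wte_def e_def)
  ultimately have "sat s M lid ?q" using tprov_sound[OF assms(1)] by (metis sem_def)
  then have "negt ?q \<in> M" using truth wfq by simp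
  then show False using M(2) M_not wfq by simp
qed

text \<open>All three translations commute with universal quantifiers, so closure is repeated
  generalisation; the type bounds are those required by the generalisation rule.\<close>

lemma lprov_int_close:
  "lprov s (Defs.int p) \<Longrightarrow> (\<And>v. v \<in> set vs \<Longrightarrow> typeok s (fst v)) \<Longrightarrow>
    lprov s (Defs.int (foldr (\<lambda>v q. TAll (fst v) (snd v) q) vs p))"
proof (induction vs)
  case (Cons v vs)
  obtain n i where v: "v = (n, i)" by (cases v)
  have "typeok s (fst v)" by (rule Cons.prems) simp
  then have "typeok s n" by (simp add: v)
  moreover have "lprov s (Defs.int (foldr (\<lambda>v q. TAll (fst v) (snd v) q) vs p))"
    by (rule Cons.IH[OF Cons.prems(1)]) (use Cons.prems(2) in auto)
  ultimately show ?case by (simp add: v int_def lprov_all)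
qed simp

lemma tprov_int_tclose: "tprov s p \<Longrightarrow> twfs s p \<Longrightarrow> lprov s (Defs.int (tclose p))"
  unfolding tclose_def by (rule lprov_int_close[OF tprov_int]) (auto dest: tfv_typeok)

theorem theorem12p3:
  shows "(\<forall>s p. twfs (Some s) p \<longrightarrow> tprov (Some s) p \<longrightarrow> lprov (Some s) (Defs.int (tclose p)))
       \<and> (\<forall>p. twfs None p \<longrightarrow> tprov None p \<longrightarrow> lprov None (Defs.int (tclose p)))"
  by (blast intro: tprov_int_tclose)

end
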